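(* Let $\mathbf{U}_0$ be the tangent vector (as a function of arc length) of a curve $\gamma_0\in\mathcal{F}$, and assume that for each $\mu\in\mathbb{R}$ sufficiently close to $0$, $\mathbf{U}(\mu,\cdot)$ is the tangent vector of a closed curve $\gamma_\mu$ in $\mathbb{R}^3$ of length $2\pi$ parametrized by arc length, i.e. $\mathbf{U}(\mu,\cdot)$ is $2\pi$-periodic with $$|\mathbf{U}(\mu,s)|\equiv 1,\qquad \int_0^{2\pi}\mathbf{U}(\mu,s)\,ds=0 .$$ Suppose that $\mathbf{U}(\mu,s)$ has an expansion $$\mathbf{U}(\mu,s)=\mathbf{U}_0(s)+\mu\,\mathbf{u}_1(s)+\mu^2\mathbf{u}_2(s)+o(\mu^2)\qquad(\mu\to0)$$ in $H^1$ (of $2\pi$-periodic $\mathbb{R}^3$-valued functions). Then there exists a positive number $c$ such that $$e_0(\gamma_\mu)\ge e_0(\gamma_0)\qquad\text{for } |\mu|<c .$$ The inequality is strict unless $\gamma_\mu$ belongs again to the family $\mathcal{F}$.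
   Context: For a closed curve $\gamma$ of length $2\pi$ in $\mathbb{R}^3$, parametrized by arc length $s$ with unit tangent vector $\mathbf{U}(s)$ and curvature $\kappa(s)=|\mathbf{U}'(s)|$, let $H_\gamma=-\frac{d^2}{ds^2}+\kappa^2(s)$ act on square integrable $2\pi$-periodic functions, and let $$e_0(\gamma)=\inf\operatorname{spec}H_\gamma=\inf_{\Phi\neq0}\frac{\int_0^{2\pi}\big((\Phi')^2+\kappa^2\Phi^2\big)\,ds}{\int_0^{2\pi}|\Phi|^2\,ds},$$ the infimum being over $2\pi$-periodic functions $\Phi$ in $H^1$. $\mathcal{F}$ denotes the family of closed curves of length $2\pi$ obtained by translations, rotations and dilations from planar loops whose tangent vector at arc length $s$ is proportional (with a positive scalar factor depending on $s$) to $(\cos s,\beta\sin s,0)$ for some constant $0<\beta\le1$. Equivalently, the curves in $\mathcal{F}$ are those whose unit tangent vector is $\mathbf{U}(s)=\mathbf{X}_0(s)/|\mathbf{X}_0(s)|$ with $\mathbf{X}_0(s)=\cos(s)\,\mathbf{v}_1+\sin(s)\,\mathbf{v}_2$ for some linearly independent $\mathbf{v}_1,\mathbf{v}_2\in\mathbb{R}^3$. Every $\gamma\in\mathcal{F}$ has $e_0(\gamma)=1$. *)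

theory Defs
  imports "HOL-Analysis.Analysis"
begin

section \<open>The Sobolev space of periodic functions\<close>

text \<open>Elements of \<open>H\<^sup>1\<close> are represented by their continuous representative, so that \<open>f\<close> has weak
  derivative \<open>g\<close> iff \<open>f\<close> is the indefinite Lebesgue integral of \<open>g\<close>. The derivative \<open>g\<close> only
  matters on one period.\<close>

definition has_periodic_h1_deriv ::
    "(real \<Rightarrow> 'a::euclidean_space) \<Rightarrow> (real \<Rightarrow> 'a) \<Rightarrow> bool" where
  "has_periodic_h1_deriv f g \<longleftrightarrow>
     (\<forall>s. f (s + 2 * pi) = f s) \<and>
     set_borel_measurable lborel {0..2*pi} g \<and>
     set_integrable lborel {0..2*pi} (\<lambda>s. (norm (g s))\<^sup>2) \<and>
     (\<forall>s\<in>{0..2*pi}. f s = f 0 + (LINT t:{0..s}|lborel. g t))"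

definition periodic_h1 :: "(real \<Rightarrow> 'a::euclidean_space) set" where
  "periodic_h1 = {f. \<exists>g. has_periodic_h1_deriv f g}"

text \<open>The weak derivative is unique only up to null sets on \<open>[0, 2\<pi>]\<close>; \<open>h1_deriv\<close> chooses one, and
  it is used below only under integrals over \<open>[0, 2\<pi>]\<close>, which do not depend on the choice.\<close>

definition h1_deriv :: "(real \<Rightarrow> 'a::euclidean_space) \<Rightarrow> real \<Rightarrow> 'a" where
  "h1_deriv f = (SOME g. has_periodic_h1_deriv f g)"

definition h1_norm :: "(real \<Rightarrow> 'a::euclidean_space) \<Rightarrow> real" where
  "h1_norm f = sqrt ((LINT s:{0..2*pi}|lborel. (norm (f s))\<^sup>2)
                   + (LINT s:{0..2*pi}|lborel. (norm (h1_deriv f s))\<^sup>2))"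

section \<open>Closed curves of length \<open>2\<pi>\<close>\<close>

definition tangent :: "(real \<Rightarrow> real^3) \<Rightarrow> real \<Rightarrow> real^3" where
  "tangent \<gamma> s = vector_derivative \<gamma> (at s)"

definition arclength_loop :: "(real \<Rightarrow> real^3) \<Rightarrow> bool" where
  "arclength_loop \<gamma> \<longleftrightarrow>
     (\<forall>s. \<gamma> differentiable (at s)) \<and> (\<forall>s. norm (tangent \<gamma> s) = 1) \<and> (\<forall>s. \<gamma> (s + 2 * pi) = \<gamma> s)"

text \<open>\<open>\<kappa> = |U'|\<close>, as an almost everywhere defined function, for loops whose tangent \<open>U\<close> is in
  \<open>H\<^sup>1\<close>.\<close>

definition curvature :: "(real \<Rightarrow> real^3) \<Rightarrow> real \<Rightarrow> real" where
  "curvature \<gamma> s = norm (h1_deriv (tangent \<gamma>) s)"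

text \<open>The bottom of the spectrum of \<open>- d\<^sup>2/ds\<^sup>2 + \<kappa>\<^sup>2\<close>, as the infimum of the Rayleigh quotient.\<close>

definition e0 :: "(real \<Rightarrow> real^3) \<Rightarrow> real" where
  "e0 \<gamma> = (INF \<Phi> \<in> {\<Phi> :: real \<Rightarrow> real. \<Phi> \<in> periodic_h1 \<and> \<Phi> \<noteq> (\<lambda>_. 0)}.
      (LINT s:{0..2*pi}|lborel. (h1_deriv \<Phi> s)\<^sup>2 + (curvature \<gamma> s)\<^sup>2 * (\<Phi> s)\<^sup>2)
    / (LINT s:{0..2*pi}|lborel. (\<Phi> s)\<^sup>2))"

definition family_F :: "(real \<Rightarrow> real^3) set" where
  "family_F = {\<gamma>. arclength_loop \<gamma> \<and>
     (\<exists>v\<^sub>1 v\<^sub>2. v\<^sub>1 \<noteq> v\<^sub>2 \<and> independent {v\<^sub>1, v\<^sub>2} \<and>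
       (\<forall>s. let X\<^sub>0 = cos s *\<^sub>R v\<^sub>1 + sin s *\<^sub>R v\<^sub>2 in tangent \<gamma> s = X\<^sub>0 /\<^sub>R norm X\<^sub>0))}"

section \<open>Consistency of the definitions\<close>

text \<open>Continuous tangents of loops are exactly the periodic, unit-length, mean-zero functions.\<close>

lemma arclength_loop_tangent_iff:
  fixes U :: "real \<Rightarrow> real^3"
  assumes cont: "continuous_on UNIV U"
  shows "(\<exists>\<gamma>. arclength_loop \<gamma> \<and> tangent \<gamma> = U) \<longleftrightarrow>
     (\<forall>s. U (s + 2 * pi) = U s) \<and> (\<forall>s. norm (U s) = 1) \<and> (U has_integral 0) {0..2*pi}"
    (is "?L \<longleftrightarrow> ?R")
proof
  assume ?L
  then obtain \<gamma> where g: "arclength_loop \<gamma>" and t: "tangent \<gamma> = U" by blast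
  have d: "(\<gamma> has_vector_derivative U s) (at s)" for s
    using g unfolding arclength_loop_def t[symmetric] tangent_def
    by (simp add: vector_derivative_works)
  have per: "\<gamma> (s + 2 * pi) = \<gamma> s" for s using g by (simp add: arclength_loop_def)
  have "U (s + 2 * pi) = U s" for s
  proof -
    have "((\<lambda>s. s + 2 * pi) has_vector_derivative 1) (at s)"
      by (auto intro!: derivative_eq_intros)
    from vector_diff_chain_at[OF this d]
    have "(\<gamma> \<circ> (\<lambda>s. s + 2 * pi) has_vector_derivative U (s + 2 * pi)) (at s)" by simp
    moreover have "\<gamma> \<circ> (\<lambda>s. s + 2 * pi) = \<gamma>" using per by auto
    ultimately show ?thesis using d vector_derivative_unique_at by metis
  qed
  moreover have "(U has_integral (\<gamma> (2*pi) - \<gamma> 0)) {0..2*pi}"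
    by (rule fundamental_theorem_of_calculus)
      (auto intro: d has_vector_derivative_at_within)
  moreover have "\<gamma> (2*pi) = \<gamma> 0" using per[of 0] by simp
  moreover have "norm (U s) = 1" for s using g t by (auto simp: arclength_loop_def)
  ultimately show ?R by simp
next
  assume R: ?R
  have "\<exists>F. \<forall>x::real. - \<infinity> < ereal x \<longrightarrow> ereal x < \<infinity> \<longrightarrow> (F has_vector_derivative U x) (at x)"
    by (rule einterval_antiderivative)
      (use cont in \<open>auto simp: continuous_on_eq_continuous_at\<close>)
  then obtain \<gamma> where d: "\<And>s. (\<gamma> has_vector_derivative U s) (at s)" by auto
  have t: "tangent \<gamma> = U" unfolding tangent_def using d by (auto intro: vector_derivative_at)
  have d0: "((\<lambda>s. \<gamma> (s + 2 * pi) - \<gamma> s) has_vector_derivative 0) (at s)" for s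
  proof -
    have "((\<lambda>s. s + 2 * pi) has_vector_derivative 1) (at s)"
      by (auto intro!: derivative_eq_intros)
    from vector_diff_chain_at[OF this d]
    have "((\<lambda>s. \<gamma> (s + 2 * pi)) has_vector_derivative U s) (at s)" using R by (simp add: o_def)
    from has_vector_derivative_diff[OF this d] show ?thesis by simp
  qed
  obtain c where c: "\<And>s. \<gamma> (s + 2 * pi) - \<gamma> s = c"
    using has_vector_derivative_zero_constant[of UNIV "\<lambda>s. \<gamma> (s + 2 * pi) - \<gamma> s"] d0 by auto
  have "(U has_integral (\<gamma> (2*pi) - \<gamma> 0)) {0..2*pi}"
    by (rule fundamental_theorem_of_calculus)
      (auto intro: d has_vector_derivative_at_within)
  with R have "\<gamma> (2*pi) - \<gamma> 0 = 0" using has_integral_unique by blast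
  with c[of 0] have "c = 0" by simp
  with c have "\<gamma> (s + 2 * pi) = \<gamma> s" for s by (metis eq_iff_diff_eq_0)
  then have "arclength_loop \<gamma>"
    unfolding arclength_loop_def t using R d by (auto intro: differentiableI_vector)
  with t show ?L by blast
qed

lemma independent_pair_iff:
  fixes v w :: "'a::real_vector"
  shows "v \<noteq> w \<and> independent {v, w} \<longleftrightarrow> (\<forall>a b. a *\<^sub>R v + b *\<^sub>R w = 0 \<longrightarrow> a = 0 \<and> b = 0)"
    (is "?L \<longleftrightarrow> ?R")
proof
  assume L: ?L
  show ?R
  proof (intro allI impI)
    fix a b assume e: "a *\<^sub>R v + b *\<^sub>R w = 0"
    define u where "u x = (if x = v then a else b)" for x
    have "(\<Sum>x\<in>{v, w}. u x *\<^sub>R x) = 0" using L e by (auto simp: u_def)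
    moreover have "\<forall>u. (\<Sum>x\<in>{v, w}. u x *\<^sub>R x) = 0 \<longrightarrow> (\<forall>x\<in>{v, w}. u x = 0)"
      using L unfolding independent_explicit_finite_subsets by blast
    ultimately have "\<forall>x\<in>{v, w}. u x = 0" by blast
    then show "a = 0 \<and> b = 0" using L by (auto simp: u_def)
  qed
next
  assume R: ?R
  have ne: "v \<noteq> w" using R[rule_format, of 1 "-1"] by auto
  moreover have "independent {v, w}"
    using ne R by (subst independent_if_scalars_zero) auto
  ultimately show ?L by blast
qed

lemma rotation_matrix_exists:
  fixes e\<^sub>1 e\<^sub>2 :: "real^3"
  assumes "norm e\<^sub>1 = 1" "norm e\<^sub>2 = 1" "e\<^sub>1 \<bullet> e\<^sub>2 = 0"
  obtains A :: "real^3^3" where "rotation_matrix A" "column 1 A = e\<^sub>1" "column 2 A = e\<^sub>2"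
proof -
  define e\<^sub>3 where "e\<^sub>3 = cross3 e\<^sub>1 e\<^sub>2"
  define B :: "real^3^3" where "B = vector [e\<^sub>1, e\<^sub>2, e\<^sub>3]"
  have n3: "norm e\<^sub>3 = 1"
    using norm_cross_dot[of e\<^sub>1 e\<^sub>2] assms by (simp add: e\<^sub>3_def power2_eq_1_iff)
      (use norm_ge_zero[of "cross3 e\<^sub>1 e\<^sub>2"] in linarith)
  have o3: "e\<^sub>1 \<bullet> e\<^sub>3 = 0" "e\<^sub>2 \<bullet> e\<^sub>3 = 0"
    by (simp_all add: e\<^sub>3_def dot_cross_self)
  have row: "row 1 B = e\<^sub>1" "row 2 B = e\<^sub>2" "row 3 B = e\<^sub>3"
    by (simp_all add: B_def row_def vector_def vec_eq_iff)
  have "orthogonal_matrix B"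
    unfolding orthogonal_matrix_orthonormal_rows
    using assms o3 n3 by (simp add: forall_3 row orthogonal_def inner_commute)
  moreover have "det B = cross3 e\<^sub>1 e\<^sub>2 \<bullet> e\<^sub>3"
    unfolding B_def by (simp add: cross3_simps)
  then have "det B = 1"
    using n3 by (simp add: e\<^sub>3_def dot_square_norm)
  ultimately have "rotation_matrix (transpose B)"
    by (simp add: rotation_matrix_def orthogonal_matrix_transpose)
  then show ?thesis using row by (intro that[of "transpose B"]) simp_all
qed

lemma matrix_vector_mult_vector3:
  fixes A :: "real^3^3"
  shows "A *v vector [x, y, 0] = x *\<^sub>R column 1 A + y *\<^sub>R column 2 A"
  by (simp add: matrix_vector_mult_def column_def vec_eq_iff sum_3 vector_def algebra_simps)

text \<open>Up to translation, rotation and choice of the starting point, the curves in \<open>family_F\<close> are the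
  planar loops with tangent proportional to \<open>(cos s, \<beta> sin s, 0)\<close>, \<open>0 < \<beta> \<le> 1\<close>.\<close>

lemma family_F_iff:
  "\<gamma> \<in> family_F \<longleftrightarrow> arclength_loop \<gamma> \<and>
     (\<exists>\<beta> s\<^sub>0. \<exists>A::real^3^3. 0 < \<beta> \<and> \<beta> \<le> 1 \<and> rotation_matrix A \<and>
       (\<forall>s. \<exists>r>0. tangent \<gamma> s = r *\<^sub>R (A *v vector [cos (s - s\<^sub>0), \<beta> * sin (s - s\<^sub>0), 0])))"
    (is "_ \<longleftrightarrow> _ \<and> ?R")
proof -
  have "?R" if "arclength_loop \<gamma>" and indep: "v\<^sub>1 \<noteq> v\<^sub>2 \<and> independent {v\<^sub>1, v\<^sub>2}"
    and tan: "\<And>s. tangent \<gamma> s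
        = (cos s *\<^sub>R v\<^sub>1 + sin s *\<^sub>R v\<^sub>2) /\<^sub>R norm (cos s *\<^sub>R v\<^sub>1 + sin s *\<^sub>R v\<^sub>2)" for v\<^sub>1 v\<^sub>2
  proof -
    define X where "X s = cos s *\<^sub>R v\<^sub>1 + sin s *\<^sub>R v\<^sub>2" for s
    have X0: "X s \<noteq> 0" for s
      using indep[unfolded independent_pair_iff] sin_zero_abs_cos_one[of s] unfolding X_def by force
    have Xpi: "X (s + pi/2 + pi/2) = - X s" for s by (simp add: X_def add.assoc)
    define g where "g s = X s \<bullet> X (s + pi/2)" for s
    have gpi: "g (s + pi/2) = - g s" for s unfolding g_def Xpi by (simp add: inner_commute)
    have "isCont g s" for s unfolding g_def X_def by (intro continuous_intros)
    then have cont: "continuous_on {0..pi/2} g"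
      by (simp add: continuous_at_imp_continuous_on)
    have "\<exists>t. g t = 0"
    proof (cases "g 0 \<le> 0")
      case True
      then show ?thesis using IVT'[of g 0 0 "pi/2"] gpi[of 0] cont by auto
    next
      case False
      then show ?thesis using IVT2'[of g "pi/2" 0 0] gpi[of 0] cont by auto
    qed
    then obtain t where t: "g t = 0" by blast
    obtain s\<^sub>0 where s0: "g s\<^sub>0 = 0" "norm (X (s\<^sub>0 + pi/2)) \<le> norm (X s\<^sub>0)"
    proof (cases "norm (X (t + pi/2)) \<le> norm (X t)")
      case True then show ?thesis using t that by blast
    next
      case False
      then show ?thesis using t gpi[of t] Xpi[of t] by (intro that[of "t + pi/2"]) auto
    qed
    define w\<^sub>1 w\<^sub>2 where "w\<^sub>1 = X s\<^sub>0" and "w\<^sub>2 = X (s\<^sub>0 + pi/2)"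
    have Xw: "X s = cos (s - s\<^sub>0) *\<^sub>R w\<^sub>1 + sin (s - s\<^sub>0) *\<^sub>R w\<^sub>2" for s
    proof -
      have c: "cos s = cos (s - s\<^sub>0) * cos s\<^sub>0 - sin (s - s\<^sub>0) * sin s\<^sub>0"
        using cos_add[of "s - s\<^sub>0" s\<^sub>0] by simp
      have d: "sin s = sin (s - s\<^sub>0) * cos s\<^sub>0 + cos (s - s\<^sub>0) * sin s\<^sub>0"
        using sin_add[of "s - s\<^sub>0" s\<^sub>0] by simp
      show ?thesis
        unfolding X_def w\<^sub>1_def w\<^sub>2_def c d by (simp add: sin_add cos_add algebra_simps)
    qed
    have pos: "norm w\<^sub>1 > 0" "norm w\<^sub>2 > 0" using X0 by (auto simp: w\<^sub>1_def w\<^sub>2_def)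
    define \<beta> where "\<beta> = norm w\<^sub>2 / norm w\<^sub>1"
    have "norm (w\<^sub>1 /\<^sub>R norm w\<^sub>1) = 1" "norm (w\<^sub>2 /\<^sub>R norm w\<^sub>2) = 1"
      "(w\<^sub>1 /\<^sub>R norm w\<^sub>1) \<bullet> (w\<^sub>2 /\<^sub>R norm w\<^sub>2) = 0"
      using pos s0(1) by (auto simp: g_def w\<^sub>1_def w\<^sub>2_def)
    then obtain A :: "real^3^3" where A: "rotation_matrix A"
      "column 1 A = w\<^sub>1 /\<^sub>R norm w\<^sub>1" "column 2 A = w\<^sub>2 /\<^sub>R norm w\<^sub>2"
      by (rule rotation_matrix_exists)
    have "X s = norm w\<^sub>1 *\<^sub>R (A *v vector [cos (s - s\<^sub>0), \<beta> * sin (s - s\<^sub>0), 0])" for s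
      unfolding Xw matrix_vector_mult_vector3 A \<beta>_def using pos
      by (simp add: scaleR_add_right mult.assoc[symmetric] field_simps)
    then have "tangent \<gamma> s
        = (norm w\<^sub>1 / norm (X s)) *\<^sub>R (A *v vector [cos (s - s\<^sub>0), \<beta> * sin (s - s\<^sub>0), 0])" for s
      using tan[of s] unfolding X_def[symmetric]
      by (metis divide_inverse_commute scaleR_scaleR)
    moreover have "norm w\<^sub>1 / norm (X s) > 0" for s using pos X0 by simp
    moreover have "0 < \<beta>" "\<beta> \<le> 1"
      using pos s0(2) by (auto simp: \<beta>_def w\<^sub>1_def w\<^sub>2_def)
    ultimately show ?R using A(1) by blast
  qed
  moreover have "\<gamma> \<in> family_F" if loop: "arclength_loop \<gamma>" and R: ?R
  proof -
    obtain \<beta> s\<^sub>0 and A :: "real^3^3" where b: "0 < \<beta>" "\<beta> \<le> 1" and A: "rotation_matrix A"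
      and tan: "\<And>s. \<exists>r>0. tangent \<gamma> s = r *\<^sub>R (A *v vector [cos (s - s\<^sub>0), \<beta> * sin (s - s\<^sub>0), 0])"
      using R by blast
    define a b where "a = column 1 A" and "b = \<beta> *\<^sub>R column 2 A"
    have on: "norm (column 1 A) = 1" "norm (column 2 A) = 1" "column 1 A \<bullet> column 2 A = 0"
      using A unfolding rotation_matrix_def orthogonal_matrix_orthonormal_columns
      by (auto simp: orthogonal_def)
    define v\<^sub>1 v\<^sub>2 where "v\<^sub>1 = cos s\<^sub>0 *\<^sub>R a - sin s\<^sub>0 *\<^sub>R b" and "v\<^sub>2 = sin s\<^sub>0 *\<^sub>R a + cos s\<^sub>0 *\<^sub>R b"
    define X where "X s = cos s *\<^sub>R v\<^sub>1 + sin s *\<^sub>R v\<^sub>2" for s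
    have XA: "A *v vector [cos (s - s\<^sub>0), \<beta> * sin (s - s\<^sub>0), 0] = X s" for s
      unfolding matrix_vector_mult_vector3 X_def v\<^sub>1_def v\<^sub>2_def a_def b_def
      by (simp add: cos_diff sin_diff algebra_simps)
    have "tangent \<gamma> s = X s /\<^sub>R norm (X s)" for s
    proof -
      obtain r where r: "r > 0" "tangent \<gamma> s = r *\<^sub>R X s" using tan[of s] XA by auto
      moreover have "norm (tangent \<gamma> s) = 1" using loop by (simp add: arclength_loop_def)
      ultimately have "r * norm (X s) = 1" by simp
      then have "r = inverse (norm (X s))" using inverse_unique[of "norm (X s)" r]
        by (simp add: mult.commute)
      with r show ?thesis by simp
    qed
    moreover have "v\<^sub>1 \<noteq> v\<^sub>2 \<and> independent {v\<^sub>1, v\<^sub>2}"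
      unfolding independent_pair_iff
    proof (intro allI impI)
      fix x y assume e: "x *\<^sub>R v\<^sub>1 + y *\<^sub>R v\<^sub>2 = 0"
      define p q where "p = x * cos s\<^sub>0 + y * sin s\<^sub>0" and "q = y * cos s\<^sub>0 - x * sin s\<^sub>0"
      have e': "p *\<^sub>R column 1 A + (q * \<beta>) *\<^sub>R column 2 A = 0"
        using e by (simp add: p_def q_def v\<^sub>1_def v\<^sub>2_def a_def b_def algebra_simps)
      have "p = (p *\<^sub>R column 1 A + (q * \<beta>) *\<^sub>R column 2 A) \<bullet> column 1 A"
        using on by (simp add: inner_add_left dot_square_norm inner_commute[of "column 2 A" "column 1 A"])
      then have p: "p = 0" unfolding e' by simp
      have "q * \<beta> = (p *\<^sub>R column 1 A + (q * \<beta>) *\<^sub>R column 2 A) \<bullet> column 2 A"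
        using on by (simp add: inner_add_left dot_square_norm inner_commute[of "column 2 A" "column 1 A"])
      then have q: "q = 0" unfolding e' using b by simp
      have "p\<^sup>2 + q\<^sup>2 = (x\<^sup>2 + y\<^sup>2) * ((sin s\<^sub>0)\<^sup>2 + (cos s\<^sub>0)\<^sup>2)"
        unfolding p_def q_def by algebra
      then show "x = 0 \<and> y = 0" using p q by (simp add: sum_power2_eq_zero_iff)
    qed
    ultimately show ?thesis
      using loop unfolding family_F_def X_def Let_def by blast
  qed
  ultimately show ?thesis unfolding family_F_def Let_def by blast
qed

end

theory Submission
  imports Defs
begin

text \<open>
  For a loop with unit tangent \<open>U\<close> and a real test function \<open>\<Phi>\<close> put \<open>X = \<Phi> U\<close>. Since \<open>U\<close> is
  orthogonal to \<open>U'\<close>, the integral of \<open>|X'|\<^sup>2\<close> is that of \<open>\<Phi>'\<^sup>2 + \<kappa>\<^sup>2 \<Phi>\<^sup>2\<close>, and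
  \<open>|X|\<^sup>2 = \<Phi>\<^sup>2\<close>. So \<open>e\<^sub>0 \<ge> 1\<close> says that \<open>J(X) = \<integral>|X'|\<^sup>2 - |X|\<^sup>2\<close> is nonnegative on the maps \<open>X\<close>
  of direction \<open>\<plusminus>U\<close>, where \<open>U\<close> satisfies the closing condition \<open>\<integral>U = 0\<close>. The first harmonics
  \<open>cos s a + sin s b\<close> have \<open>J = 0\<close>; if they have no zero they satisfy the closing condition, because
  they change sign under \<open>s \<mapsto> s + \<pi>\<close>, and their directions are the tangents of the family \<open>F\<close>.
  The theorem says that these maps form a minimum of \<open>J\<close> under the closing condition that is
  nondegenerate in the transversal directions.

  Let \<open>X\<close> be near \<open>X\<^sub>0 = cos(s - s\<^sub>0) e\<^sub>1 + \<beta> sin(s - s\<^sub>0) e\<^sub>2\<close>, with \<open>r = |X\<^sub>0|\<close>, and let \<open>V\<close> be \<open>X\<close> minus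
  its first harmonics. Then \<open>J(X) = J(V)\<close>, and only the mean of \<open>V\<close> contributes negatively. The closing condition controls it:
  up to an error that is small compared with \<open>V\<close>, the component of \<open>V/r\<close>
  orthogonal to \<open>X\<^sub>0\<close> has integral zero (\<open>sgn_strict_derivative\<close>). The heart of
  the proof is the estimate \<open>coercive_vector\<close>, which bounds \<open>J(V)\<close> below by \<open>\<delta> \<integral>|V|\<^sup>2\<close> minus a
  multiple of the square of this linearised condition; the small error is then absorbed
  (\<open>local_minimum\<close>).

  Coercivity is read off from Fourier coefficients with respect to the polar angle \<open>\<theta>\<close> of \<open>X\<^sub>0\<close>. With
  \<open>\<kappa> = \<theta>' = \<beta>/r\<^sup>2\<close> and \<open>\<zeta> = exp(2i\<theta>)\<close> the functions \<open>E\<^sub>k = r \<zeta>\<^sup>k\<close> satisfy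
  \<open>E\<^sub>k'' + E\<^sub>k = (1 - 4k\<^sup>2) \<kappa>\<^sup>2 E\<^sub>k\<close>, so they diagonalise \<open>J\<close>, and only \<open>k = 0\<close> is negative. Moreover \<open>1/\<kappa>\<close>
  is the Poisson kernel \<open>\<Sum>\<^sub>k q\<^bsup>|k|\<^esup> \<zeta>\<^sup>k\<close> with \<open>q = (1 - \<beta>)/(1 + \<beta>) < 1\<close>. Hence the linearised condition
  bounds the zeroth coefficient by \<open>\<Sum>\<^sub>k q\<^bsup>k-1\<^esup> |v\<^sub>k| + q\<^sup>k |v\<^sub>-\<^sub>k|\<close> (\<open>coef0_planar\<close>, \<open>coef0_normal\<close>), and the
  Cauchy--Schwarz inequality leaves a gap because
  \<open>\<Sum>\<^sub>k (q\<^bsup>2k-2\<^esup> + q\<^bsup>2k\<^esup>)/(4k\<^sup>2 - 1) \<le> (1 + 2q\<^sup>2)/3 < 1\<close> (\<open>weight_sum_bound\<close>).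

  It remains to see that every test function with Rayleigh quotient close to 1 gives, after scaling,
  a map near \<open>X\<^sub>0\<close>. For the unperturbed tangent, \<open>J(g X\<^sub>0) = \<integral> g'\<^sup>2 r\<^sup>2\<close> forces \<open>g\<close> to be nearly
  constant (\<open>J_multiple_of_X0\<close>), and the perturbed curvature differs little because the expansion gives
  \<open>U(\<mu>, \<cdot>) \<rightarrow> U\<^sub>0\<close> in \<open>H\<^sup>1\<close> (\<open>near_minimizer\<close>). As for the strict inequality, if
  \<open>e\<^sub>0 = 1\<close>, then along a minimising sequence \<open>J\<close>, hence also \<open>V\<close>, tends to zero, and \<open>U\<close> is the direction of
  a limit of first harmonics (\<open>limit_direction\<close>).
\<close>

section \<open>Square-integrable functions on one period\<close>

text \<open>Lebesgue measure on one period. All functions are integrated against this finite measure, so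
  that integrability side conditions carry no interval.\<close>

definition circ :: "real measure" where
  "circ = restrict_space lborel {0..2*pi}"

lemma space_circ [simp]: "space circ = {0..2*pi}"
  by (simp add: circ_def)

lemma emeasure_circ: "emeasure circ {0..2*pi} = ennreal (2 * pi)"
  by (simp add: circ_def emeasure_restrict_space)

lemma finite_measure_circ: "finite_measure circ"
  by (rule finite_measureI) (simp add: emeasure_circ)

interpretation circ: finite_measure circ
  by (rule finite_measure_circ)

lemma measure_circ [simp]: "measure circ {0..2*pi} = 2 * pi"
  by (simp add: measure_def emeasure_circ)

lemma measurable_circ_lborel: "f \<in> borel_measurable lborel \<Longrightarrow> f \<in> borel_measurable circ"
  unfolding circ_def by (rule measurable_restrict_space1)

lemma measurable_circ_cont:
  fixes f :: "real \<Rightarrow> 'a::topological_space"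
  assumes "continuous_on {0..2*pi} f"
  shows "f \<in> borel_measurable circ"
  using borel_measurable_continuous_on_restrict[OF assms]
  by (simp add: circ_def cong: measurable_cong_sets)

lemma lebesgue_circ_eq: "(LINT s:{0..2*pi}|lborel. f s) = (LINT s|circ. f s)"
  for f :: "real \<Rightarrow> 'a::euclidean_space"
  by (simp add: circ_def integral_restrict_space set_lebesgue_integral_def)

lemma set_integrable_circ_iff: "set_integrable lborel {0..2*pi} f \<longleftrightarrow> integrable circ f"
  for f :: "real \<Rightarrow> 'a::euclidean_space"
  by (simp add: circ_def integrable_restrict_space set_integrable_def)

lemma set_measurable_circ_iff: "set_borel_measurable lborel {0..2*pi} f \<longleftrightarrow> f \<in> borel_measurable circ"
  for f :: "real \<Rightarrow> 'a::euclidean_space"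
  by (simp add: circ_def borel_measurable_restrict_space_iff set_borel_measurable_def)

text \<open>Membership in \<open>L\<^sup>2\<close> of one period.\<close>

definition sq_int :: "(real \<Rightarrow> 'a::euclidean_space) \<Rightarrow> bool" where
  "sq_int g \<longleftrightarrow> g \<in> borel_measurable circ \<and> integrable circ (\<lambda>s. (norm (g s))\<^sup>2)"

lemma sq_int_measurable [measurable_dest]: "sq_int g \<Longrightarrow> g \<in> borel_measurable circ"
  by (simp add: sq_int_def)

lemma integrable_circ_cont:
  fixes f :: "real \<Rightarrow> 'a::euclidean_space"
  assumes "continuous_on {0..2*pi} f"
  shows "integrable circ f"
  using borel_integrable_compact[OF compact_Icc assms]
  by (simp add: circ_def integrable_restrict_space)

lemma sq_int_cont:
  assumes "continuous_on {0..2*pi} f"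
  shows "sq_int f"
  unfolding sq_int_def
  by (intro conjI measurable_circ_cont integrable_circ_cont continuous_intros assms)

text \<open>The product is dominated by \<open>K (|f|\<^sup>2 + |g|\<^sup>2)\<close>. Stating it for bounded bilinear maps covers
  inner products, scalar multiples and products of complex functions at once.\<close>

lemma sq_int_bilinear:
  fixes p :: "'a::euclidean_space \<Rightarrow> 'b::euclidean_space \<Rightarrow> 'c::euclidean_space"
  assumes b: "bounded_bilinear p" and f: "sq_int f" and g: "sq_int g"
  shows "integrable circ (\<lambda>s. p (f s) (g s))"
proof -
  interpret bounded_bilinear p by (rule b)
  obtain K where K: "\<And>a b. norm (p a b) \<le> norm a * norm b * K" and "K \<ge> 0"
    using nonneg_bounded by blast
  show ?thesis
  proof (rule Bochner_Integration.integrable_bound)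
    show "integrable circ (\<lambda>s. K * ((norm (f s))\<^sup>2 + (norm (g s))\<^sup>2))"
      using f g by (auto simp: sq_int_def)
    have "continuous_on UNIV (\<lambda>x. p (fst x) (snd x))"
      by (intro continuous_on continuous_intros)
    then have "(\<lambda>x. p (fst x) (snd x)) \<in> borel_measurable borel"
      by (rule borel_measurable_continuous_onI)
    moreover have "(\<lambda>s. (f s, g s)) \<in> borel_measurable circ"
      using f g unfolding sq_int_def by (intro borel_measurable_Pair) auto
    ultimately have "(\<lambda>x. p (fst x) (snd x)) \<circ> (\<lambda>s. (f s, g s)) \<in> borel_measurable circ"
      by (rule measurable_comp[rotated])
    then show "(\<lambda>s. p (f s) (g s)) \<in> borel_measurable circ"
      by (simp add: o_def)
    show "AE s in circ. norm (p (f s) (g s)) \<le> norm (K * ((norm (f s))\<^sup>2 + (norm (g s))\<^sup>2))"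
    proof (intro AE_I2)
      fix s
      have "norm (f s) * norm (g s) \<le> (norm (f s))\<^sup>2 + (norm (g s))\<^sup>2"
        using sum_squares_bound[of "norm (f s)" "norm (g s)"] mult_nonneg_nonneg[OF norm_ge_zero[of "f s"] norm_ge_zero[of "g s"]]
        by linarith
      then have "norm (f s) * norm (g s) * K \<le> K * ((norm (f s))\<^sup>2 + (norm (g s))\<^sup>2)"
        using \<open>K \<ge> 0\<close> by (simp add: mult.commute mult_left_mono)
      with K[of "f s" "g s"] show "norm (p (f s) (g s)) \<le> norm (K * ((norm (f s))\<^sup>2 + (norm (g s))\<^sup>2))"
        using \<open>K \<ge> 0\<close> by simp
    qed
  qed
qed

lemmas sq_int_inner = sq_int_bilinear[OF bounded_bilinear_inner]

lemma sq_int_norm_mult: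
  assumes "sq_int f" "sq_int g"
  shows "integrable circ (\<lambda>s. norm (f s) * norm (g s))"
proof -
  have "sq_int (\<lambda>s. norm (f s))" "sq_int (\<lambda>s. norm (g s))"
    using assms by (auto simp: sq_int_def)
  from sq_int_bilinear[OF bounded_bilinear_mult this] show ?thesis .
qed

lemma sq_int_norm2: "sq_int f \<Longrightarrow> integrable circ (\<lambda>s. (norm (f s))\<^sup>2)"
  by (simp add: sq_int_def)

lemma sq_int_integrable: 
  assumes "sq_int f" shows "integrable circ f"
proof -
  have "integrable circ (\<lambda>s. 1 *\<^sub>R f s)"
    by (rule sq_int_bilinear[OF bounded_bilinear_scaleR _ assms])
      (intro sq_int_cont continuous_intros)
  then show ?thesis by simp
qed

lemma sq_int_add:
  assumes f: "sq_int f" and g: "sq_int g" shows "sq_int (\<lambda>s. f s + g s)"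
proof -
  have "(norm (f s + g s))\<^sup>2 = (norm (f s))\<^sup>2 + 2 * (f s \<bullet> g s) + (norm (g s))\<^sup>2" for s
    by (simp add: power2_norm_eq_inner algebra_simps inner_commute)
  then show ?thesis using f g sq_int_inner[OF f g] unfolding sq_int_def by auto
qed

lemma sq_int_bounded_bilinear:
  fixes p :: "'a::euclidean_space \<Rightarrow> 'b::euclidean_space \<Rightarrow> 'c::euclidean_space"
  assumes b: "bounded_bilinear p" and f: "continuous_on {0..2*pi} f" and g: "sq_int g"
  shows "sq_int (\<lambda>s. p (f s) (g s))"
proof -
  interpret bounded_bilinear p by (rule b)
  obtain K where K: "\<And>a b. norm (p a b) \<le> norm a * norm b * K" and "K \<ge> 0"
    using nonneg_bounded by blast
  have "bounded (f ` {0..2*pi})"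
    by (intro compact_imp_bounded compact_continuous_image f compact_Icc)
  then obtain B where B: "\<And>s. s \<in> {0..2*pi} \<Longrightarrow> norm (f s) \<le> B"
    unfolding bounded_iff by blast
  have m: "(\<lambda>s. p (f s) (g s)) \<in> borel_measurable circ"
    using sq_int_bilinear[OF b sq_int_cont[OF f] g] by auto
  moreover have "integrable circ (\<lambda>s. (norm (p (f s) (g s)))\<^sup>2)"
  proof (rule Bochner_Integration.integrable_bound)
    show "integrable circ (\<lambda>s. (B * K)\<^sup>2 * (norm (g s))\<^sup>2)"
      using g by (auto simp: sq_int_def)
    show "(\<lambda>s. (norm (p (f s) (g s)))\<^sup>2) \<in> borel_measurable circ" using m by simp
    show "AE s in circ. norm ((norm (p (f s) (g s)))\<^sup>2) \<le> norm ((B * K)\<^sup>2 * (norm (g s))\<^sup>2)"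
    proof (intro AE_I2)
      fix s assume "s \<in> space circ"
      then have "norm (f s) \<le> B" using B by simp
      then have "norm (f s) * norm (g s) * K \<le> B * norm (g s) * K"
        using \<open>K \<ge> 0\<close> by (intro mult_right_mono) auto
      then have "norm (p (f s) (g s)) \<le> B * K * norm (g s)" 
        using K[of "f s" "g s"] by (simp add: mult_ac)
      then have "(norm (p (f s) (g s)))\<^sup>2 \<le> (B * K * norm (g s))\<^sup>2"
        by (intro power_mono) auto
      then show "norm ((norm (p (f s) (g s)))\<^sup>2) \<le> norm ((B * K)\<^sup>2 * (norm (g s))\<^sup>2)"
        by (simp add: power_mult_distrib)
    qed
  qed
  ultimately show ?thesis by (simp add: sq_int_def)
qed

lemma sq_int_scaleR: "sq_int g \<Longrightarrow> sq_int (\<lambda>s. c *\<^sub>R g s)"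
  by (rule sq_int_bounded_bilinear[OF bounded_bilinear_scaleR]) (auto intro: continuous_intros)

lemma sq_int_diff: "sq_int f \<Longrightarrow> sq_int g \<Longrightarrow> sq_int (\<lambda>s. f s - g s)"
  using sq_int_add[of f "\<lambda>s. (-1) *\<^sub>R g s"] sq_int_scaleR[of g "-1"] by simp

lemma sq_int_linear:
  fixes T :: "'a::euclidean_space \<Rightarrow> 'b::euclidean_space"
  assumes T: "bounded_linear T" and g: "sq_int g" shows "sq_int (\<lambda>s. T (g s))"
proof -
  interpret bounded_linear T by (rule T)
  have "bounded_bilinear (\<lambda>(a::real) x. a *\<^sub>R T x)"
    by (rule bounded_bilinear.comp[OF bounded_bilinear_scaleR bounded_linear_ident T])
  from sq_int_bounded_bilinear[OF this continuous_on_const g, of 1] show ?thesis by simp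
qed

lemma quadratic_nonneg_discriminant:
  fixes a b c :: real
  assumes "\<And>x. a * x\<^sup>2 + 2 * b * x + c \<ge> 0" and "a \<ge> 0"
  shows "b\<^sup>2 \<le> a * c"
proof (cases "a = 0")
  case True
  have "b = 0"
  proof (rule ccontr)
    assume "b \<noteq> 0"
    then show False using assms(1)[of "- (c + 1) / (2 * b)"] True by (simp add: field_simps)
  qed
  then show ?thesis using True by simp
next
  case False
  then have "a > 0" using assms(2) by simp
  have "a * (- b / a)\<^sup>2 + 2 * b * (- b / a) + c = c - b\<^sup>2 / a"
    using False by (simp add: power2_eq_square field_simps)
  then have "b\<^sup>2 / a \<le> c" using assms(1)[of "- b / a"] by simp
  then show ?thesis using \<open>a > 0\<close> by (simp add: field_simps)
qed

lemma Cauchy_Schwarz_circ: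
  assumes f: "sq_int f" and g: "sq_int g"
  shows "(LINT s|circ. norm (f s) * norm (g s))\<^sup>2 \<le> (LINT s|circ. (norm (f s))\<^sup>2) * (LINT s|circ. (norm (g s))\<^sup>2)"
proof (rule quadratic_nonneg_discriminant)
  note i = sq_int_norm2[OF f] sq_int_norm2[OF g] sq_int_norm_mult[OF f g]
  fix x :: real
  have "0 \<le> (LINT s|circ. (x * norm (f s) + norm (g s))\<^sup>2)" by simp
  also have "(\<lambda>s. (x * norm (f s) + norm (g s))\<^sup>2) = (\<lambda>s. x\<^sup>2 * (norm (f s))\<^sup>2 + 2 * x * (norm (f s) * norm (g s)) + (norm (g s))\<^sup>2)"
    by (simp add: power2_eq_square algebra_simps)
  also have "(LINT s|circ. x\<^sup>2 * (norm (f s))\<^sup>2 + 2 * x * (norm (f s) * norm (g s)) + (norm (g s))\<^sup>2)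
    = x\<^sup>2 * (LINT s|circ. (norm (f s))\<^sup>2) + 2 * x * (LINT s|circ. norm (f s) * norm (g s)) + (LINT s|circ. (norm (g s))\<^sup>2)"
    using i by simp
  finally show "0 \<le> (LINT s|circ. (norm (f s))\<^sup>2) * x\<^sup>2 + 2 * (LINT s|circ. norm (f s) * norm (g s)) * x + (LINT s|circ. (norm (g s))\<^sup>2)"
    by (simp add: mult_ac)
qed simp

section \<open>Functions with square-integrable derivative\<close>

abbreviation int_Icc :: "real \<Rightarrow> real \<Rightarrow> (real \<Rightarrow> 'a::euclidean_space) \<Rightarrow> 'a" where
  "int_Icc a b f \<equiv> LINT t|circ. indicator {a..b} t *\<^sub>R f t"

lemma integral_indicator_Icc:
  assumes "0 \<le> a" "a \<le> b" "b \<le> 2*pi"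
  shows "(LINT t|circ. indicator {a..b} t) = b - a"
proof -
  have s: "{a..b} \<in> sets circ"
    using assms by (auto simp: circ_def sets_restrict_space_iff)
  have "(LINT t|circ. indicator {a..b} t) = measure circ {a..b}"
    using s assms by (simp add: Int_absorb1)
  also have "\<dots> = b - a"
    using assms by (simp add: circ_def measure_restrict_space)
  finally show ?thesis .
qed

lemma borel_measurable_circ_indicator [measurable]:
  "A \<in> sets borel \<Longrightarrow> indicator A \<in> borel_measurable circ"
  by (rule measurable_circ_lborel) simp

lemma AE_circ_neq: "AE t in circ. t \<noteq> a"
  unfolding circ_def by (subst AE_restrict_space_iff) (auto intro: AE_mp[OF AE_lborel_singleton])

lemma integrable_indicator_circ:
  fixes f :: "real \<Rightarrow> 'a::euclidean_space"
  assumes "A \<in> sets borel" "integrable circ f"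
  shows "integrable circ (\<lambda>t. indicator A t *\<^sub>R f t)"
proof (rule Bochner_Integration.integrable_bound[OF assms(2)])
  show "(\<lambda>t. indicator A t *\<^sub>R f t) \<in> borel_measurable circ"
    using assms by (intro borel_measurable_scaleR borel_measurable_circ_indicator) auto
qed (auto simp: indicator_def)

lemma integral_indicator_split:
  fixes h :: "real \<Rightarrow> 'a::euclidean_space"
  assumes h: "integrable circ h" and ab: "0 \<le> a" "a \<le> b"
  shows "(int_Icc a b h) = (int_Icc 0 b h) - (int_Icc 0 a h)"
proof -
  have "(int_Icc 0 b h) - (int_Icc 0 a h) = (LINT t|circ. indicator {0..b} t *\<^sub>R h t - indicator {0..a} t *\<^sub>R h t)"
    by (rule Bochner_Integration.integral_diff[symmetric]) (auto intro!: integrable_indicator_circ h)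
  also have "\<dots> = (int_Icc a b h)"
  proof (rule integral_cong_AE)
    show "AE t in circ. indicator {0..b} t *\<^sub>R h t - indicator {0..a} t *\<^sub>R h t = indicator {a..b} t *\<^sub>R h t"
      using AE_circ_neq[of a] by eventually_elim (use ab in \<open>auto simp: indicator_def\<close>)
  qed (use h in \<open>auto intro!: borel_measurable_scaleR borel_measurable_circ_indicator borel_measurable_diff\<close>)
  finally show ?thesis by simp
qed

lemma sq_int_indicator:
  assumes "A \<in> sets borel" "sq_int f"
  shows "sq_int (\<lambda>t. indicator A t *\<^sub>R f t)"
proof -
  have "(\<lambda>t. indicator A t *\<^sub>R f t) \<in> borel_measurable circ"
    using assms by (intro borel_measurable_scaleR borel_measurable_circ_indicator) (auto simp: sq_int_def)
  moreover have "(norm (indicator A t *\<^sub>R f t))\<^sup>2 = indicator A t *\<^sub>R (norm (f t))\<^sup>2" for t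
    by (simp add: indicator_def)
  ultimately show ?thesis
    using integrable_indicator_circ[OF assms(1) sq_int_norm2[OF assms(2)]] by (simp add: sq_int_def)
qed

text \<open>The part of \<open>has_periodic_h1_deriv\<close> without periodicity: it also covers factors such as affine
  functions, with which periodic functions get multiplied on subintervals.\<close>

definition has_l2_deriv :: "(real \<Rightarrow> 'a::euclidean_space) \<Rightarrow> (real \<Rightarrow> 'a) \<Rightarrow> bool" where
  "has_l2_deriv f g \<longleftrightarrow> sq_int g \<and>
    (\<forall>a b. 0 \<le> a \<longrightarrow> a \<le> b \<longrightarrow> b \<le> 2 * pi \<longrightarrow> f b - f a = (int_Icc a b g))"

lemma h1_iff:
  fixes f g :: "real \<Rightarrow> 'a::euclidean_space"
  shows "has_periodic_h1_deriv f g \<longleftrightarrow> (\<forall>s. f (s + 2 * pi) = f s) \<and> has_l2_deriv f g"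
  (is "?L \<longleftrightarrow> ?R")
proof -
  have sq: "set_borel_measurable lborel {0..2*pi} g \<and> set_integrable lborel {0..2*pi} (\<lambda>s. (norm (g s))\<^sup>2) \<longleftrightarrow> sq_int g"
    by (simp add: set_measurable_circ_iff set_integrable_circ_iff sq_int_def)
  have e: "(LINT t:{0..s}|lborel. g t) = (int_Icc 0 s g)" if "s \<in> {0..2*pi}" for s
  proof -
    have "(int_Icc 0 s g) = (LBINT t. indicator {0..2*pi} t *\<^sub>R indicator {0..s} t *\<^sub>R g t)"
      unfolding circ_def by (rule integral_restrict_space) simp
    also have "\<dots> = (LBINT t. indicator {0..s} t *\<^sub>R g t)"
      by (rule Bochner_Integration.integral_cong) (use that in \<open>auto simp: indicator_def\<close>)
    finally show ?thesis by (simp add: set_lebesgue_integral_def)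
  qed
  have "?L \<Longrightarrow> f b - f a = (int_Icc a b g)" if "0 \<le> a" "a \<le> b" "b \<le> 2*pi" for a b
  proof -
    assume L: ?L
    then have g: "integrable circ g" using sq by (auto simp: has_periodic_h1_deriv_def intro: sq_int_integrable)
    have "f b - f a = (int_Icc 0 b g) - (int_Icc 0 a g)"
    proof -
      have "f s = f 0 + (int_Icc 0 s g)" if s: "s \<in> {0..2*pi}" for s
    proof -
      have "f s = f 0 + (LINT t:{0..s}|lborel. g t)"
        using L s unfolding has_periodic_h1_deriv_def by blast
      then show ?thesis unfolding e[OF s] .
    qed
      from this[of a] this[of b] show ?thesis using that by (auto simp: algebra_simps)
    qed
    also have "\<dots> = (int_Icc a b g)"
      by (rule integral_indicator_split[symmetric]) (use g that in auto)
    finally show ?thesis .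
  qed
  moreover have ?L if R: ?R
    unfolding has_periodic_h1_deriv_def
  proof (intro conjI ballI)
    fix s assume s: "s \<in> {0..2*pi}"
    then have "f s - f 0 = (int_Icc 0 s g)" using R by (simp add: has_l2_deriv_def)
    then show "f s = f 0 + (LINT t:{0..s}|lborel. g t)" unfolding e[OF s] by (simp only: diff_eq_eq add.commute)
  qed (use R sq in \<open>auto simp: has_l2_deriv_def\<close>)
  ultimately show ?thesis using sq unfolding has_periodic_h1_deriv_def has_l2_deriv_def by blast
qed

lemma h1_periodic: "has_periodic_h1_deriv f g \<Longrightarrow> f (s + 2 * pi) = f s"
  and h1_l2: "has_periodic_h1_deriv f g \<Longrightarrow> has_l2_deriv f g"
  by (auto simp: h1_iff)

lemma l2_deriv_sq_int: "has_l2_deriv f g \<Longrightarrow> sq_int g"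
  and l2_deriv_increment: "has_l2_deriv f g \<Longrightarrow> 0 \<le> a \<Longrightarrow> a \<le> b \<Longrightarrow> b \<le> 2 * pi \<Longrightarrow>
     f b - f a = (int_Icc a b g)"
  by (auto simp: has_l2_deriv_def)

lemmas h1_sq_int_deriv = l2_deriv_sq_int[OF h1_l2]
lemmas h1_increment = l2_deriv_increment[OF h1_l2]

lemma norm_integral_Icc_le:
  fixes g :: "real \<Rightarrow> 'a::euclidean_space"
  assumes g: "sq_int g" and ab: "0 \<le> a" "a \<le> b" "b \<le> 2*pi"
  shows "(int_Icc a b (\<lambda>t. norm (g t)))\<^sup>2 \<le> (b - a) * (int_Icc a b (\<lambda>t. (norm (g t))\<^sup>2))"
proof -
  let ?h = "\<lambda>t. indicator {a..b} t *\<^sub>R g t"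
  have "sq_int ?h" by (rule sq_int_indicator[OF _ g]) simp
  moreover have o: "sq_int (\<lambda>t. indicator {a..b} t *\<^sub>R (1::real))"
    by (rule sq_int_indicator) (auto intro!: sq_int_cont continuous_intros)
  ultimately have "(LINT s|circ. norm (indicator {a..b} s *\<^sub>R (1::real)) * norm (?h s))\<^sup>2
     \<le> (LINT s|circ. (norm (indicator {a..b} s *\<^sub>R (1::real)))\<^sup>2) * (LINT s|circ. (norm (?h s))\<^sup>2)"
    by (intro Cauchy_Schwarz_circ)
  moreover have "norm (indicator {a..b} s *\<^sub>R (1::real)) * norm (?h s) = indicator {a..b} s *\<^sub>R norm (g s)" for s
    by (simp add: indicator_def)
  moreover have "(norm (indicator {a..b} s *\<^sub>R (1::real)))\<^sup>2 = indicator {a..b} s" for s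
    by (simp add: indicator_def)
  moreover have "(norm (?h s))\<^sup>2 = indicator {a..b} s *\<^sub>R (norm (g s))\<^sup>2" for s
    by (simp add: indicator_def)
  ultimately show ?thesis by (simp only: integral_indicator_Icc[OF ab])
qed

lemma l2_deriv_increment_bound:
  fixes f g :: "real \<Rightarrow> 'a::euclidean_space"
  assumes f: "has_l2_deriv f g" and ab: "0 \<le> a" "a \<le> b" "b \<le> 2*pi"
  shows "(norm (f b - f a))\<^sup>2 \<le> (b - a) * (int_Icc a b (\<lambda>t. (norm (g t))\<^sup>2))"
proof -
  have g: "sq_int g" using f by (rule l2_deriv_sq_int)
  have "norm (f b - f a) \<le> (LINT t|circ. norm (indicator {a..b} t *\<^sub>R g t))"
    unfolding l2_deriv_increment[OF f ab] by (rule integral_norm_bound)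
  also have "\<dots> = (int_Icc a b (\<lambda>t. norm (g t)))" 
    by (rule Bochner_Integration.integral_cong) (auto simp: indicator_def)
  finally have "(norm (f b - f a))\<^sup>2 \<le> (int_Icc a b (\<lambda>t. norm (g t)))\<^sup>2"
    by (rule power_mono) simp
  with norm_integral_Icc_le[OF g ab] show ?thesis by linarith
qed

lemma integral_indicator_le:
  fixes h :: "real \<Rightarrow> real"
  assumes "integrable circ h" "\<And>t. h t \<ge> 0"
  shows "(int_Icc a b h) \<le> (LINT t|circ. h t)"
proof (rule integral_mono)
  show "integrable circ (\<lambda>t. indicator {a..b} t *\<^sub>R h t)"
    by (rule integrable_indicator_circ) (use assms in auto)
qed (use assms in \<open>auto simp: indicator_def\<close>)

lemma l2_deriv_increment_bound':
  fixes f g :: "real \<Rightarrow> 'a::euclidean_space"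
  assumes f: "has_l2_deriv f g" and ab: "a \<in> {0..2*pi}" "b \<in> {0..2*pi}"
  shows "(norm (f b - f a))\<^sup>2 \<le> \<bar>b - a\<bar> * (LINT t|circ. (norm (g t))\<^sup>2)"
proof -
  have *: "(norm (f b - f a))\<^sup>2 \<le> \<bar>b - a\<bar> * (LINT t|circ. (norm (g t))\<^sup>2)" if "0 \<le> a" "a \<le> b" "b \<le> 2*pi" for a b
  proof -
    have "(b - a) * (int_Icc a b (\<lambda>t. (norm (g t))\<^sup>2)) \<le> (b - a) * (LINT t|circ. (norm (g t))\<^sup>2)"
      using that by (intro mult_left_mono integral_indicator_le sq_int_norm2 l2_deriv_sq_int[OF f]) auto
    with l2_deriv_increment_bound[OF f that] show ?thesis using that by simp
  qed
  show ?thesis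
  proof (cases "a \<le> b")
    case True then show ?thesis using * ab by auto
  next
    case False then show ?thesis using *[of b a] ab by (simp add: norm_minus_commute abs_minus_commute)
  qed
qed

lemma l2_deriv_cont:
  fixes f g :: "real \<Rightarrow> 'a::euclidean_space"
  assumes f: "has_l2_deriv f g"
  shows "continuous_on {0..2*pi} f"
  unfolding continuous_on_def
proof
  fix a assume a: "a \<in> {0..2*pi}"
  define C where "C = (LINT t|circ. (norm (g t))\<^sup>2)"
  have "((\<lambda>b. sqrt (\<bar>b - a\<bar> * C)) \<longlongrightarrow> sqrt (\<bar>a - a\<bar> * C)) (at a within {0..2*pi})"
    by (intro tendsto_intros)
  then have "((\<lambda>b. sqrt (\<bar>b - a\<bar> * C)) \<longlongrightarrow> 0) (at a within {0..2*pi})" by simp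
  moreover have "\<forall>\<^sub>F b in at a within {0..2*pi}. norm (f b - f a) \<le> sqrt (\<bar>b - a\<bar> * C)"
    unfolding eventually_at_filter
    by (rule always_eventually) (use l2_deriv_increment_bound'[OF f a] in \<open>auto simp: C_def intro!: real_le_rsqrt\<close>)
  ultimately have "((\<lambda>b. f b - f a) \<longlongrightarrow> 0) (at a within {0..2*pi})"
    by (rule Lim_null_comparison[rotated])
  then show "(f \<longlongrightarrow> f a) (at a within {0..2*pi})" by (simp add: LIM_zero_iff)
qed

lemmas h1_increment_bound = l2_deriv_increment_bound'[OF h1_l2]
lemmas h1_cont = l2_deriv_cont[OF h1_l2]

lemma h1_sq_int: "has_periodic_h1_deriv f g \<Longrightarrow> sq_int f"
  by (intro sq_int_cont h1_cont)

text \<open>On a partition of mesh \<open>h\<close> the increments of \<open>F\<close> add up to at most \<open>h (m b - m a)\<close>, as those of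
  \<open>m\<close> telescope. It serves the product rule, whose defect
  on \<open>[a, b]\<close> is of second order: \<open>(b - a)\<close> times the increment of an indefinite integral.\<close>

lemma constant_if_increments_superadditive:
  fixes F :: "real \<Rightarrow> 'a::real_normed_vector"
  assumes inc: "\<And>a b. A \<le> a \<Longrightarrow> a \<le> b \<Longrightarrow> b \<le> B \<Longrightarrow> norm (F b - F a) \<le> (b - a) * (m b - m a)"
    and ab: "A \<le> a" "a \<le> b" "b \<le> B"
  shows "F b = F a"
proof -
  have step: "norm (F (a + real k * h) - F a) \<le> h * (m (a + real k * h) - m a)"
    if h: "h \<ge> 0" and "a + real k * h \<le> b" for k h
    using that(2)
  proof (induction k)
    case 0 then show ?case by simp
  next
    case (Suc k)
    have e: "a + real (Suc k) * h = a + real k * h + h" by (simp add: algebra_simps)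
    have kh: "0 \<le> real k * h" using h by simp
    have 1: "norm (F (a + real k * h) - F a) \<le> h * (m (a + real k * h) - m a)"
      using Suc h e by simp
    have 2: "norm (F (a + real k * h + h) - F (a + real k * h)) \<le> h * (m (a + real k * h + h) - m (a + real k * h))"
      using inc[of "a + real k * h" "a + real k * h + h"] Suc.prems h kh ab e by simp
    have "norm (F (a + real k * h + h) - F a) \<le> norm (F (a + real k * h + h) - F (a + real k * h)) + norm (F (a + real k * h) - F a)"
      using norm_triangle_ineq[of "F (a + real k * h + h) - F (a + real k * h)" "F (a + real k * h) - F a"] by simp
    with 1 2 show ?case unfolding e by (simp add: algebra_simps)
  qed
  have b: "norm (F b - F a) \<le> (b - a) * (m b - m a) / real (Suc n)" for n
    using step[of "(b - a) / real (Suc n)" "Suc n"] ab by simp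
  have "(\<lambda>n. (b - a) * (m b - m a) / real (Suc n)) \<longlonglongrightarrow> 0"
    by (rule LIMSEQ_Suc) (rule lim_const_over_n)
  then have "norm (F b - F a) \<le> 0"
    by (rule LIMSEQ_le_const) (use b in auto)
  then show ?thesis by simp
qed

lemma h1I:
  fixes f g :: "real \<Rightarrow> 'a::euclidean_space"
  assumes "\<And>s. f (s + 2 * pi) = f s" "sq_int g"
    "\<And>a b. 0 \<le> a \<Longrightarrow> a \<le> b \<Longrightarrow> b \<le> 2 * pi \<Longrightarrow> f b - f a = (int_Icc a b g)"
  shows "has_periodic_h1_deriv f g"
  unfolding h1_iff has_l2_deriv_def using assms by blast

lemma h1_add:
  fixes f g :: "real \<Rightarrow> 'a::euclidean_space"
  assumes f: "has_periodic_h1_deriv f f'" and g: "has_periodic_h1_deriv g g'"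
  shows "has_periodic_h1_deriv (\<lambda>s. f s + g s) (\<lambda>s. f' s + g' s)"
proof (rule h1I)
  note i = integrable_indicator_circ[OF _ sq_int_integrable[OF h1_sq_int_deriv[OF f]]]
    integrable_indicator_circ[OF _ sq_int_integrable[OF h1_sq_int_deriv[OF g]]]
  fix a b :: real assume ab: "0 \<le> a" "a \<le> b" "b \<le> 2 * pi"
  have "f b + g b - (f a + g a) = (f b - f a) + (g b - g a)" by simp
  then show "f b + g b - (f a + g a) = (int_Icc a b (\<lambda>t. f' t + g' t))"
    using h1_increment[OF f ab] h1_increment[OF g ab] i by (simp add: scaleR_add_right)
qed (use assms in \<open>auto intro: sq_int_add h1_sq_int_deriv simp: h1_periodic\<close>)

lemma h1_linear:
  fixes T :: "'a::euclidean_space \<Rightarrow> 'b::euclidean_space"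
  assumes T: "bounded_linear T" and f: "has_periodic_h1_deriv f f'"
  shows "has_periodic_h1_deriv (\<lambda>s. T (f s)) (\<lambda>s. T (f' s))"
proof (rule h1I)
  interpret bounded_linear T by (rule T)
  fix a b :: real assume ab: "0 \<le> a" "a \<le> b" "b \<le> 2 * pi"
  have "integrable circ (\<lambda>t. indicator {a..b} t *\<^sub>R f' t)"
    by (intro integrable_indicator_circ sq_int_integrable h1_sq_int_deriv[OF f]) simp
  from integral_bounded_linear[OF T this]
  show "T (f b) - T (f a) = (int_Icc a b (\<lambda>t. T (f' t)))"
    using h1_increment[OF f ab] by (simp add: diff[symmetric] scaleR)
qed (use assms in \<open>auto intro: sq_int_linear h1_sq_int_deriv simp: h1_periodic\<close>)

lemmas h1_scaleR = h1_linear[OF bounded_linear_scaleR_right]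

lemma h1_diff:
  fixes f g :: "real \<Rightarrow> 'a::euclidean_space"
  assumes f: "has_periodic_h1_deriv f f'" and g: "has_periodic_h1_deriv g g'"
  shows "has_periodic_h1_deriv (\<lambda>s. f s - g s) (\<lambda>s. f' s - g' s)"
  using h1_add[OF f h1_scaleR[OF g, of "-1"]] by simp

lemma l2_deriv_smooth:
  fixes f :: "real \<Rightarrow> 'a::euclidean_space"
  assumes d: "\<And>s. (f has_vector_derivative f' s) (at s)" and c: "continuous_on UNIV f'"
  shows "has_l2_deriv f f'"
  unfolding has_l2_deriv_def
proof (intro conjI allI impI)
  fix a b :: real assume ab: "0 \<le> a" "a \<le> b" "b \<le> 2 * pi"
  have "(int_Icc a b f') = (LBINT t. indicator {0..2*pi} t *\<^sub>R indicator {a..b} t *\<^sub>R f' t)"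
    unfolding circ_def by (subst integral_restrict_space) simp_all
  also have "\<dots> = (LBINT t. indicator {a..b} t *\<^sub>R f' t)"
    by (rule Bochner_Integration.integral_cong) (use ab in \<open>auto simp: indicator_def\<close>)
  also have "\<dots> = f b - f a"
    by (rule integral_FTC_Icc[OF ab(2)])
      (auto intro: has_vector_derivative_at_within[OF d] continuous_on_subset[OF c])
  finally show "f b - f a = (int_Icc a b f')" by simp
qed (auto intro: sq_int_cont continuous_on_subset[OF c])

lemma h1_smooth:
  fixes f :: "real \<Rightarrow> 'a::euclidean_space"
  assumes "\<And>s. f (s + 2 * pi) = f s" "\<And>s. (f has_vector_derivative f' s) (at s)"
    "continuous_on UNIV f'"
  shows "has_periodic_h1_deriv f f'"
  unfolding h1_iff using assms l2_deriv_smooth by blast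

lemma h1_integral_deriv:
  fixes f :: "real \<Rightarrow> 'a::euclidean_space"
  assumes f: "has_periodic_h1_deriv f g"
  shows "(LINT s|circ. g s) = 0"
proof -
  have "(LINT s|circ. g s) = (LINT s|circ. indicator {0..2*pi} s *\<^sub>R g s)"
    by (rule Bochner_Integration.integral_cong) auto
  also have "\<dots> = f (2 * pi) - f 0" by (rule h1_increment[OF f, symmetric]) auto
  also have "\<dots> = 0" using h1_periodic[OF f, of 0] by simp
  finally show ?thesis .
qed

text \<open>The second-order estimate behind the product rule: both the oscillation of \<open>f\<close> on \<open>[a, b]\<close> and
  the integral of \<open>|g|\<close> over \<open>[a, b]\<close> carry a factor \<open>(b - a)\<^bsup>1/2\<^esup>\<close>.\<close>

lemma integral_bilinear_Icc_bound:
  fixes p :: "'a::euclidean_space \<Rightarrow> 'b::euclidean_space \<Rightarrow> 'c::euclidean_space"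
  assumes p: "bounded_bilinear p" and K: "\<And>a b. norm (p a b) \<le> norm a * norm b * K" "K \<ge> 0"
    and f: "has_l2_deriv f f'" and g: "sq_int g"
    and ab: "0 \<le> a" "a \<le> b" "b \<le> 2*pi" and c: "c \<in> {a..b}"
  shows "norm (int_Icc a b (\<lambda>t. p (f t - f c) (g t)))
    \<le> (b - a) * (K * ((int_Icc a b (\<lambda>t. (norm (f' t))\<^sup>2)) + (int_Icc a b (\<lambda>t. (norm (g t))\<^sup>2))))"
proof -
  define M N where "M = (int_Icc a b (\<lambda>t. (norm (f' t))\<^sup>2))"
    and "N = (int_Icc a b (\<lambda>t. (norm (g t))\<^sup>2))"
  have MN: "M \<ge> 0" "N \<ge> 0" by (simp_all add: M_def N_def)
  have f': "sq_int f'" using f by (rule l2_deriv_sq_int)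
  have ig: "integrable circ (\<lambda>t. indicator {a..b} t *\<^sub>R norm (g t))"
    by (intro integrable_indicator_circ integrable_norm sq_int_integrable g) simp
  have d: "norm (f t - f c) \<le> sqrt ((b - a) * M)" if t: "t \<in> {a..b}" for t
  proof -
    have *: "(norm (f v - f u))\<^sup>2 \<le> (b - a) * M" if "a \<le> u" "u \<le> v" "v \<le> b" for u v
    proof -
      have "(int_Icc u v (\<lambda>t. (norm (f' t))\<^sup>2)) \<le> M"
        unfolding M_def
      proof (rule integral_mono)
        show "integrable circ (\<lambda>t. indicator {u..v} t *\<^sub>R (norm (f' t))\<^sup>2)"
          by (rule integrable_indicator_circ) (use sq_int_norm2[OF f'] in auto)
        show "integrable circ (\<lambda>t. indicator {a..b} t *\<^sub>R (norm (f' t))\<^sup>2)"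
          by (rule integrable_indicator_circ) (use sq_int_norm2[OF f'] in auto)
      qed (use that in \<open>auto simp: indicator_def\<close>)
      then have "(v - u) * (int_Icc u v (\<lambda>t. (norm (f' t))\<^sup>2)) \<le> (b - a) * M"
        using that by (intro mult_mono) (auto simp: MN)
      with l2_deriv_increment_bound[OF f, of u v] that ab show ?thesis by simp
    qed
    have "(norm (f t - f c))\<^sup>2 \<le> (b - a) * M"
      using *[of t c] *[of c t] t c by (cases "t \<le> c") (auto simp: norm_minus_commute)
    then show ?thesis by (rule real_le_rsqrt)
  qed
  have ip: "integrable circ (\<lambda>t. indicator {a..b} t *\<^sub>R p (f t - f c) (g t))"
    by (intro integrable_indicator_circ sq_int_bilinear[OF p] g sq_int_cont continuous_intros l2_deriv_cont[OF f]) simp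
  have "norm (int_Icc a b (\<lambda>t. p (f t - f c) (g t)))
      \<le> (LINT t|circ. norm (indicator {a..b} t *\<^sub>R p (f t - f c) (g t)))"
    by (rule integral_norm_bound)
  also have "\<dots> \<le> (LINT t|circ. sqrt ((b - a) * M) * K * (indicator {a..b} t *\<^sub>R norm (g t)))"
  proof (rule integral_mono)
    show "integrable circ (\<lambda>t. norm (indicator {a..b} t *\<^sub>R p (f t - f c) (g t)))"
      by (rule integrable_norm[OF ip])
    fix t
    have "norm (p (f t - f c) (g t)) \<le> sqrt ((b - a) * M) * norm (g t) * K" if "t \<in> {a..b}"
      using K(1)[of "f t - f c" "g t"] mult_right_mono[OF mult_right_mono[OF d[OF that] norm_ge_zero] K(2), of "g t"]
      by linarith
    then show "norm (indicator {a..b} t *\<^sub>R p (f t - f c) (g t)) \<le> sqrt ((b - a) * M) * K * (indicator {a..b} t *\<^sub>R norm (g t))"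
      by (cases "t \<in> {a..b}") (auto simp: mult_ac)
  qed (use ig in auto)
  also have "\<dots> = sqrt ((b - a) * M) * K * (int_Icc a b (\<lambda>t. norm (g t)))"
    by (rule Bochner_Integration.integral_mult_right) (rule ig)
  also have "(int_Icc a b (\<lambda>t. norm (g t))) \<le> sqrt ((b - a) * N)"
    using norm_integral_Icc_le[OF g ab] unfolding N_def by (rule real_le_rsqrt)
  then have "sqrt ((b - a) * M) * K * (int_Icc a b (\<lambda>t. norm (g t))) \<le> sqrt ((b - a) * M) * K * sqrt ((b - a) * N)"
    using K ab MN by (intro mult_left_mono) auto
  also have "\<dots> = (b - a) * (K * (sqrt M * sqrt N))"
    using ab by (simp add: real_sqrt_mult mult_ac)
  also have "\<dots> \<le> (b - a) * (K * (M + N))"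
  proof -
    have "sqrt M * sqrt N \<le> M + N"
      using arith_geo_mean_sqrt[of M N] MN by (simp add: real_sqrt_mult[symmetric])
    then show ?thesis using K ab by (intro mult_left_mono) auto
  qed
  finally show ?thesis by (simp add: M_def N_def)
qed

text \<open>Let \<open>F\<close> be the product minus the indefinite integral of the expected derivative. Freezing one
  factor at an endpoint, the increment of \<open>F\<close> over \<open>[a, b]\<close> becomes a sum of two integrals of second order,
  so \<open>F\<close> is constant.\<close>

lemma l2_deriv_prod:
  fixes p :: "'a::euclidean_space \<Rightarrow> 'b::euclidean_space \<Rightarrow> 'c::euclidean_space"
  assumes p: "bounded_bilinear p"
    and f: "has_l2_deriv f f'" and g: "has_l2_deriv g g'"
  shows "has_l2_deriv (\<lambda>s. p (f s) (g s)) (\<lambda>s. p (f' s) (g s) + p (f s) (g' s))"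
unfolding has_l2_deriv_def
proof (intro conjI allI impI)
  interpret bounded_bilinear p by (rule p)
  obtain K where K: "\<And>a b. norm (p a b) \<le> norm a * norm b * K" "K \<ge> 0"
    using nonneg_bounded by blast
  note f' = l2_deriv_sq_int[OF f] and g' = l2_deriv_sq_int[OF g]
  note fc = l2_deriv_cont[OF f] and gc = l2_deriv_cont[OF g]
  note p' = flip
  define D where "D t = p (f' t) (g t) + p (f t) (g' t)" for t
  have i1: "integrable circ (\<lambda>t. p (f' t) (g t))" by (intro sq_int_bilinear[OF p] f' sq_int_cont gc)
  have i2: "integrable circ (\<lambda>t. p (f t) (g' t))" by (intro sq_int_bilinear[OF p] g' sq_int_cont fc)
  have iD: "integrable circ D" unfolding D_def using i1 i2 by simp
  show "sq_int (\<lambda>s. p (f' s) (g s) + p (f s) (g' s))"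
    by (intro sq_int_add sq_int_bounded_bilinear[OF p fc g'] sq_int_bounded_bilinear[OF p' gc f'])
  \<comment> \<open>The defect on \<open>[a, b]\<close> is at most \<open>(b - a) (m b - m a)\<close>.\<close>
  define m where "m b = 2 * K * (int_Icc 0 b (\<lambda>t. (norm (f' t))\<^sup>2 + (norm (g' t))\<^sup>2))" for b
  define F where "F b = p (f b) (g b) - (int_Icc 0 b D)" for b
  have inc: "norm (F b - F a) \<le> (b - a) * (m b - m a)" if ab: "0 \<le> a" "a \<le> b" "b \<le> 2*pi" for a b
  proof -
    let ?I = "\<lambda>h. LINT t|circ. indicator {a..b} t *\<^sub>R h t"
    have j1: "integrable circ (\<lambda>t. indicator {a..b} t *\<^sub>R p (f' t) (g t))"
      and j2: "integrable circ (\<lambda>t. indicator {a..b} t *\<^sub>R p (f t) (g' t))"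
      and j3: "integrable circ (\<lambda>t. indicator {a..b} t *\<^sub>R f' t)"
      and j4: "integrable circ (\<lambda>t. indicator {a..b} t *\<^sub>R g' t)"
      using i1 i2 sq_int_integrable[OF f'] sq_int_integrable[OF g'] by (auto intro!: integrable_indicator_circ)
    have "F b - F a = p (f b) (g b) - p (f a) (g a) - ?I D"
      unfolding F_def using integral_indicator_split[OF iD ab(1,2)] by simp
    also have "p (f b) (g b) - p (f a) (g a) = p (f b - f a) (g b) + p (f a) (g b - g a)"
      by (simp add: diff_left diff_right)
    also have "p (f b - f a) (g b) = (int_Icc a b (\<lambda>t. p (f' t) (g b)))"
      unfolding l2_deriv_increment[OF f ab]
      using integral_bounded_linear[OF bounded_linear_left j3, of "g b"] by (simp add: scaleR_left)
    also have "p (f a) (g b - g a) = (int_Icc a b (\<lambda>t. p (f a) (g' t)))"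
      unfolding l2_deriv_increment[OF g ab]
      using integral_bounded_linear[OF bounded_linear_right j4, of "f a"] by (simp add: scaleR_right)
    also have "?I D = (int_Icc a b (\<lambda>t. p (f' t) (g t))) + (int_Icc a b (\<lambda>t. p (f t) (g' t)))"
      unfolding D_def using j1 j2 by (simp add: scaleR_add_right)
    finally have "F b - F a = - ((int_Icc a b (\<lambda>t. p (f' t) (g t))) - (int_Icc a b (\<lambda>t. p (f' t) (g b))))
       - ((int_Icc a b (\<lambda>t. p (f t) (g' t))) - (int_Icc a b (\<lambda>t. p (f a) (g' t))))"
      by simp
    also have "(int_Icc a b (\<lambda>t. p (f' t) (g t))) - (int_Icc a b (\<lambda>t. p (f' t) (g b)))
        = (int_Icc a b (\<lambda>t. p (f' t) (g t - g b)))"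
    proof -
      have "integrable circ (\<lambda>t. indicator {a..b} t *\<^sub>R p (f' t) (g b))"
        by (intro integrable_indicator_circ sq_int_bilinear[OF p] f' sq_int_cont continuous_intros) simp
      from Bochner_Integration.integral_diff[OF j1 this] show ?thesis
        by (simp add: diff_right scaleR_diff_right)
    qed
    also have "(int_Icc a b (\<lambda>t. p (f t) (g' t))) - (int_Icc a b (\<lambda>t. p (f a) (g' t)))
        = (int_Icc a b (\<lambda>t. p (f t - f a) (g' t)))"
    proof -
      have "integrable circ (\<lambda>t. indicator {a..b} t *\<^sub>R p (f a) (g' t))"
        by (intro integrable_indicator_circ sq_int_bilinear[OF p] g' sq_int_cont continuous_intros) simp
      from Bochner_Integration.integral_diff[OF j2 this] show ?thesis
        by (simp add: diff_left scaleR_diff_right)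
    qed
    finally have "norm (F b - F a) \<le> norm (int_Icc a b (\<lambda>t. p (f' t) (g t - g b))) + norm (int_Icc a b (\<lambda>t. p (f t - f a) (g' t)))"
      using norm_triangle_ineq4[of "- (int_Icc a b (\<lambda>t. p (f' t) (g t - g b)))" "LINT t|circ. indicator {a..b} t *\<^sub>R p (f t - f a) (g' t)"]
      by (simp only: norm_minus_cancel)
    moreover have "norm (int_Icc a b (\<lambda>t. p (f t - f a) (g' t)))
      \<le> (b - a) * (K * (?I (\<lambda>t. (norm (f' t))\<^sup>2) + ?I (\<lambda>t. (norm (g' t))\<^sup>2)))"
      by (rule integral_bilinear_Icc_bound[OF p K f g' ab]) (use ab in auto)
    moreover have "norm (int_Icc a b (\<lambda>t. p (f' t) (g t - g b)))
      \<le> (b - a) * (K * (?I (\<lambda>t. (norm (g' t))\<^sup>2) + ?I (\<lambda>t. (norm (f' t))\<^sup>2)))"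
      by (rule integral_bilinear_Icc_bound[OF p' _ K(2) g f' ab]) (use ab K(1) in \<open>auto simp: mult_ac\<close>)
    moreover have "m b - m a = 2 * K * (?I (\<lambda>t. (norm (f' t))\<^sup>2) + ?I (\<lambda>t. (norm (g' t))\<^sup>2))"
    proof -
      have q: "integrable circ (\<lambda>t. (norm (f' t))\<^sup>2)" "integrable circ (\<lambda>t. (norm (g' t))\<^sup>2)"
        using f' g' by (auto intro: sq_int_norm2)
      have "m b - m a = 2 * K * ?I (\<lambda>t. (norm (f' t))\<^sup>2 + (norm (g' t))\<^sup>2)"
        unfolding m_def right_diff_distrib[symmetric]
        by (subst integral_indicator_split[OF _ ab(1,2)]) (use q in auto)
      also have "?I (\<lambda>t. (norm (f' t))\<^sup>2 + (norm (g' t))\<^sup>2) = ?I (\<lambda>t. (norm (f' t))\<^sup>2) + ?I (\<lambda>t. (norm (g' t))\<^sup>2)"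
        unfolding scaleR_add_right
        by (rule Bochner_Integration.integral_add; rule integrable_indicator_circ) (use q in auto)
      finally show ?thesis .
    qed
    ultimately show ?thesis by (simp add: algebra_simps)
  qed
  fix a b :: real assume ab: "0 \<le> a" "a \<le> b" "b \<le> 2 * pi"
  have "F b = F a" by (rule constant_if_increments_superadditive[where A=0 and B="2*pi" and m=m]) (use inc ab in auto)
  then show "p (f b) (g b) - p (f a) (g a) = (int_Icc a b (\<lambda>t. p (f' t) (g t) + p (f t) (g' t)))"
    unfolding F_def D_def[symmetric] integral_indicator_split[OF iD ab(1,2)]
    by (simp only: diff_eq_eq) (simp add: diff_eq_eq[symmetric] add.commute diff_add_eq)
qed

lemma h1_prod:
  fixes p :: "'a::euclidean_space \<Rightarrow> 'b::euclidean_space \<Rightarrow> 'c::euclidean_space"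
  assumes "bounded_bilinear p" "has_periodic_h1_deriv f f'" "has_periodic_h1_deriv g g'"
  shows "has_periodic_h1_deriv (\<lambda>s. p (f s) (g s)) (\<lambda>s. p (f' s) (g s) + p (f s) (g' s))"
  using assms l2_deriv_prod unfolding h1_iff by fastforce

text \<open>The difference of two derivatives has integral zero over all intervals, hence over all Borel sets
  by Dynkin's lemma.\<close>

lemma h1_deriv_unique:
  fixes f :: "real \<Rightarrow> 'a::euclidean_space"
  assumes f: "has_periodic_h1_deriv f g" and f': "has_periodic_h1_deriv f g'"
  shows "AE s in circ. g s = g' s"
proof -
  define d where "d s = g s - g' s" for s
  have "has_periodic_h1_deriv (\<lambda>s. f s - f s) d" unfolding d_def by (rule h1_diff[OF f f'])
  then have d: "has_periodic_h1_deriv (\<lambda>s. 0) d" by simp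
  have di: "integrable circ d" by (intro sq_int_integrable h1_sq_int_deriv[OF d])
  have Icc: "(int_Icc a b d) = 0" for a b
  proof (cases "max a 0 \<le> min b (2*pi)")
    case True
    have "(int_Icc a b d) = (int_Icc (max a 0) (min b (2*pi)) d)"
      by (rule Bochner_Integration.integral_cong) (auto simp: indicator_def)
    then show ?thesis using h1_increment[OF d _ True] by simp
  next
    case False
    have "(int_Icc a b d) = (LINT t|circ. 0)"
      by (rule Bochner_Integration.integral_cong) (use False in \<open>auto simp: indicator_def\<close>)
    then show ?thesis by simp
  qed
  have all: "(LINT t|circ. indicator A t *\<^sub>R d t) = 0" if "A \<in> sets borel" for A
  proof -
    let ?G = "range (\<lambda>(a,b). {a..b::real})"
    have b: "sets borel = sigma_sets UNIV ?G"
      unfolding borel_eq_atLeastAtMost by (rule sets_measure_of) auto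
    have "Int_stable ?G" by (auto simp: Int_stable_def)
    moreover have "?G \<subseteq> Pow UNIV" by simp
    moreover have "A \<in> sigma_sets UNIV ?G" using that b by simp
    ultimately show ?thesis
    proof (induction rule: sigma_sets_induct_disjoint)
      case (compl A)
      have "(LINT t|circ. indicator (UNIV - A) t *\<^sub>R d t) = (LINT t|circ. d t - indicator A t *\<^sub>R d t)"
        by (rule Bochner_Integration.integral_cong) (auto simp: indicator_def)
      also have "\<dots> = (LINT t|circ. d t) - (LINT t|circ. indicator A t *\<^sub>R d t)"
        using compl di b by (intro Bochner_Integration.integral_diff integrable_indicator_circ) auto
      finally show ?case using compl h1_integral_deriv[OF d] by simp
    next
      case (union A)
      define B where "B i = A i \<inter> {0..2*pi}" for i
      have A: "A i \<in> sets borel" for i using union b by auto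
      have "(LINT t|circ. indicator (\<Union>i. A i) t *\<^sub>R d t) = (LINT t:(\<Union>i. B i)|circ. d t)"
        unfolding set_lebesgue_integral_def
        by (rule Bochner_Integration.integral_cong) (auto simp: indicator_def B_def)
      also have "\<dots> = (\<Sum>i. (LINT t:(B i)|circ. d t))"
      proof (rule lebesgue_integral_countable_add)
        show m: "B i \<in> sets circ" for i using A by (auto simp: B_def circ_def sets_restrict_space)
        show "set_integrable circ (\<Union>i. B i) d"
          unfolding set_integrable_def using m di
          by (intro integrable_mult_indicator) auto
      qed (use union(1) in \<open>auto simp: disjoint_family_on_def B_def\<close>)
      also have "(\<lambda>i. LINT t:(B i)|circ. d t) = (\<lambda>i. LINT t|circ. indicator (A i) t *\<^sub>R d t)"
        unfolding set_lebesgue_integral_def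
        by (intro ext Bochner_Integration.integral_cong) (auto simp: indicator_def B_def)
      finally show ?case using union by simp
    qed (use Icc in auto)
  qed
  have "AE s in circ. d s = 0"
  proof (rule circ.density_zero[OF di])
    fix A assume "A \<in> sets circ"
    then obtain B where B: "B \<in> sets borel" "A = {0..2*pi} \<inter> B"
      by (auto simp: circ_def sets_restrict_space)
    have "set_lebesgue_integral circ A d = (LINT t|circ. indicator B t *\<^sub>R d t)"
      unfolding set_lebesgue_integral_def
      by (rule Bochner_Integration.integral_cong) (auto simp: indicator_def B)
    then show "set_lebesgue_integral circ A d = 0" using all B by simp
  qed
  then show ?thesis by (simp add: d_def)
qed

lemma periodic_h1_deriv: "f \<in> periodic_h1 \<Longrightarrow> has_periodic_h1_deriv f (h1_deriv f)"
  unfolding periodic_h1_def h1_deriv_def by (simp add: someI_ex)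

lemma periodic_h1I: "has_periodic_h1_deriv f g \<Longrightarrow> f \<in> periodic_h1"
  unfolding periodic_h1_def by auto

section \<open>Inner product and integration by parts\<close>

definition ip :: "(real \<Rightarrow> 'a::euclidean_space) \<Rightarrow> (real \<Rightarrow> 'a) \<Rightarrow> real" where
  "ip f g = (LINT s|circ. f s \<bullet> g s)"

lemma ip_commute: "ip f g = ip g f"
  by (simp add: ip_def inner_commute)

lemma ip_self: "ip f f = (LINT s|circ. (norm (f s))\<^sup>2)"
  by (simp add: ip_def power2_norm_eq_inner)

abbreviation sqn :: "(real \<Rightarrow> 'a::euclidean_space) \<Rightarrow> real" where
  "sqn f \<equiv> ip f f"

lemma ip_self_nonneg: "sqn f \<ge> 0"
  by (simp add: ip_self)

lemma ip_add_left: "sq_int f \<Longrightarrow> sq_int g \<Longrightarrow> sq_int h \<Longrightarrow> ip (\<lambda>s. f s + g s) h = ip f h + ip g h"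
  by (simp add: ip_def inner_add_left sq_int_inner)

lemma ip_diff_left: "sq_int f \<Longrightarrow> sq_int g \<Longrightarrow> sq_int h \<Longrightarrow> ip (\<lambda>s. f s - g s) h = ip f h - ip g h"
  by (simp add: ip_def inner_diff_left sq_int_inner)

lemma ip_add_right: "sq_int f \<Longrightarrow> sq_int g \<Longrightarrow> sq_int h \<Longrightarrow> ip h (\<lambda>s. f s + g s) = ip h f + ip h g"
  by (simp add: ip_def inner_add_right sq_int_inner)

lemma ip_diff_right: "sq_int f \<Longrightarrow> sq_int g \<Longrightarrow> sq_int h \<Longrightarrow> ip h (\<lambda>s. f s - g s) = ip h f - ip h g"
  by (simp add: ip_def inner_diff_right sq_int_inner)

lemma ip_scaleR_left: "ip (\<lambda>s. c *\<^sub>R f s) h = c * ip f h"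
  by (simp add: ip_def)

lemma ip_scaleR_right: "ip h (\<lambda>s. c *\<^sub>R f s) = c * ip h f"
  by (simp add: ip_def)

lemma ip_sq_add: 
  assumes "sq_int f" "sq_int g"
  shows "sqn (\<lambda>s. f s + g s) = sqn f + 2 * ip f g + sqn g"
  using assms by (simp add: ip_add_left ip_add_right sq_int_add ip_commute[of g f])

lemma ip_sq_diff: 
  assumes "sq_int f" "sq_int g"
  shows "sqn (\<lambda>s. f s - g s) = sqn f - 2 * ip f g + sqn g"
  using assms by (simp add: ip_diff_left ip_diff_right sq_int_diff ip_commute[of g f])

lemma ip_parts:
  fixes f g :: "real \<Rightarrow> 'a::euclidean_space"
  assumes f: "has_periodic_h1_deriv f f'" and g: "has_periodic_h1_deriv g g'"
  shows "ip f' g = - ip f g'"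
proof -
  have "(LINT s|circ. f' s \<bullet> g s + f s \<bullet> g' s) = 0"
    by (rule h1_integral_deriv[OF h1_prod[OF bounded_bilinear_inner f g]])
  then show ?thesis
    using sq_int_inner[OF h1_sq_int_deriv[OF f] h1_sq_int[OF g]] sq_int_inner[OF h1_sq_int[OF f] h1_sq_int_deriv[OF g]]
    by (simp add: ip_def)
qed

lemma ip_scaleR_const_left:
  fixes f :: "real \<Rightarrow> 'a::euclidean_space"
  assumes p: "continuous_on {0..2*pi} p" and f: "sq_int f"
  shows "ip (\<lambda>s. p s *\<^sub>R v) f = v \<bullet> (LINT s|circ. p s *\<^sub>R f s)"
proof -
  have "integrable circ (\<lambda>s. p s *\<^sub>R f s)"
    by (rule sq_int_bilinear[OF bounded_bilinear_scaleR sq_int_cont[OF p] f])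
  from integral_inner_right[of v, OF this] show ?thesis by (simp add: ip_def)
qed

section \<open>A Wirtinger inequality with a gap\<close>

text \<open>The gap in the Wirtinger inequality below needs \<open>\<pi>\<^sup>2/3 - 5/2 < 1\<close>. As \<open>sin(\<pi>/6) = 1/2\<close>, an
  upper bound of \<open>\<pi>\<close> follows from a lower bound of \<open>sin 0.53\<close>.\<close>

lemma pi_less_318: "pi < 318/100"
proof (rule ccontr)
  assume "\<not> ?thesis"
  then have "53/100 \<le> pi/6" by simp
  then have "sin (53/100 :: real) \<le> sin (pi/6)" by (intro sin_monotone_2pi_le) (use pi_gt_zero in auto)
  then have "sin (53/100 :: real) \<le> 1/2" by (simp add: sin_30)
  moreover have "\<bar>sin (53/100 :: real) - (\<Sum>m<4. sin_coeff m * (53/100) ^ m)\<bar> \<le> inverse (fact 4) * \<bar>53/100\<bar> ^ 4"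
    by (rule Maclaurin_sin_bound)
  then have "\<bar>sin (53/100 :: real) - (53/100 - (53/100)^3 / 6)\<bar> \<le> (53/100)^4 / 24"
    by (simp add: sin_coeff_Suc cos_coeff_Suc eval_nat_numeral)
  ultimately show False by (simp add: eval_nat_numeral abs_le_iff)
qed

text \<open>On \<open>(-\<pi>, \<pi>)\<close>, the sawtooth \<open>v/2 = \<Sum>\<^sub>n (-1)\<^bsup>n+1\<^esup> sin(n v)/n\<close> without its modes \<open>n = 1, 2\<close>.\<close>

definition saw :: "real \<Rightarrow> real" where "saw v = v / 2 - sin v + sin (2 * v) / 2"

lemma saw_deriv: "(saw has_real_derivative (1/2 - cos v + cos (2 * v))) (at v)"
  unfolding saw_def by (auto intro!: derivative_eq_intros)

definition saw_int :: "real \<Rightarrow> real" where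
  "saw_int v = v^3 / 12 + 5 * v / 8 - sin (2 * v) / 4 - sin (4 * v) / 32 + 2 * (v * cos v - sin v) / 2
     + sin (2 * v) / 8 - v * cos (2 * v) / 4 - 2 * sin v ^ 3 / 3"

lemma saw_int_deriv: "(saw_int has_real_derivative (saw v)\<^sup>2) (at v)"
proof -
  have s2: "sin (2 * v) = 2 * sin v * cos v" by (rule sin_double)
  have c2: "cos (2 * v) = (cos v)\<^sup>2 - (sin v)\<^sup>2" by (rule cos_double)
  have "sin (4 * v) = sin (2 * (2 * v))" "cos (4 * v) = cos (2 * (2 * v))" by simp_all
  then have c4: "cos (4 * v) = ((cos v)\<^sup>2 - (sin v)\<^sup>2)\<^sup>2 - (2 * sin v * cos v)\<^sup>2"
    by (simp only: cos_double[of "2 * v"] s2 c2)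
  have cc: "(cos v)\<^sup>2 = 1 - (sin v)\<^sup>2" by (simp add: cos_squared_eq)
  have "(saw_int has_real_derivative (v\<^sup>2 / 4 + 5 / 8 - cos (2 * v) / 2 - cos (4 * v) / 8 - v * sin v
     + cos (2 * v) / 4 - cos (2 * v) / 4 + v * sin (2 * v) / 2 - 2 * (sin v)\<^sup>2 * cos v)) (at v)"
    unfolding saw_int_def by (auto intro!: derivative_eq_intros simp: field_simps power2_eq_square)
  also have "(v\<^sup>2 / 4 + 5 / 8 - cos (2 * v) / 2 - cos (4 * v) / 8 - v * sin v
     + cos (2 * v) / 4 - cos (2 * v) / 4 + v * sin (2 * v) / 2 - 2 * (sin v)\<^sup>2 * cos v) = (saw v)\<^sup>2"
  proof -
    define S C where "S = sin v" and "C = cos v"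
    have c1: "C * C = 1 - S * S"
      using cc unfolding S_def C_def by (simp only: power2_eq_square)
    have c2': "C * (C * x) = x - S * (S * x)" for x
    proof -
      have "C * (C * x) = (C * C) * x" by simp
      then show ?thesis unfolding c1 by (simp add: left_diff_distrib)
    qed
    show ?thesis unfolding saw_def s2 c2 c4 S_def[symmetric] C_def[symmetric]
      by (simp add: power2_eq_square field_simps c1 c2')
  qed
  finally show ?thesis .
qed

lemma saw_int_total: "saw_int pi - saw_int (- pi) = pi^3 / 6 - 5 * pi / 4"
proof -
  have "sin (4 * pi) = 0" using sin_npi[of 4] by simp
  then show ?thesis by (simp add: saw_int_def power3_eq_cube)
qed

text \<open>Convolution of \<open>f'\<close> with the sawtooth recovers \<open>\<pi> f\<close> up to its mean. As \<open>f\<close> has no modes up to 2,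
  those modes may be removed from the kernel, which lowers its square norm to
  \<open>\<pi>\<^sup>3/6 - 5\<pi>/4 = \<pi> \<Sum>\<^sub>n\<^sub>\<ge>\<^sub>3 1/n\<^sup>2\<close>; then the Cauchy--Schwarz inequality applies.\<close>

lemma sup_bound_high_modes:
  fixes f :: "real \<Rightarrow> 'a::euclidean_space"
  assumes f: "has_periodic_h1_deriv f f'" and s: "s \<in> {0..2*pi}"
    and m: "(LINT s|circ. f s) = 0" "(LINT s|circ. cos s *\<^sub>R f s) = 0" "(LINT s|circ. sin s *\<^sub>R f s) = 0"
      "(LINT s|circ. cos (2 * s) *\<^sub>R f s) = 0" "(LINT s|circ. sin (2 * s) *\<^sub>R f s) = 0"
  shows "pi\<^sup>2 * (norm (f s))\<^sup>2 \<le> (pi^3 / 6 - 5 * pi / 4) * sqn f'"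
proof -
  \<comment> \<open>The periodic kernel \<open>t \<mapsto> saw (t - s \<plusminus> \<pi>)\<close> jumps by \<open>\<pi>\<close> at \<open>t = s\<close>, so it is treated as two smooth pieces; their common derivative \<open>k'\<close> has modes up to 2 only.\<close>
  define k1 k2 k' where "k1 t = saw (t - s + pi)" and "k2 t = saw (t - s - pi)"
    and "k' t = 1/2 + cos (t - s) + cos (2 * t - 2 * s)" for t
  define K where "K t = indicator {0..s} t *\<^sub>R k1 t + indicator {s..2*pi} t *\<^sub>R k2 t" for t
  have sawc: "continuous_on UNIV saw"
    unfolding saw_def by (intro continuous_intros) auto
  have saws: "continuous_on A (\<lambda>t. saw (t + c))" for A c
    unfolding saw_def by (intro continuous_intros) auto
  have "continuous_on A k1" "continuous_on A k2" for A
    using saws[of A "-s+pi"] saws[of A "-s-pi"] by (simp_all add: k1_def k2_def algebra_simps)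
  note kc = this
  have kd: "(k1 has_vector_derivative k' t) (at t)" "(k2 has_vector_derivative k' t) (at t)" for t
  proof -
    have d: "((\<lambda>t. t - s + pi) has_real_derivative 1) (at t)" "((\<lambda>t. t - s - pi) has_real_derivative 1) (at t)"
      by (auto intro!: derivative_eq_intros)
    have "2 * (t - s + pi) = (2 * t - 2 * s) + 2 * pi" "2 * (t - s - pi) = (2 * t - 2 * s) - 2 * pi" by simp_all
    then have e: "1/2 - cos (t - s + pi) + cos (2 * (t - s + pi)) = k' t" "1/2 - cos (t - s - pi) + cos (2 * (t - s - pi)) = k' t"
      unfolding k'_def by (simp_all only: cos_periodic_pi cos_periodic cos_minus_pi cos_diff[of _ "2*pi"] cos_two_pi sin_two_pi, simp_all?)
    show "(k1 has_vector_derivative k' t) (at t)"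
      using DERIV_chain2[OF saw_deriv d(1)] unfolding k1_def e(1) by (simp add: has_real_derivative_iff_has_vector_derivative)
    show "(k2 has_vector_derivative k' t) (at t)"
      using DERIV_chain2[OF saw_deriv d(2)] unfolding k2_def e(2) by (simp add: has_real_derivative_iff_has_vector_derivative)
  qed
  have k'c: "continuous_on A k'" for A unfolding k'_def by (intro continuous_intros)
  have k'int: "(LINT t|circ. k' t *\<^sub>R f t) = 0"
  proof -
    have i: "integrable circ (\<lambda>t. p t *\<^sub>R f t)" if "continuous_on {0..2*pi} p" for p
      by (rule sq_int_bilinear[OF bounded_bilinear_scaleR sq_int_cont[OF that] h1_sq_int[OF f]])
    have "(\<lambda>t. k' t *\<^sub>R f t) = (\<lambda>t. (1/2) *\<^sub>R f t + cos s *\<^sub>R (cos t *\<^sub>R f t) + sin s *\<^sub>R (sin t *\<^sub>R f t)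
      + cos (2 * s) *\<^sub>R (cos (2 * t) *\<^sub>R f t) + sin (2 * s) *\<^sub>R (sin (2 * t) *\<^sub>R f t))"
      by (simp add: k'_def cos_diff algebra_simps)
    then have "(LINT t|circ. k' t *\<^sub>R f t) = (LINT t|circ. (1/2) *\<^sub>R f t + cos s *\<^sub>R (cos t *\<^sub>R f t) + sin s *\<^sub>R (sin t *\<^sub>R f t)
      + cos (2 * s) *\<^sub>R (cos (2 * t) *\<^sub>R f t) + sin (2 * s) *\<^sub>R (sin (2 * t) *\<^sub>R f t))"
      by simp
    also have "\<dots> = (1/2) *\<^sub>R (LINT t|circ. f t) + cos s *\<^sub>R (LINT t|circ. cos t *\<^sub>R f t) + sin s *\<^sub>R (LINT t|circ. sin t *\<^sub>R f t)
      + cos (2 * s) *\<^sub>R (LINT t|circ. cos (2 * t) *\<^sub>R f t) + sin (2 * s) *\<^sub>R (LINT t|circ. sin (2 * t) *\<^sub>R f t)"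
      using sq_int_integrable[OF h1_sq_int[OF f]] i[of cos] i[of sin] i[of "\<lambda>t. cos (2 * t)"] i[of "\<lambda>t. sin (2 * t)"]
      by (simp add: continuous_intros del: scaleR_scaleR)
    finally show ?thesis using m by simp
  qed
  have ik: "integrable circ (\<lambda>t. indicator A t *\<^sub>R (p t *\<^sub>R h t))"
    if "A \<in> sets borel" "continuous_on {0..2*pi} p" "sq_int h" for A p and h :: "real \<Rightarrow> 'a"
    by (intro integrable_indicator_circ that(1) sq_int_bilinear[OF bounded_bilinear_scaleR] sq_int_cont that)
  have parts: "(int_Icc a b (\<lambda>t. k t *\<^sub>R f' t)) = k b *\<^sub>R f b - k a *\<^sub>R f a - (int_Icc a b (\<lambda>t. k' t *\<^sub>R f t))"
    if kd: "\<And>t. (k has_vector_derivative k' t) (at t)" and kc: "continuous_on {0..2*pi} k"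
      and ab: "0 \<le> a" "a \<le> b" "b \<le> 2*pi" for k a b
  proof -
    have "has_l2_deriv (\<lambda>t. k t *\<^sub>R f t) (\<lambda>t. k' t *\<^sub>R f t + k t *\<^sub>R f' t)"
      by (rule l2_deriv_prod[OF bounded_bilinear_scaleR l2_deriv_smooth[OF kd k'c] h1_l2[OF f]])
    from l2_deriv_increment[OF this ab]
    have "k b *\<^sub>R f b - k a *\<^sub>R f a = (LINT t|circ. indicator {a..b} t *\<^sub>R (k' t *\<^sub>R f t) + indicator {a..b} t *\<^sub>R (k t *\<^sub>R f' t))"
      by (simp add: scaleR_add_right)
    also have "\<dots> = (int_Icc a b (\<lambda>t. k' t *\<^sub>R f t)) + (int_Icc a b (\<lambda>t. k t *\<^sub>R f' t))"
      by (intro Bochner_Integration.integral_add ik k'c kc h1_sq_int[OF f] h1_sq_int_deriv[OF f]) auto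
    finally show ?thesis by simp
  qed
  have f2: "f (2 * pi) = f 0" using h1_periodic[OF f, of 0] by simp
  have kv: "k1 0 = k2 (2*pi)" "k1 s - k2 s = pi"
    by (simp_all add: k1_def k2_def saw_def)
  have "(LINT t|circ. K t *\<^sub>R f' t) = (int_Icc 0 s (\<lambda>t. k1 t *\<^sub>R f' t)) + (int_Icc s (2*pi) (\<lambda>t. k2 t *\<^sub>R f' t))"
  proof -
    have "(\<lambda>t. K t *\<^sub>R f' t) = (\<lambda>t. indicator {0..s} t *\<^sub>R (k1 t *\<^sub>R f' t) + indicator {s..2*pi} t *\<^sub>R (k2 t *\<^sub>R f' t))"
      by (simp add: K_def scaleR_add_left)
    then show ?thesis
      by (simp only:) (intro Bochner_Integration.integral_add ik kc h1_sq_int_deriv[OF f]; simp)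
  qed
  also have "\<dots> = k1 s *\<^sub>R f s - k1 0 *\<^sub>R f 0 + k2 (2*pi) *\<^sub>R f (2*pi) - k2 s *\<^sub>R f s
      - ((int_Icc 0 s (\<lambda>t. k' t *\<^sub>R f t)) + (int_Icc s (2*pi) (\<lambda>t. k' t *\<^sub>R f t)))"
    using parts[OF kd(1) kc(1), of 0 s] parts[OF kd(2) kc(2), of s "2*pi"] s by simp
  also have "(int_Icc 0 s (\<lambda>t. k' t *\<^sub>R f t)) + (int_Icc s (2*pi) (\<lambda>t. k' t *\<^sub>R f t)) = (int_Icc 0 (2*pi) (\<lambda>t. k' t *\<^sub>R f t))"
  proof -
    have "integrable circ (\<lambda>t. k' t *\<^sub>R f t)"
      by (rule sq_int_bilinear[OF bounded_bilinear_scaleR sq_int_cont[OF k'c] h1_sq_int[OF f]])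
    from integral_indicator_split[OF this, of s "2*pi"] show ?thesis using s by simp
  qed
  also have "\<dots> = 0"
    unfolding k'int[symmetric] by (rule Bochner_Integration.integral_cong) auto
  also have "k1 s *\<^sub>R f s - k1 0 *\<^sub>R f 0 + k2 (2*pi) *\<^sub>R f (2*pi) - k2 s *\<^sub>R f s - 0 = pi *\<^sub>R f s"
    unfolding f2 kv(1) by (simp add: scaleR_diff_left[symmetric] kv(2))
  finally have rep: "(LINT t|circ. K t *\<^sub>R f' t) = pi *\<^sub>R f s" .
  have Ksq: "sq_int K"
    unfolding K_def by (intro sq_int_add sq_int_indicator sq_int_cont kc) auto
  have KK: "(LINT t|circ. (norm (K t))\<^sup>2) = pi^3 / 6 - 5 * pi / 4"
  proof -
    have "(LINT t|circ. (norm (K t))\<^sup>2) = (LINT t|circ. indicator {0..s} t *\<^sub>R (k1 t)\<^sup>2 + indicator {s..2*pi} t *\<^sub>R (k2 t)\<^sup>2)"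
    proof (rule integral_cong_AE)
      show "(\<lambda>t. (norm (K t))\<^sup>2) \<in> borel_measurable circ" using sq_int_norm2[OF Ksq] by auto
      show "(\<lambda>t. indicator {0..s} t *\<^sub>R (k1 t)\<^sup>2 + indicator {s..2*pi} t *\<^sub>R (k2 t)\<^sup>2) \<in> borel_measurable circ"
        by (intro borel_measurable_add borel_measurable_scaleR borel_measurable_circ_indicator measurable_circ_cont continuous_intros kc) auto
      show "AE t in circ. (norm (K t))\<^sup>2 = indicator {0..s} t *\<^sub>R (k1 t)\<^sup>2 + indicator {s..2*pi} t *\<^sub>R (k2 t)\<^sup>2"
        using AE_circ_neq[of s] by eventually_elim (auto simp: K_def indicator_def)
    qed
    also have "\<dots> = (int_Icc 0 s (\<lambda>t. (k1 t)\<^sup>2)) + (int_Icc s (2*pi) (\<lambda>t. (k2 t)\<^sup>2))"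
      by (intro Bochner_Integration.integral_add integrable_indicator_circ integrable_circ_cont continuous_intros kc) auto
    also have "(int_Icc 0 s (\<lambda>t. (k1 t)\<^sup>2)) = saw_int (s - s + pi) - saw_int (0 - s + pi)"
    proof (rule l2_deriv_increment[symmetric])
      show "has_l2_deriv (\<lambda>t. saw_int (t - s + pi)) (\<lambda>t. (k1 t)\<^sup>2)"
        by (rule l2_deriv_smooth)
          (auto intro!: continuous_intros kc DERIV_cong[OF DERIV_chain2[OF saw_int_deriv]] derivative_eq_intros
            simp: has_real_derivative_iff_has_vector_derivative[symmetric] k1_def[symmetric])
    qed (use s in auto)
    also have "(int_Icc s (2*pi) (\<lambda>t. (k2 t)\<^sup>2)) = saw_int (2*pi - s - pi) - saw_int (s - s - pi)"
    proof (rule l2_deriv_increment[symmetric])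
      show "has_l2_deriv (\<lambda>t. saw_int (t - s - pi)) (\<lambda>t. (k2 t)\<^sup>2)"
        by (rule l2_deriv_smooth)
          (auto intro!: continuous_intros kc DERIV_cong[OF DERIV_chain2[OF saw_int_deriv]] derivative_eq_intros
            simp: has_real_derivative_iff_has_vector_derivative[symmetric] k2_def[symmetric])
    qed (use s in auto)
    finally show ?thesis using saw_int_total by simp
  qed
  have "pi * norm (f s) \<le> (LINT t|circ. norm (K t *\<^sub>R f' t))"
    using integral_norm_bound[of circ "\<lambda>t. K t *\<^sub>R f' t"] unfolding rep by simp
  also have "\<dots> = (LINT t|circ. norm (K t) * norm (f' t))" by simp
  finally have "(pi * norm (f s))\<^sup>2 \<le> (LINT t|circ. norm (K t) * norm (f' t))\<^sup>2"
    by (rule power_mono) simp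
  also have "\<dots> \<le> (LINT t|circ. (norm (K t))\<^sup>2) * (LINT t|circ. (norm (f' t))\<^sup>2)"
    by (rule Cauchy_Schwarz_circ[OF Ksq h1_sq_int_deriv[OF f]])
  finally show ?thesis unfolding KK ip_self by (simp add: power_mult_distrib)
qed

lemma integral_cos_mult: "k > 0 \<Longrightarrow> (LINT t|circ. cos (real k * t)) = 0"
  and integral_sin_mult: "k > 0 \<Longrightarrow> (LINT t|circ. sin (real k * t)) = 0"
proof -
  assume k: "k > 0"
  have e: "real k * (s + 2 * pi) = real k * s + 2 * pi * real k" for s by (simp add: algebra_simps)
  have n: "cos (2 * pi * real k) = 1" "sin (2 * pi * real k) = 0"
    by (simp_all add: cos_integer_2pi sin_integer_2pi)
  have "has_periodic_h1_deriv (\<lambda>t. sin (real k * t) / real k) (\<lambda>t. cos (real k * t))"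
    using k n by (intro h1_smooth)
      (auto simp: e sin_add has_real_derivative_iff_has_vector_derivative[symmetric] intro!: derivative_eq_intros continuous_intros)
  from h1_integral_deriv[OF this] show "(LINT t|circ. cos (real k * t)) = 0" .
  have "has_periodic_h1_deriv (\<lambda>t. - cos (real k * t) / real k) (\<lambda>t. sin (real k * t))"
    using k n by (intro h1_smooth)
      (auto simp: e cos_add has_real_derivative_iff_has_vector_derivative[symmetric] intro!: derivative_eq_intros continuous_intros)
  from h1_integral_deriv[OF this] show "(LINT t|circ. sin (real k * t)) = 0" .
qed

lemma trig_integrals:
  "(LINT t|circ. cos t) = 0" "(LINT t|circ. sin t) = 0"
  "(LINT t|circ. cos (2 * t)) = 0" "(LINT t|circ. sin (2 * t)) = 0"
  using integral_cos_mult[of 1] integral_sin_mult[of 1] integral_cos_mult[of 2] integral_sin_mult[of 2] by simp_all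

text \<open>Evaluates an integral after a product-to-sum formula has turned the integrand into a
  combination of two frequencies and a constant.\<close>

lemma integral_trig_lincomb:
  fixes a b c d e :: real
  assumes "\<And>t. f t = a * cos (real m * t) + b * cos (real n * t) + c * sin (real m * t) + d * sin (real n * t) + e"
    and "m > 0" "n > 0"
  shows "(LINT t|circ. f t) = 2 * pi * e"
proof -
  have "integrable circ (\<lambda>t. cos (real k * t))" "integrable circ (\<lambda>t. sin (real k * t))" for k
    by (auto intro!: integrable_circ_cont continuous_intros)
  moreover have "f = (\<lambda>t. a * cos (real m * t) + b * cos (real n * t) + c * sin (real m * t) + d * sin (real n * t) + e)"
    using assms by auto
  ultimately show ?thesis
    using assms(2,3) by (simp add: integral_cos_mult integral_sin_mult)
qed

lemma trig_products:
  "(LINT t|circ. cos t * cos t) = pi" "(LINT t|circ. sin t * sin t) = pi"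
  "(LINT t|circ. cos t * sin t) = 0" "(LINT t|circ. sin t * cos t) = 0"
  "(LINT t|circ. cos (2*t) * cos (2*t)) = pi" "(LINT t|circ. sin (2*t) * sin (2*t)) = pi"
  "(LINT t|circ. cos (2*t) * sin (2*t)) = 0" "(LINT t|circ. sin (2*t) * cos (2*t)) = 0"
  "(LINT t|circ. cos t * cos (2*t)) = 0" "(LINT t|circ. cos t * sin (2*t)) = 0"
  "(LINT t|circ. sin t * cos (2*t)) = 0" "(LINT t|circ. sin t * sin (2*t)) = 0"
proof -
  have e1: "1 + real k = real (Suc k)" "t + real k * t = real (Suc k) * t" "real k * t - t = real (k - 1) * t" if "k > 0" for k t
    using that by (auto simp: algebra_simps of_nat_diff)
  show "(LINT t|circ. cos t * cos t) = pi" 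
    by (subst integral_trig_lincomb[where a="1/2" and b=0 and c=0 and d=0 and m=2 and n=1 and e="1/2"])
       (auto simp: cos_times_cos field_simps)
  show "(LINT t|circ. sin t * sin t) = pi" 
    by (subst integral_trig_lincomb[where a="-1/2" and b=0 and c=0 and d=0 and m=2 and n=1 and e="1/2"])
       (auto simp: sin_times_sin field_simps)
  show "(LINT t|circ. cos t * sin t) = 0" 
    by (subst integral_trig_lincomb[where a=0 and b=0 and c="1/2" and d=0 and m=2 and n=1 and e=0])
       (auto simp: cos_times_sin field_simps)
  then show "(LINT t|circ. sin t * cos t) = 0" by (simp add: mult.commute)
  show "(LINT t|circ. cos (2*t) * cos (2*t)) = pi" 
    by (subst integral_trig_lincomb[where a="1/2" and b=0 and c=0 and d=0 and m=4 and n=1 and e="1/2"])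
       (auto simp: cos_times_cos field_simps)
  show "(LINT t|circ. sin (2*t) * sin (2*t)) = pi" 
    by (subst integral_trig_lincomb[where a="-1/2" and b=0 and c=0 and d=0 and m=4 and n=1 and e="1/2"])
       (auto simp: sin_times_sin field_simps)
  show "(LINT t|circ. cos (2*t) * sin (2*t)) = 0" 
    by (subst integral_trig_lincomb[where a=0 and b=0 and c="1/2" and d=0 and m=4 and n=1 and e=0])
       (auto simp: cos_times_sin field_simps)
  then show "(LINT t|circ. sin (2*t) * cos (2*t)) = 0" by (simp add: mult.commute)
  have d: "t - 2 * t = - t" "t + 2 * t = 3 * t" "t * 2 - t = t" for t :: real by simp_all
  show "(LINT t|circ. cos t * cos (2*t)) = 0" 
    by (subst integral_trig_lincomb[where a="1/2" and b="1/2" and c=0 and d=0 and m=3 and n=1 and e=0])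
       (simp_all only: cos_times_cos d, simp_all add: field_simps)
  show "(LINT t|circ. cos t * sin (2*t)) = 0" 
    by (subst integral_trig_lincomb[where a=0 and b=0 and c="1/2" and d="1/2" and m=3 and n=1 and e=0])
       (simp_all only: cos_times_sin d, simp_all add: field_simps)
  show "(LINT t|circ. sin t * cos (2*t)) = 0" 
    by (subst integral_trig_lincomb[where a=0 and b=0 and c="1/2" and d="-1/2" and m=3 and n=1 and e=0])
       (simp_all only: sin_times_cos d, simp_all add: field_simps)
  show "(LINT t|circ. sin t * sin (2*t)) = 0" 
    by (subst integral_trig_lincomb[where a="-1/2" and b="1/2" and c=0 and d=0 and m=3 and n=1 and e=0])
       (simp_all only: sin_times_sin d, simp_all add: field_simps)
qed

lemma integral_scaleR_lincomb:
  fixes f :: "real \<Rightarrow> 'a::euclidean_space"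
  assumes p: "continuous_on {0..2*pi} p" and a: "continuous_on {0..2*pi} a" and b: "continuous_on {0..2*pi} b"
    and f: "sq_int f"
  shows "(LINT t|circ. p t *\<^sub>R (f t - (a t *\<^sub>R u + b t *\<^sub>R v)))
    = (LINT t|circ. p t *\<^sub>R f t) - ((LINT t|circ. p t * a t) *\<^sub>R u + (LINT t|circ. p t * b t) *\<^sub>R v)"
proof -
  have 1: "integrable circ (\<lambda>t. p t *\<^sub>R f t)"
    by (rule sq_int_bilinear[OF bounded_bilinear_scaleR sq_int_cont[OF p] f])
  have 2: "integrable circ (\<lambda>t. p t * a t)" "integrable circ (\<lambda>t. p t * b t)"
    by (intro integrable_circ_cont continuous_intros p a b)+
  have "(\<lambda>t. p t *\<^sub>R (f t - (a t *\<^sub>R u + b t *\<^sub>R v))) = (\<lambda>t. p t *\<^sub>R f t - ((p t * a t) *\<^sub>R u + (p t * b t) *\<^sub>R v))"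
    by (simp add: scaleR_diff_right scaleR_add_right)
  then show ?thesis using 1 2 by simp
qed

text \<open>Any constant above 1 gives coercivity of \<open>J\<close>; the optimal one is 4. Splitting off the second
  harmonics, on which the ratio is 4, leaves modes of order at least 3, for which the pointwise bound of \<open>sup_bound_high_modes\<close> integrates to
  a constant above \<open>11/10\<close>.\<close>

lemma wirtinger_gap:
  fixes f :: "real \<Rightarrow> 'a::euclidean_space"
  assumes f: "has_periodic_h1_deriv f f'"
    and m: "(LINT s|circ. f s) = 0" "(LINT s|circ. cos s *\<^sub>R f s) = 0" "(LINT s|circ. sin s *\<^sub>R f s) = 0"
  shows "sqn f' \<ge> 11/10 * sqn f"
proof -
  define c d where "c = (LINT s|circ. cos (2 * s) *\<^sub>R f s) /\<^sub>R pi" and "d = (LINT s|circ. sin (2 * s) *\<^sub>R f s) /\<^sub>R pi"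
  define h where "h t = cos (2 * t) *\<^sub>R c + sin (2 * t) *\<^sub>R d" for t
  define h' where "h' t = (- 2 * sin (2 * t)) *\<^sub>R c + (2 * cos (2 * t)) *\<^sub>R d" for t
  define g g' where "g t = f t - h t" and "g' t = f' t - h' t" for t
  have per: "cos (2 * (s + 2 * pi)) = cos (2 * s)" "sin (2 * (s + 2 * pi)) = sin (2 * s)" for s
  proof -
    have e: "2 * (s + 2 * pi) = 2 * s + real 4 * pi" by simp
    show "cos (2 * (s + 2 * pi)) = cos (2 * s)" "sin (2 * (s + 2 * pi)) = sin (2 * s)"
      unfolding e cos_add sin_add cos_npi sin_npi by simp_all
  qed
  have h: "has_periodic_h1_deriv h h'"
    unfolding h_def h'_def
    by (rule h1_smooth, simp only: per) (auto simp: mult.commute intro!: derivative_eq_intros continuous_intros)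
  have "has_periodic_h1_deriv h' (\<lambda>t. (- 4 * cos (2 * t)) *\<^sub>R c + (- 4 * sin (2 * t)) *\<^sub>R d)"
    unfolding h'_def
    by (rule h1_smooth, simp only: per) (auto simp: mult.commute intro!: derivative_eq_intros continuous_intros)
  moreover have "(\<lambda>t. (- 4 * cos (2 * t)) *\<^sub>R c + (- 4 * sin (2 * t)) *\<^sub>R d) = (\<lambda>t. (-4) *\<^sub>R h t)"
    by (simp add: h_def algebra_simps)
  ultimately have h2: "has_periodic_h1_deriv h' (\<lambda>t. (-4) *\<^sub>R h t)" by simp
  have g: "has_periodic_h1_deriv g g'" unfolding g_def g'_def by (rule h1_diff[OF f h])
  have pg: "(LINT t|circ. p t *\<^sub>R g t) = (LINT t|circ. p t *\<^sub>R f t) - ((LINT t|circ. p t * cos (2 * t)) *\<^sub>R c + (LINT t|circ. p t * sin (2 * t)) *\<^sub>R d)"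
    if "continuous_on {0..2*pi} p" for p
    unfolding g_def h_def by (rule integral_scaleR_lincomb) (auto intro!: continuous_intros that h1_sq_int[OF f])
  have mg: "(LINT s|circ. g s) = 0" "(LINT s|circ. cos s *\<^sub>R g s) = 0" "(LINT s|circ. sin s *\<^sub>R g s) = 0"
      "(LINT s|circ. cos (2 * s) *\<^sub>R g s) = 0" "(LINT s|circ. sin (2 * s) *\<^sub>R g s) = 0"
    using pg[of "\<lambda>_. 1"] pg[of cos] pg[of sin] pg[of "\<lambda>t. cos (2 * t)"] pg[of "\<lambda>t. sin (2 * t)"] m
    by (simp_all add: trig_products trig_integrals continuous_intros c_def d_def)
  have gh: "ip h g = 0"
  proof -
    have "ip h g = ip (\<lambda>t. cos (2 * t) *\<^sub>R c) g + ip (\<lambda>t. sin (2 * t) *\<^sub>R d) g"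
      unfolding h_def by (rule ip_add_left) (auto intro!: sq_int_cont continuous_intros h1_sq_int[OF g])
    also have "\<dots> = 0"
      using mg(4,5) by (simp add: ip_scaleR_const_left h1_sq_int[OF g] continuous_intros)
    finally show ?thesis .
  qed
  have g'h': "ip h' g' = 0"
    using ip_parts[OF g h2, unfolded ip_scaleR_right] gh by (simp add: ip_commute[of h' g'] ip_commute[of g h])
  have h'h': "sqn h' = 4 * sqn h"
    using ip_parts[OF h h2, unfolded ip_scaleR_right] by simp
  note sq = h1_sq_int[OF g] h1_sq_int[OF h] h1_sq_int_deriv[OF g] h1_sq_int_deriv[OF h]
  have "f = (\<lambda>s. h s + g s)" "f' = (\<lambda>s. h' s + g' s)" by (simp_all add: g_def g'_def)
  then have ff: "sqn f = sqn h + sqn g" "sqn f' = 4 * sqn h + sqn g'"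
    using sq gh g'h' h'h' by (simp_all add: ip_sq_add)
  define M where "M = (pi^3 / 6 - 5 * pi / 4) * sqn g' / pi\<^sup>2"
  have b: "(norm (g s))\<^sup>2 \<le> M" if "s \<in> {0..2*pi}" for s
    using sup_bound_high_modes[OF g that mg] by (simp add: M_def field_simps)
  have "sqn g \<le> (LINT s|circ. M)"
    unfolding ip_self by (rule integral_mono_AE) (use b sq in \<open>auto intro: sq_int_norm2\<close>)
  also have "\<dots> = 2 * pi * M" by simp
  also have "\<dots> = (pi\<^sup>2 / 3 - 5 / 2) * sqn g'"
    by (simp add: M_def power2_eq_square power3_eq_cube field_simps)
  also have "\<dots> \<le> 10 / 11 * sqn g'"
  proof (rule mult_right_mono)
    have "pi\<^sup>2 \<le> (318/100)\<^sup>2" by (rule power_mono) (use pi_less_318 in auto)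
    then show "pi\<^sup>2 / 3 - 5 / 2 \<le> 10 / 11" by (simp add: power2_eq_square)
  qed (rule ip_self_nonneg)
  finally have "11 * sqn g \<le> 10 * sqn g'" by (simp add: field_simps)
  then have "11 * sqn h + 11 * sqn g \<le> 40 * sqn h + 10 * sqn g'"
    using ip_self_nonneg[of h] by linarith
  then show ?thesis unfolding ff by simp
qed

lemma antiperiodic_integral_zero:
  fixes f :: "real \<Rightarrow> 'a::euclidean_space"
  assumes c: "continuous_on UNIV f" and a: "\<And>s. f (s + pi) = - f s"
  shows "(LINT s|circ. f s) = 0"
proof -
  have io: "f integrable_on {a..b}" for a b
    by (intro integrable_continuous_interval continuous_on_subset[OF c]) auto
  have "set_integrable lborel {0..2*pi} f"
    unfolding set_integrable_circ_iff by (rule integrable_circ_cont[OF continuous_on_subset[OF c]]) simp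
  then have "(LINT s|circ. f s) = integral {0..2*pi} f"
    unfolding lebesgue_circ_eq[symmetric] by (rule set_borel_integral_eq_integral(2))
  also have "\<dots> = integral {0..pi} f + integral {pi..2*pi} f"
    by (rule Henstock_Kurzweil_Integration.integral_combine[symmetric]) (use io in auto)
  also have "integral {pi..2*pi} f = integral {0..pi} (f \<circ> (\<lambda>x. x + pi))"
  proof -
    have "integral {0..pi} (f \<circ> (\<lambda>x. x + pi)) = integral {0 + pi..pi + pi} f"
      by (rule integral_shift[OF continuous_on_subset[OF c]]) simp
    then show ?thesis by simp
  qed
  also have "\<dots> = - integral {0..pi} f" by (simp add: o_def a)
  finally show ?thesis by simp
qed

section \<open>Ovals and their polar angle\<close>

text \<open>The scalar data of \<open>X\<^sub>0(s) = cos(s - s\<^sub>0) e\<^sub>1 + \<beta> sin(s - s\<^sub>0) e\<^sub>2\<close>: \<open>w\<close> is \<open>X\<^sub>0\<close> in complex notation, \<open>r\<close> its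
  modulus and \<open>\<zeta> = w/cnj w = exp(2i\<theta>)\<close> for its polar angle \<open>\<theta>\<close>. The curvature \<open>\<kappa> = \<theta>'\<close> equals \<open>\<beta>/r\<^sup>2\<close>
  because \<open>X\<^sub>0'' = - X\<^sub>0\<close> conserves angular momentum. Unlike \<open>\<theta>\<close>, \<open>\<zeta>\<close> is periodic. The
  functions \<open>r1\<close> and \<open>E1\<close> are the derivatives of \<open>r\<close> and \<open>E\<close>, and \<open>coef y k\<close> is the \<open>k\<close>-th Fourier coefficient of
  \<open>y/r\<close> as a function of \<open>\<theta>\<close>.\<close>

locale oval =
  fixes \<beta> s0 :: real
  assumes \<beta>: "0 < \<beta>" "\<beta> \<le> 1"
begin

definition q :: real where "q = (1 - \<beta>) / (1 + \<beta>)"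

definition w :: "real \<Rightarrow> complex" where "w s = Complex (cos (s - s0)) (\<beta> * sin (s - s0))"
definition r :: "real \<Rightarrow> real" where "r s = sqrt ((cos (s - s0))\<^sup>2 + (\<beta> * sin (s - s0))\<^sup>2)"
definition r1 :: "real \<Rightarrow> real" where "r1 s = (\<beta>\<^sup>2 - 1) * cos (s - s0) * sin (s - s0) / r s"
definition \<kappa> :: "real \<Rightarrow> real" where "\<kappa> s = \<beta> / (r s)\<^sup>2"
definition \<zeta> :: "real \<Rightarrow> complex" where "\<zeta> s = w s / cnj (w s)"
definition E :: "int \<Rightarrow> real \<Rightarrow> complex" where "E k s = of_real (r s) * \<zeta> s powi k"
definition E1 :: "int \<Rightarrow> real \<Rightarrow> complex" where
  "E1 k s = (of_real (r1 s) + \<i> * of_real (2 * of_int k * \<beta> / r s)) * \<zeta> s powi k"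
definition T :: real where "T = (LINT s|circ. \<kappa> s)"
definition coef :: "(real \<Rightarrow> complex) \<Rightarrow> int \<Rightarrow> complex" where
  "coef y k = (LINT s|circ. of_real (\<kappa> s / r s) * \<zeta> s powi (- k) * y s) / of_real T"

lemma q: "0 \<le> q" "q < 1"
  using \<beta> by (auto simp: q_def field_simps)

lemma r_sq: "(r s)\<^sup>2 = (cos (s - s0))\<^sup>2 + (\<beta> * sin (s - s0))\<^sup>2"
  by (simp add: r_def)

lemma r_ge: "r s \<ge> \<beta>"
proof -
  have "\<beta>\<^sup>2 = \<beta>\<^sup>2 * (cos (s - s0))\<^sup>2 + \<beta>\<^sup>2 * (sin (s - s0))\<^sup>2" 
    by (simp add: distrib_left[symmetric])
  also have "\<dots> \<le> 1 * (cos (s - s0))\<^sup>2 + \<beta>\<^sup>2 * (sin (s - s0))\<^sup>2"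
    using \<beta> by (intro add_right_mono mult_right_mono) (auto simp: power_le_one)
  finally show ?thesis unfolding r_def by (intro real_le_rsqrt) (simp add: power_mult_distrib)
qed

lemma r_pos [simp]: "r s > 0" "r s \<noteq> 0"
  using r_ge[of s] \<beta> by auto

lemma r_le: "r s \<le> 1"
proof -
  have "\<beta>\<^sup>2 * (sin (s - s0))\<^sup>2 \<le> 1 * (sin (s - s0))\<^sup>2"
    using \<beta> by (intro mult_right_mono) (auto simp: power_le_one)
  then have "(cos (s - s0))\<^sup>2 + (\<beta> * sin (s - s0))\<^sup>2 \<le> 1"
    using sin_cos_squared_add[of "s - s0"] unfolding power_mult_distrib by linarith
  then show ?thesis unfolding r_def by simp
qed

lemma shift_pi:
  "w (s + pi) = - w s" "r (s + pi) = r s" "r1 (s + pi) = r1 s" "\<kappa> (s + pi) = \<kappa> s" "\<zeta> (s + pi) = \<zeta> s"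
  "E k (s + pi) = E k s" "E1 k (s + pi) = E1 k s"
proof -
  have e: "s + pi - s0 = (s - s0) + pi" by simp
  show "w (s + pi) = - w s" unfolding w_def e by (simp add: complex_eq_iff)
  then show z: "\<zeta> (s + pi) = \<zeta> s" by (simp add: \<zeta>_def)
  show r: "r (s + pi) = r s" unfolding r_def e by simp
  then show "r1 (s + pi) = r1 s" unfolding r1_def e by simp
  then show "\<kappa> (s + pi) = \<kappa> s" "E k (s + pi) = E k s" "E1 k (s + pi) = E1 k s" 
    using r z by (simp_all add: \<kappa>_def E_def E1_def)
qed

lemma shift_2pi: "f (s + 2 * pi) = f s" if "\<And>s. f (s + pi) = f s"
  using that[of s] that[of "s + pi"] by (simp add: add.assoc)

lemma w_norm: "norm (w s) = r s"
  by (simp add: w_def r_def complex_norm)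

lemma w_nz [simp]: "w s \<noteq> 0"
  using w_norm[of s] r_pos[of s] by (metis norm_zero)

lemma w_cnj: "w s * cnj (w s) = of_real ((r s)\<^sup>2)"
  by (simp add: complex_norm_square[symmetric] w_norm)

lemma \<zeta>_nz [simp]: "\<zeta> s \<noteq> 0" by (simp add: \<zeta>_def)

lemma \<zeta>_norm [simp]: "norm (\<zeta> s) = 1" by (simp add: \<zeta>_def norm_divide)

lemma \<zeta>_powi_norm [simp]: "norm (\<zeta> s powi k) = 1" by (simp add: norm_power_int)

lemma \<zeta>_cnj: "cnj (\<zeta> s powi k) = \<zeta> s powi (- k)"
proof -
  have "cnj (\<zeta> s) = inverse (\<zeta> s)" by (simp add: \<zeta>_def)
  then show ?thesis by (simp add: power_int_minus power_int_inverse)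
qed

lemma r_deriv: "(r has_real_derivative r1 s) (at s)"
proof -
  have p: "(cos (s - s0))\<^sup>2 + (\<beta> * sin (s - s0))\<^sup>2 > 0" using r_sq[of s] r_pos(1)[of s] by (metis zero_less_power)
  have "((\<lambda>s. (cos (s - s0))\<^sup>2 + (\<beta> * sin (s - s0))\<^sup>2) has_real_derivative 2 * ((\<beta>\<^sup>2 - 1) * cos (s - s0) * sin (s - s0))) (at s)"
    by (auto intro!: derivative_eq_intros simp: algebra_simps power2_eq_square)
  from DERIV_chain2[where f=sqrt, OF DERIV_real_sqrt[OF p] this]
  show ?thesis
    unfolding r_def[symmetric] r1_def by (rule DERIV_cong) (simp add: field_simps)
qed

text \<open>The radial equation of the harmonic oscillator, \<open>r'' = \<kappa>\<^sup>2 r - r\<close> with \<open>\<kappa>\<^sup>2 r = \<beta>\<^sup>2/r\<^sup>3\<close>; the left-hand side is \<open>r''\<close>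
  as it comes from differentiating \<open>r1\<close>.\<close>

lemma r_ode: "(\<beta>\<^sup>2 - 1) * ((cos (s - s0))\<^sup>2 - (sin (s - s0))\<^sup>2) / r s - (\<beta>\<^sup>2 - 1) * cos (s - s0) * sin (s - s0) * r1 s / (r s)\<^sup>2
   = (\<kappa> s)\<^sup>2 * r s - r s"
proof -
  define c d where "c = cos (s - s0)" and "d = sin (s - s0)"
  have cd: "c\<^sup>2 + d\<^sup>2 = 1" by (simp add: c_def d_def)
  have r2: "(r s)\<^sup>2 = c\<^sup>2 + \<beta>\<^sup>2 * d\<^sup>2" by (simp add: r_sq c_def d_def power_mult_distrib)
  have "((\<beta>\<^sup>2 - 1) * (c\<^sup>2 - d\<^sup>2)) * (r s)\<^sup>2 - ((\<beta>\<^sup>2 - 1) * c * d)\<^sup>2 = \<beta>\<^sup>2 - (r s)\<^sup>2 * (r s)\<^sup>2"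
    unfolding r2 using cd by algebra
  moreover have "A / R - B * (B / R) / R\<^sup>2 = (A * R\<^sup>2 - B\<^sup>2) / R^3" if "R \<noteq> 0" for A B R :: real
    using that by (simp add: field_simps power2_eq_square power3_eq_cube)
  moreover have "(\<beta>\<^sup>2 - R\<^sup>2 * R\<^sup>2) / R^3 = (\<beta> / R\<^sup>2)\<^sup>2 * R - R" if "R \<noteq> 0" for R :: real
    using that by (simp add: field_simps power2_eq_square power3_eq_cube)
  ultimately show ?thesis
    unfolding r1_def \<kappa>_def c_def[symmetric] d_def[symmetric] by simp
qed

lemma r1_deriv: "(r1 has_real_derivative ((\<kappa> s)\<^sup>2 * r s - r s)) (at s)"
  unfolding r_ode[symmetric] r1_def[abs_def]
  by (auto intro!: derivative_eq_intros r_deriv simp: field_simps power2_eq_square r1_def)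

lemma w_deriv: "(w has_vector_derivative Complex (- sin (s - s0)) (\<beta> * cos (s - s0))) (at s)"
  unfolding w_def by (auto intro!: derivative_eq_intros has_vector_derivative_complex_iff[THEN iffD2] 
    simp: has_vector_derivative_complex_iff)

text \<open>As \<open>\<zeta> = w/cnj w\<close>, the derivative contains the angular momentum \<open>Im(w' cnj w) = \<beta>\<close>.\<close>

lemma \<zeta>_deriv: "(\<zeta> has_vector_derivative (2 * \<i> * of_real (\<kappa> s) * \<zeta> s)) (at s)"
proof -
  define w' where "w' = Complex (- sin (s - s0)) (\<beta> * cos (s - s0))"
  have w: "(w has_vector_derivative w') (at s)" unfolding w'_def by (rule w_deriv)
  then have wc: "((\<lambda>s. cnj (w s)) has_vector_derivative cnj w') (at s)"
    by (rule bounded_linear.has_vector_derivative[OF bounded_linear_cnj])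
  have "(inverse has_field_derivative - (1 / (cnj (w s))\<^sup>2)) (at (cnj (w s)))"
    by (auto intro!: derivative_eq_intros simp: power2_eq_square field_simps)
  from field_vector_diff_chain_at[OF wc this]
  have "((\<lambda>s. inverse (cnj (w s))) has_vector_derivative (cnj w' * - (1 / (cnj (w s))\<^sup>2))) (at s)"
    by (simp add: o_def)
  from has_vector_derivative_mult[OF w this]
  have "(\<zeta> has_vector_derivative (w s * (cnj w' * - (1 / (cnj (w s))\<^sup>2)) + w' * inverse (cnj (w s)))) (at s)"
    by (simp add: \<zeta>_def[abs_def] divide_inverse)
  also have "w s * (cnj w' * - (1 / (cnj (w s))\<^sup>2)) + w' * inverse (cnj (w s)) = (w' * cnj (w s) - w s * cnj w') / (cnj (w s))\<^sup>2"
    by (simp add: field_simps power2_eq_square)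
  also have "w' * cnj (w s) - w s * cnj w' = 2 * \<i> * of_real \<beta>"
  proof -
    have "\<beta> * sin (s - s0) * sin (s - s0) + \<beta> * cos (s - s0) * cos (s - s0) = \<beta> * ((sin (s - s0))\<^sup>2 + (cos (s - s0))\<^sup>2)"
      by (simp only: power2_eq_square distrib_left mult.assoc)
    then show ?thesis by (simp add: complex_eq_iff w'_def w_def algebra_simps)
  qed
  also have "2 * \<i> * of_real \<beta> / (cnj (w s))\<^sup>2 = 2 * \<i> * of_real (\<kappa> s) * \<zeta> s"
  proof -
    have "of_real (\<kappa> s) = of_real \<beta> / (w s * cnj (w s))" by (simp add: \<kappa>_def w_cnj)
    then show ?thesis by (simp add: \<zeta>_def power2_eq_square)
  qed
  finally show ?thesis .
qed

lemma \<zeta>_powi_deriv: "((\<lambda>s. \<zeta> s powi k) has_vector_derivative (2 * \<i> * of_int k * of_real (\<kappa> s) * \<zeta> s powi k)) (at s)"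
proof -
  have "((\<lambda>x. x powi k) has_field_derivative (of_int k * \<zeta> s powi (k - 1))) (at (\<zeta> s))"
    by (auto intro!: derivative_eq_intros)
  from field_vector_diff_chain_at[OF \<zeta>_deriv this]
  have "((\<lambda>s. \<zeta> s powi k) has_vector_derivative (2 * \<i> * of_real (\<kappa> s) * \<zeta> s * (of_int k * \<zeta> s powi (k - 1)))) (at s)"
    by (simp add: o_def)
  moreover have "\<zeta> s powi k = \<zeta> s * \<zeta> s powi (k - 1)"
    using power_int_add[of "\<zeta> s" 1 "k - 1"] by simp
  ultimately show ?thesis by (simp add: mult_ac)
qed

lemma r_cont [continuous_intros]: "continuous_on A r"
  by (intro continuous_at_imp_continuous_on ballI DERIV_isCont[OF r_deriv])

lemma r1_cont [continuous_intros]: "continuous_on A r1"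
  by (intro continuous_at_imp_continuous_on ballI DERIV_isCont[OF r1_deriv])

lemma \<kappa>_cont [continuous_intros]: "continuous_on A \<kappa>"
  unfolding \<kappa>_def by (intro continuous_intros) auto

lemma \<zeta>_cont [continuous_intros]: "continuous_on A (\<lambda>s. \<zeta> s powi k)"
  by (intro continuous_at_imp_continuous_on ballI has_vector_derivative_continuous[OF \<zeta>_powi_deriv])

lemma E_cont [continuous_intros]: "continuous_on A (E k)"
  unfolding E_def by (intro continuous_intros)

lemma E1_cont [continuous_intros]: "continuous_on A (E1 k)"
  unfolding E1_def by (intro continuous_intros) auto

lemma E_deriv: "(E k has_vector_derivative E1 k s) (at s)"
proof -
  have "((\<lambda>s. r s *\<^sub>R \<zeta> s powi k) has_vector_derivative (r s *\<^sub>R (2 * \<i> * of_int k * of_real (\<kappa> s) * \<zeta> s powi k) + r1 s *\<^sub>R \<zeta> s powi k)) (at s)"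
    by (rule has_vector_derivative_scaleR[OF r_deriv \<zeta>_powi_deriv])
  moreover have "(\<lambda>s. r s *\<^sub>R \<zeta> s powi k) = E k" by (simp add: E_def[abs_def] scaleR_conv_of_real)
  moreover have "r s *\<^sub>R (2 * \<i> * of_int k * of_real (\<kappa> s) * \<zeta> s powi k) + r1 s *\<^sub>R \<zeta> s powi k = E1 k s"
    by (simp add: E1_def \<kappa>_def scaleR_conv_of_real field_simps power2_eq_square)
  ultimately show ?thesis by simp
qed

text \<open>The terms with \<open>r1\<close> cancel, because \<open>2 r' \<kappa> + r \<kappa>' = 0\<close>.\<close>

lemma E1_deriv: "(E1 k has_vector_derivative ((1 - 4 * (of_int k)\<^sup>2) * (\<kappa> s)\<^sup>2) *\<^sub>R E k s - E k s) (at s)"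
proof -
  have "((\<lambda>s. 2 * of_int k * \<beta> / r s) has_real_derivative (- (2 * of_int k * \<beta> * r1 s / (r s)\<^sup>2))) (at s)"
    by (auto intro!: derivative_eq_intros r_deriv simp: power2_eq_square)
  from has_vector_derivative_scaleR[OF this \<zeta>_powi_deriv[of k]]
  have 1: "((\<lambda>s. \<i> * ((2 * of_int k * \<beta> / r s) *\<^sub>R \<zeta> s powi k)) has_vector_derivative
     (\<i> * ((2 * of_int k * \<beta> / r s) *\<^sub>R (2 * \<i> * of_int k * of_real (\<kappa> s) * \<zeta> s powi k) + - (2 * of_int k * \<beta> * r1 s / (r s)\<^sup>2) *\<^sub>R \<zeta> s powi k))) (at s)"
    by (rule has_vector_derivative_mult_right)
  have 2: "((\<lambda>s. r1 s *\<^sub>R \<zeta> s powi k) has_vector_derivative (r1 s *\<^sub>R (2 * \<i> * of_int k * of_real (\<kappa> s) * \<zeta> s powi k) + ((\<kappa> s)\<^sup>2 * r s - r s) *\<^sub>R \<zeta> s powi k)) (at s)"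
    by (rule has_vector_derivative_scaleR[OF r1_deriv \<zeta>_powi_deriv])
  have "(\<lambda>s. r1 s *\<^sub>R \<zeta> s powi k + \<i> * ((2 * of_int k * \<beta> / r s) *\<^sub>R \<zeta> s powi k)) = E1 k"
    by (simp add: E1_def[abs_def] scaleR_conv_of_real algebra_simps)
  moreover have "r1 s *\<^sub>R (2 * \<i> * of_int k * of_real (\<kappa> s) * \<zeta> s powi k) + ((\<kappa> s)\<^sup>2 * r s - r s) *\<^sub>R \<zeta> s powi k
      + \<i> * ((2 * of_int k * \<beta> / r s) *\<^sub>R (2 * \<i> * of_int k * of_real (\<kappa> s) * \<zeta> s powi k) + - (2 * of_int k * \<beta> * r1 s / (r s)\<^sup>2) *\<^sub>R \<zeta> s powi k)
     = ((1 - 4 * (of_int k)\<^sup>2) * (\<kappa> s)\<^sup>2) *\<^sub>R E k s - E k s"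
  proof -
    have k: "2 * of_int k * \<beta> / r s = 2 * of_int k * \<kappa> s * r s" "2 * of_int k * \<beta> * r1 s / (r s)\<^sup>2 = 2 * of_int k * \<kappa> s * r1 s"
      by (simp_all add: \<kappa>_def power2_eq_square)
    have ii: "\<i> * (\<i> * x) = - x" for x by (simp flip: mult.assoc)
    show ?thesis unfolding k
      by (simp add: E_def scaleR_conv_of_real algebra_simps power2_eq_square ii)
  qed
  ultimately show ?thesis using has_vector_derivative_add[OF 2 1] by simp
qed

lemma h1_E: "has_periodic_h1_deriv (E k) (E1 k)"
  by (rule h1_smooth) (auto intro: shift_2pi shift_pi E_deriv E1_cont)

lemma h1_E1: "has_periodic_h1_deriv (E1 k) (\<lambda>s. ((1 - 4 * (of_int k)\<^sup>2) * (\<kappa> s)\<^sup>2) *\<^sub>R E k s - E k s)"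
  by (rule h1_smooth) (auto intro!: shift_2pi[where f="E1 k"] shift_pi E1_deriv continuous_intros)

lemma E_trig: "(LINT s|circ. cos s *\<^sub>R E k s) = 0" "(LINT s|circ. sin s *\<^sub>R E k s) = 0"
  by (rule antiperiodic_integral_zero; (intro continuous_intros)?; simp add: shift_pi)+

lemma T_pos: "T > 0"
proof -
  have "continuous_on {0..2*pi} \<kappa>" by (intro continuous_intros)
  have "\<beta> \<le> \<kappa> s" for s
    using r_le[of s] r_pos(1)[of s] \<beta> power_le_one[OF less_imp_le[OF r_pos(1)] r_le, of s 2] by (simp add: \<kappa>_def le_divide_eq)
  then have "(LINT s|circ. \<beta>) \<le> T" unfolding T_def
    by (intro integral_mono) (auto intro!: integrable_circ_cont continuous_intros)
  moreover have "(LINT s|circ. \<beta>) > 0" using \<beta> by simp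
  ultimately show ?thesis by linarith
qed

text \<open>For \<open>k \<noteq> 0\<close> the integrand is a multiple of the derivative of \<open>\<zeta>\<^sup>k\<close>.\<close>

lemma \<kappa>_orth: "(LINT s|circ. of_real (\<kappa> s) * \<zeta> s powi k) = (if k = 0 then of_real T else 0)"
proof (cases "k = 0")
  case True
  have "(LINT s|circ. complex_of_real (\<kappa> s)) = of_real (LINT s|circ. \<kappa> s)"
    by (rule integral_complex_of_real)
  then show ?thesis using True by (simp add: T_def)
next
  case False
  have d: "has_periodic_h1_deriv (\<lambda>s. \<zeta> s powi k) (\<lambda>s. 2 * \<i> * of_int k * of_real (\<kappa> s) * \<zeta> s powi k)"
    by (rule h1_smooth) (auto intro!: shift_2pi[where f="\<lambda>s. \<zeta> s powi k"] \<zeta>_powi_deriv continuous_intros simp: shift_pi)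
  have "(LINT s|circ. (2 * \<i> * of_int k) * (of_real (\<kappa> s) * \<zeta> s powi k)) = 0"
    using h1_integral_deriv[OF d] by (simp add: mult.assoc)
  then show ?thesis using False by simp
qed

text \<open>Equivalently \<open>\<kappa> = |1 - q \<zeta>|\<^sup>2/(1 - q\<^sup>2)\<close>: in polar coordinates \<open>1/r\<^sup>2 = cos\<^sup>2\<theta> + \<beta>\<^sup>-\<^sup>2 sin\<^sup>2\<theta>\<close>, the
  equation of the ellipse traced by \<open>X\<^sub>0\<close>.\<close>

lemma \<kappa>_Poisson: "complex_of_real (\<kappa> s) = (1 + (of_real q)\<^sup>2 - of_real q * (\<zeta> s + inverse (\<zeta> s))) / (1 - (of_real q)\<^sup>2)"
proof -
  have i: "inverse (\<zeta> s) = cnj (\<zeta> s)" using \<zeta>_cnj[of s 1] by (simp add: power_int_minus)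
  have z: "\<zeta> s = (w s)\<^sup>2 / of_real ((r s)\<^sup>2)" unfolding w_cnj[symmetric] \<zeta>_def by (simp add: power2_eq_square)
  have re: "Re (\<zeta> s) = ((cos (s - s0))\<^sup>2 - (\<beta> * sin (s - s0))\<^sup>2) / (r s)\<^sup>2"
    unfolding z by (simp only: Re_divide_of_real) (simp add: w_def power2_eq_square)
  have "\<zeta> s + inverse (\<zeta> s) = of_real (2 * Re (\<zeta> s))"
    unfolding i by (simp add: complex_add_cnj)
  moreover have "\<kappa> s = (1 + q\<^sup>2 - q * (2 * Re (\<zeta> s))) / (1 - q\<^sup>2)"
  proof -
    define c d where "c = (cos (s - s0))\<^sup>2" and "d = (sin (s - s0))\<^sup>2"
    have cd: "c = 1 - d" by (simp add: c_def d_def cos_squared_eq)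
    have r2: "(r s)\<^sup>2 = c + \<beta>\<^sup>2 * d" by (simp add: r_sq c_def d_def power_mult_distrib)
    then have nz: "c + \<beta>\<^sup>2 * d \<noteq> 0" using r_pos(2)[of s] by (metis zero_eq_power2)
    have b: "(1 + \<beta>) \<noteq> 0" using \<beta> by simp
    have "1 - q\<^sup>2 = 4 * \<beta> / (1 + \<beta>)\<^sup>2" "1 + q\<^sup>2 = 2 * (1 + \<beta>\<^sup>2) / (1 + \<beta>)\<^sup>2" "q * 2 = 2 * (1 - \<beta>\<^sup>2) / (1 + \<beta>)\<^sup>2"
    proof -
      have qB: "q * (1 + \<beta>) = 1 - \<beta>" unfolding q_def using b by simp
      have "(1 - q\<^sup>2) * (1 + \<beta>)\<^sup>2 = 4 * \<beta>" "(1 + q\<^sup>2) * (1 + \<beta>)\<^sup>2 = 2 * (1 + \<beta>\<^sup>2)" "q * 2 * (1 + \<beta>)\<^sup>2 = 2 * (1 - \<beta>\<^sup>2)"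
        using qB by algebra+
      then show "1 - q\<^sup>2 = 4 * \<beta> / (1 + \<beta>)\<^sup>2" "1 + q\<^sup>2 = 2 * (1 + \<beta>\<^sup>2) / (1 + \<beta>)\<^sup>2" "q * 2 = 2 * (1 - \<beta>\<^sup>2) / (1 + \<beta>)\<^sup>2"
        using b by (simp_all add: eq_divide_eq)
    qed
    note e = this
    have e0: "(1 + q\<^sup>2 - q * (2 * Re (\<zeta> s))) = (1 + q\<^sup>2 - q * 2 * Re (\<zeta> s))" by simp
    have "(1 + q\<^sup>2 - q * (2 * Re (\<zeta> s))) / (1 - q\<^sup>2) = (2 * (1 + \<beta>\<^sup>2) - 2 * (1 - \<beta>\<^sup>2) * Re (\<zeta> s)) / (4 * \<beta>)"
    proof -
      have "(x / u - y / u * z) / (v / u) = (x - y * z) / v" if "u \<noteq> 0" for x y z u v :: real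
        using that by (simp add: diff_divide_distrib[symmetric])
      from this[of "(1 + \<beta>)\<^sup>2"] b show ?thesis unfolding e0 unfolding e by simp
    qed
    also have "\<dots> = \<beta> / (r s)\<^sup>2"
    proof -
      have p4: "(2 * (1 + \<beta>\<^sup>2) * (c + \<beta>\<^sup>2 * d) - 2 * (1 - \<beta>\<^sup>2) * (c - \<beta>\<^sup>2 * d)) = 4 * \<beta> * \<beta>"
        unfolding cd by (simp add: power2_eq_square algebra_simps)
      have "(2 * (1 + \<beta>\<^sup>2) - 2 * (1 - \<beta>\<^sup>2) * ((c - \<beta>\<^sup>2 * d) / (c + \<beta>\<^sup>2 * d))) = 4 * \<beta> * \<beta> / (c + \<beta>\<^sup>2 * d)"
      proof -
        have "P - Q * (X / Y) = (P * Y - Q * X) / Y" if "Y \<noteq> 0" for P Q X Y :: real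
          using that by (simp add: field_simps)
        from this[OF nz] show ?thesis unfolding p4[symmetric] by simp
      qed
      then show ?thesis unfolding re r2 power_mult_distrib c_def[symmetric] d_def[symmetric]
        using \<beta> by simp
    qed
    finally show ?thesis by (simp add: \<kappa>_def)
  qed
  ultimately show ?thesis by simp
qed

end

section \<open>The quadratic form and its expansion in the functions \<open>E\<^sub>k\<close>\<close>

definition J :: "(real \<Rightarrow> 'a::euclidean_space) \<Rightarrow> (real \<Rightarrow> 'a) \<Rightarrow> real" where
  "J f f' = sqn f' - sqn f"

definition J_polar :: "(real \<Rightarrow> 'a::euclidean_space) \<Rightarrow> (real \<Rightarrow> 'a) \<Rightarrow> (real \<Rightarrow> 'a) \<Rightarrow> (real \<Rightarrow> 'a) \<Rightarrow> real" where
  "J_polar f f' g g' = ip f' g' - ip f g"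

lemma J_diff:
  fixes f g :: "real \<Rightarrow> 'a::euclidean_space"
  assumes f: "has_periodic_h1_deriv f f'" and g: "has_periodic_h1_deriv g g'"
  shows "J (\<lambda>s. f s - g s) (\<lambda>s. f' s - g' s) = J f f' - 2 * J_polar f f' g g' + J g g'"
  unfolding J_def J_polar_def
  using h1_sq_int[OF f] h1_sq_int[OF g] h1_sq_int_deriv[OF f] h1_sq_int_deriv[OF g]
  by (simp add: ip_sq_diff)

lemma h1_sum:
  fixes f :: "'i \<Rightarrow> real \<Rightarrow> 'a::euclidean_space"
  assumes "finite K" "\<And>k. k \<in> K \<Longrightarrow> has_periodic_h1_deriv (f k) (f' k)"
  shows "has_periodic_h1_deriv (\<lambda>s. \<Sum>k\<in>K. f k s) (\<lambda>s. \<Sum>k\<in>K. f' k s)"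
  using assms
proof (induction K rule: finite_induct)
  case empty
  show ?case by (rule h1_smooth) auto
next
  case (insert k K)
  then show ?case using h1_add[of "f k" "f' k" "\<lambda>s. \<Sum>k\<in>K. f k s" "\<lambda>s. \<Sum>k\<in>K. f' k s"] by simp
qed

lemma ip_sum_right:
  assumes "sq_int y" "\<And>k. k \<in> K \<Longrightarrow> sq_int (f k)"
  shows "ip y (\<lambda>s. \<Sum>k\<in>K. f k s) = (\<Sum>k\<in>K. ip y (f k))"
  unfolding ip_def inner_sum_right using assms by (intro Bochner_Integration.integral_sum sq_int_inner)

lemma integrable_cont_mult:
  fixes p y :: "real \<Rightarrow> complex"
  assumes "continuous_on {0..2*pi} p" "sq_int y"
  shows "integrable circ (\<lambda>s. p s * y s)"
  by (rule sq_int_bilinear[OF bounded_bilinear_mult sq_int_cont[OF assms(1)] assms(2)])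

lemma integral_scaleR_diff_cont:
  fixes f g :: "real \<Rightarrow> 'a::euclidean_space"
  assumes "continuous_on {0..2*pi} p" "sq_int f" "sq_int g"
  shows "(LINT s|circ. p s *\<^sub>R (f s - g s)) = (LINT s|circ. p s *\<^sub>R f s) - (LINT s|circ. p s *\<^sub>R g s)"
  unfolding scaleR_diff_right
  by (intro Bochner_Integration.integral_diff sq_int_bilinear[OF bounded_bilinear_scaleR] sq_int_cont assms)

text \<open>The first harmonics are the tangent directions of the family of minimisers, so coercivity can only
  hold on their orthogonal complement.\<close>

definition first_mode_free :: "(real \<Rightarrow> 'a::euclidean_space) \<Rightarrow> bool" where
  "first_mode_free f \<longleftrightarrow> (LINT s|circ. cos s *\<^sub>R f s) = 0 \<and> (LINT s|circ. sin s *\<^sub>R f s) = 0"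

lemma first_mode_free_diff:
  assumes "first_mode_free f" "first_mode_free g" "sq_int f" "sq_int g"
  shows "first_mode_free (\<lambda>s. f s - g s)"
  using assms integral_scaleR_diff_cont[of cos f g] integral_scaleR_diff_cont[of sin f g]
  by (simp add: first_mode_free_def continuous_intros)

lemma first_mode_free_linear:
  fixes A :: "'a::euclidean_space \<Rightarrow> 'b::euclidean_space"
  assumes A: "bounded_linear A" and f: "first_mode_free f" "sq_int f"
  shows "first_mode_free (\<lambda>s. A (f s))"
proof -
  interpret bounded_linear A by (rule A)
  have "integrable circ (\<lambda>s. cos s *\<^sub>R f s)" "integrable circ (\<lambda>s. sin s *\<^sub>R f s)"
    by (intro sq_int_bilinear[OF bounded_bilinear_scaleR] sq_int_cont continuous_intros f)+
  from integral_bounded_linear[OF A this(1)] integral_bounded_linear[OF A this(2)] show ?thesis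
    using f by (simp add: first_mode_free_def scaleR)
qed

lemma first_mode_free_sum:
  fixes f :: "'i \<Rightarrow> real \<Rightarrow> 'a::euclidean_space"
  assumes "\<And>k. k \<in> K \<Longrightarrow> first_mode_free (f k)" "\<And>k. k \<in> K \<Longrightarrow> sq_int (f k)"
  shows "first_mode_free (\<lambda>s. \<Sum>k\<in>K. f k s)"
proof -
  have "(LINT s|circ. p s *\<^sub>R (\<Sum>k\<in>K. f k s)) = (\<Sum>k\<in>K. (LINT s|circ. p s *\<^sub>R f k s))"
    if "continuous_on {0..2*pi} p" for p
    unfolding scaleR_sum_right
    by (intro Bochner_Integration.integral_sum sq_int_bilinear[OF bounded_bilinear_scaleR] sq_int_cont that assms)
  from this[of cos] this[of sin] show ?thesis
    using assms by (simp add: first_mode_free_def continuous_intros)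
qed

text \<open>From \<open>k = 2\<close> on the powers are at most \<open>q\<^sup>2\<close>, and \<open>2/(4k\<^sup>2 - 1) = 1/(2k - 1) - 1/(2k + 1)\<close>
  telescopes to \<open>1/3\<close>. For \<open>q = 1\<close> the infinite series has sum 1, so the bound is below 1 exactly
  because \<open>q < 1\<close>.\<close>

lemma weight_sum_bound:
  fixes q :: real
  assumes q: "0 \<le> q" "q < 1"
  shows "(\<Sum>k=1..N. (q^(2*(k-1)) + q^(2*k)) / (4 * (real k)\<^sup>2 - 1)) \<le> (1 + 2 * q\<^sup>2) / 3"
proof (cases "N = 0")
  case True then show ?thesis using q by simp
next
  case False
  then have "N \<ge> 1" by simp
  then have "(\<Sum>k=1..N. (q^(2*(k-1)) + q^(2*k)) / (4 * (real k)\<^sup>2 - 1)) \<le> (1 + 2 * q\<^sup>2) / 3 - q\<^sup>2 / (2 * real N + 1)"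
  proof (induction N rule: dec_induct)
    case base show ?case by (simp add: field_simps power2_eq_square)
  next
    case (step n)
    have d: "4 * (real (Suc n))\<^sup>2 - 1 = (2 * real n + 1) * (2 * real n + 3)" by (simp add: power2_eq_square algebra_simps)
    have "q^(2*n) \<le> q^2" "q^(2*Suc n) \<le> q^2"
      by (rule power_decreasing; use q step in simp)+
    then have "(q^(2*n) + q^(2*Suc n)) / (4 * (real (Suc n))\<^sup>2 - 1) \<le> 2 * q^2 / ((2 * real n + 1) * (2 * real n + 3))"
      unfolding d by (intro divide_right_mono) auto
    also have "\<dots> = q\<^sup>2 / (2 * real n + 1) - q\<^sup>2 / (2 * real (Suc n) + 1)"
    proof -
      have "2 * x / (a * (a + 2)) = x / a - x / (a + 2)" if "a > 0" for x a :: real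
        using that by (simp add: field_simps)
      from this[of "2 * real n + 1" "q^2"] show ?thesis by (simp add: algebra_simps)
    qed
    finally show ?case using step by simp
  qed
  also have "\<dots> \<le> (1 + 2 * q\<^sup>2) / 3"
  proof -
    have "0 \<le> q\<^sup>2 / (2 * real N + 1)" by simp
    then show ?thesis by linarith
  qed
  finally show ?thesis .
qed

lemma weighted_Cauchy_Schwarz:
  fixes q :: real and x y :: "nat \<Rightarrow> real"
  assumes q: "0 \<le> q" "q < 1"
  shows "(\<Sum>k=1..N. q^(k-1) * x k + q^k * y k)\<^sup>2
     \<le> (1 + 2 * q\<^sup>2) / 3 * (\<Sum>k=1..N. (4 * (real k)\<^sup>2 - 1) * ((x k)\<^sup>2 + (y k)\<^sup>2))"
proof -
  define d where "d k = 4 * (real k)\<^sup>2 - 1" for k :: nat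
  have d: "d k > 0" if "k \<ge> 1" for k
  proof -
    have "(real k)\<^sup>2 \<ge> 1" using that by simp
    then show ?thesis by (simp add: d_def)
  qed
  define \<alpha> where "\<alpha> k = sqrt ((q^(2*(k-1)) + q^(2*k)) / d k)" for k
  define b where "b k = (q^(k-1) * x k + q^k * y k) / \<alpha> k" for k
  have *: "(q^(k-1) * x k + q^k * y k)\<^sup>2 \<le> (\<alpha> k)\<^sup>2 * (d k * ((x k)\<^sup>2 + (y k)\<^sup>2))" if "k \<ge> 1" for k
  proof -
    have "(a * x + b * y)\<^sup>2 \<le> (a\<^sup>2 + b\<^sup>2) * (x\<^sup>2 + y\<^sup>2)" for a b x y :: real
    proof -
      have "(a\<^sup>2 + b\<^sup>2) * (x\<^sup>2 + y\<^sup>2) - (a * x + b * y)\<^sup>2 = (a * y - b * x)\<^sup>2"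
        by (simp add: power2_eq_square algebra_simps)
      then show ?thesis by (metis diff_ge_0_iff_ge zero_le_power2)
    qed
    from this[of "q^(k-1)" "x k" "q^k" "y k"] show ?thesis
      using d[OF that] q by (simp add: \<alpha>_def power_mult[symmetric] mult.commute[of _ 2])
  qed
  have "(\<Sum>k=1..N. q^(k-1) * x k + q^k * y k)\<^sup>2 \<le> (\<Sum>k=1..N. \<alpha> k * sqrt (d k * ((x k)\<^sup>2 + (y k)\<^sup>2)))\<^sup>2"
  proof (rule power2_le_iff_abs_le[THEN iffD2])
    have nn: "\<alpha> k \<ge> 0" if "k \<ge> 1" for k using d[OF that] q by (simp add: \<alpha>_def)
    have dn: "d k * ((x k)\<^sup>2 + (y k)\<^sup>2) \<ge> 0" if "k \<ge> 1" for k using d[OF that] by simp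
    show "0 \<le> (\<Sum>k=1..N. \<alpha> k * sqrt (d k * ((x k)\<^sup>2 + (y k)\<^sup>2)))"
      using nn dn by (intro sum_nonneg mult_nonneg_nonneg) auto
    have "\<bar>\<Sum>k=1..N. q^(k-1) * x k + q^k * y k\<bar> \<le> (\<Sum>k=1..N. \<bar>q^(k-1) * x k + q^k * y k\<bar>)" by (rule sum_abs)
    also have "\<dots> \<le> (\<Sum>k=1..N. \<alpha> k * sqrt (d k * ((x k)\<^sup>2 + (y k)\<^sup>2)))"
    proof (rule sum_mono)
      fix k assume "k \<in> {1..N}"
      then have k: "k \<ge> 1" by simp
      have "\<bar>q^(k-1) * x k + q^k * y k\<bar> \<le> sqrt ((\<alpha> k)\<^sup>2 * (d k * ((x k)\<^sup>2 + (y k)\<^sup>2)))"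
        using *[OF k] by (intro real_le_rsqrt) simp
      then show "\<bar>q^(k-1) * x k + q^k * y k\<bar> \<le> \<alpha> k * sqrt (d k * ((x k)\<^sup>2 + (y k)\<^sup>2))"
        using nn[OF k] by (simp add: real_sqrt_mult)
    qed
    finally show "\<bar>\<Sum>k=1..N. q^(k-1) * x k + q^k * y k\<bar> \<le> (\<Sum>k=1..N. \<alpha> k * sqrt (d k * ((x k)\<^sup>2 + (y k)\<^sup>2)))" .
  qed
  also have "\<dots> \<le> (\<Sum>k=1..N. (\<alpha> k)\<^sup>2) * (\<Sum>k=1..N. (sqrt (d k * ((x k)\<^sup>2 + (y k)\<^sup>2)))\<^sup>2)"
    by (rule Cauchy_Schwarz_ineq_sum)
  also have "(\<Sum>k=1..N. (sqrt (d k * ((x k)\<^sup>2 + (y k)\<^sup>2)))\<^sup>2) = (\<Sum>k=1..N. d k * ((x k)\<^sup>2 + (y k)\<^sup>2))"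
    using d by (intro sum.cong) (auto simp: less_imp_le)
  also have "(\<Sum>k=1..N. (\<alpha> k)\<^sup>2) = (\<Sum>k=1..N. (q^(2*(k-1)) + q^(2*k)) / (4 * (real k)\<^sup>2 - 1))"
    using d q by (intro sum.cong) (auto simp: \<alpha>_def d_def less_imp_le)
  also have "\<dots> * (\<Sum>k=1..N. d k * ((x k)\<^sup>2 + (y k)\<^sup>2)) \<le> (1 + 2 * q\<^sup>2) / 3 * (\<Sum>k=1..N. d k * ((x k)\<^sup>2 + (y k)\<^sup>2))"
    using d by (intro mult_right_mono weight_sum_bound q sum_nonneg) (auto simp: less_imp_le)
  finally show ?thesis by (simp add: d_def)
qed

context oval
begin

lemma h1_cE: "has_periodic_h1_deriv (\<lambda>s. c * E k s) (\<lambda>s. c * E1 k s)"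
  by (rule h1_linear[OF bounded_linear_mult_right h1_E])

lemma wt_cont: "continuous_on A (\<lambda>s. complex_of_real (\<kappa> s / r s) * \<zeta> s powi k)"
  by (intro continuous_intros) auto

lemma wt_int: "sq_int y \<Longrightarrow> integrable circ (\<lambda>s. complex_of_real (\<kappa> s / r s) * \<zeta> s powi k * y s)"
  by (intro integrable_cont_mult wt_cont)

lemma coef_diff:
  assumes "sq_int f" "sq_int g"
  shows "coef (\<lambda>s. f s - g s) k = coef f k - coef g k"
  unfolding coef_def right_diff_distrib
  by (simp only: Bochner_Integration.integral_diff[OF wt_int[OF assms(1)] wt_int[OF assms(2)]] diff_divide_distrib)

lemma coef_sum:
  assumes "\<And>k. k \<in> K \<Longrightarrow> sq_int (f k)"
  shows "coef (\<lambda>s. \<Sum>k\<in>K. f k s) l = (\<Sum>k\<in>K. coef (f k) l)"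
  unfolding coef_def sum_distrib_left
  by (simp only: Bochner_Integration.integral_sum[OF wt_int[OF assms]] sum_divide_distrib)

lemma coef_E: "coef (\<lambda>s. c * E m s) k = (if m = k then c else 0)"
proof -
  have "complex_of_real (\<kappa> s / r s) * \<zeta> s powi (- k) * (c * E m s) = c * (of_real (\<kappa> s) * \<zeta> s powi (m - k))" for s
    using power_int_add[of "\<zeta> s" m "- k"] by (simp add: E_def)
  then show ?thesis
    unfolding coef_def using T_pos by (simp add: \<kappa>_orth)
qed

lemma inner_complex_cnj: "x \<bullet> y = Re (cnj y * x)"
  by (simp add: inner_complex_def)

lemma Re_cnj_self: "Re (cnj x * x) = (norm x)\<^sup>2"
  unfolding cmod_power2 by (simp add: power2_eq_square)

text \<open>Integration by parts moves both derivatives to \<open>E k\<close>, where the differential equation of \<open>E k\<close>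
  turns them into the weight \<open>\<kappa>\<^sup>2\<close>, and \<open>\<kappa>\<^sup>2 r = \<beta> \<kappa>/r\<close>.\<close>

lemma J_polar_E:
  assumes y: "has_periodic_h1_deriv y y'"
  shows "J_polar y y' (\<lambda>s. c * E k s) (\<lambda>s. c * E1 k s) = (4 * (of_int k)\<^sup>2 - 1) * \<beta> * T * Re (cnj c * coef y k)"
proof -
  let ?a = "1 - 4 * (of_int k)\<^sup>2 :: real"
  have h: "has_periodic_h1_deriv (\<lambda>s. c * E1 k s) (\<lambda>s. c * ((?a * (\<kappa> s)\<^sup>2) *\<^sub>R E k s - E k s))"
    by (rule h1_linear[OF bounded_linear_mult_right h1_E1])
  have sq: "sq_int (\<lambda>s. c * E k s)" by (rule h1_sq_int[OF h1_cE])
  have "ip y' (\<lambda>s. c * E1 k s) = - ip y (\<lambda>s. c * ((?a * (\<kappa> s)\<^sup>2) *\<^sub>R E k s - E k s))"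
    by (rule ip_parts[OF y h])
  moreover have "ip y (\<lambda>s. c * ((?a * (\<kappa> s)\<^sup>2) *\<^sub>R E k s - E k s)) = ip y (\<lambda>s. c * ((?a * (\<kappa> s)\<^sup>2) *\<^sub>R E k s) - c * E k s)"
    by (simp add: right_diff_distrib)
  moreover have "\<dots> = ip y (\<lambda>s. c * ((?a * (\<kappa> s)\<^sup>2) *\<^sub>R E k s)) - ip y (\<lambda>s. c * E k s)"
    by (rule ip_diff_right) (auto intro!: sq_int_cont continuous_intros h1_sq_int[OF y])
  ultimately have "J_polar y y' (\<lambda>s. c * E k s) (\<lambda>s. c * E1 k s) = - ip y (\<lambda>s. c * ((?a * (\<kappa> s)\<^sup>2) *\<^sub>R E k s))"
    by (simp add: J_polar_def)
  also have "ip y (\<lambda>s. c * ((?a * (\<kappa> s)\<^sup>2) *\<^sub>R E k s)) = (LINT s|circ. Re (of_real (?a * \<beta>) * cnj c * (of_real (\<kappa> s / r s) * \<zeta> s powi (- k) * y s)))"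
    unfolding ip_def
  proof (rule Bochner_Integration.integral_cong[OF refl])
    fix s
    have k: "(\<kappa> s)\<^sup>2 * r s = \<beta> * (\<kappa> s / r s)" by (simp add: \<kappa>_def power2_eq_square)
    have "y s \<bullet> (c * ((?a * (\<kappa> s)\<^sup>2) *\<^sub>R E k s)) = Re (cnj (c * ((?a * (\<kappa> s)\<^sup>2) *\<^sub>R E k s)) * y s)"
      by (rule inner_complex_cnj)
    also have "cnj (c * ((?a * (\<kappa> s)\<^sup>2) *\<^sub>R E k s)) = cnj c * (of_real (?a * ((\<kappa> s)\<^sup>2 * r s)) * \<zeta> s powi (- k))"
      by (simp add: E_def scaleR_conv_of_real \<zeta>_cnj del: complex_cnj_power_int)
    finally show "y s \<bullet> (c * ((?a * (\<kappa> s)\<^sup>2) *\<^sub>R E k s)) = Re (of_real (?a * \<beta>) * cnj c * (of_real (\<kappa> s / r s) * \<zeta> s powi (- k) * y s))"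
      unfolding k by (simp only: of_real_mult mult_ac)
  qed
  also have "\<dots> = Re (LINT s|circ. of_real (?a * \<beta>) * cnj c * (of_real (\<kappa> s / r s) * \<zeta> s powi (- k) * y s))"
    by (rule integral_Re[OF integrable_mult_right[OF wt_int[OF h1_sq_int[OF y]]]])
  also have "\<dots> = Re (of_real (?a * \<beta>) * cnj c * (of_real T * coef y k))"
  proof -
    have "of_real T * coef y k = (LINT s|circ. of_real (\<kappa> s / r s) * \<zeta> s powi (- k) * y s)"
      using T_pos by (simp add: coef_def)
    then show ?thesis by (simp only: Bochner_Integration.integral_mult_right_zero)
  qed
  also have "\<dots> = ?a * \<beta> * T * Re (cnj c * coef y k)"
  proof -
    have "of_real (?a * \<beta>) * cnj c * (of_real T * coef y k) = of_real (?a * \<beta> * T) * (cnj c * coef y k)" by simp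
    then show ?thesis by (simp only: Re_complex_of_real Im_complex_of_real times_complex.simps, simp?)
  qed
  finally show ?thesis by (simp add: algebra_simps)
qed

lemma J_polar_sum_right:
  assumes "sq_int y" "sq_int y'" "\<And>k. k \<in> K \<Longrightarrow> sq_int (f k)" "\<And>k. k \<in> K \<Longrightarrow> sq_int (f' k)"
  shows "J_polar y y' (\<lambda>s. \<Sum>k\<in>K. f k s) (\<lambda>s. \<Sum>k\<in>K. f' k s) = (\<Sum>k\<in>K. J_polar y y' (f k) (f' k))"
  unfolding J_polar_def using assms by (simp add: ip_sum_right sum_subtractf)

lemma first_mode_free_cE: "first_mode_free (\<lambda>s. c * E k s)"
  by (rule first_mode_free_linear[OF bounded_linear_mult_right])
    (auto simp: first_mode_free_def E_trig intro: h1_sq_int[OF h1_E])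

definition \<delta>1 :: real where "\<delta>1 = min (1/20) (\<beta> * T / (4 * pi))"

lemma \<delta>1_pos: "\<delta>1 > 0" using \<beta> T_pos by (simp add: \<delta>1_def)

lemma ip_E0_le: "sqn (\<lambda>s. c * E 0 s) \<le> 2 * pi * (norm c)\<^sup>2"
proof -
  have "sqn (\<lambda>s. c * E 0 s) = (LINT s|circ. (norm (c * E 0 s))\<^sup>2)" by (rule ip_self)
  also have "\<dots> \<le> (LINT s|circ. (norm c)\<^sup>2)"
  proof (rule integral_mono)
    show "integrable circ (\<lambda>s. (norm (c * E 0 s))\<^sup>2)" by (rule sq_int_norm2[OF h1_sq_int[OF h1_cE]])
    fix s
    have "norm (E 0 s) \<le> 1" using r_le[of s] less_imp_le[OF r_pos(1)[of s]] by (simp add: E_def)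
    then have "norm (c * E 0 s) \<le> norm c" by (simp add: norm_mult mult_left_le)
    then show "(norm (c * E 0 s))\<^sup>2 \<le> (norm c)\<^sup>2" by (rule power_mono) simp
  qed simp
  finally show ?thesis by simp
qed

lemma ip_sq_add_le:
  fixes f g :: "real \<Rightarrow> 'a::euclidean_space"
  assumes "sq_int f" "sq_int g"
  shows "sqn (\<lambda>s. f s + g s) \<le> 2 * sqn f + 2 * sqn g"
  using ip_sq_add[OF assms] ip_sq_diff[OF assms] ip_self_nonneg[of "\<lambda>s. f s - g s"] by linarith

text \<open>Apart from its null directions, the first harmonics, \<open>J\<close> has a single negative direction. It is nonnegative on functions of
  mean zero, and \<open>E 0 = r\<close> is a function with \<open>J < 0\<close>; so it is also nonnegative on the complement of
  \<open>E 0\<close> with respect to \<open>J\<close>. Concretely, subtracting a multiple \<open>t E 0\<close> makes the mean vanish and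
  lowers \<open>J\<close> by \<open>\<beta> T |t|\<^sup>2\<close>.\<close>

lemma J_coercive_mean_free:
  assumes y: "has_periodic_h1_deriv y y'" and m: "first_mode_free y" and c0: "coef y 0 = 0"
  shows "J y y' \<ge> \<delta>1 * sqn y"
proof -
  define R where "R = (LINT s|circ. r s)"
  have "(LINT s|circ. \<beta>) \<le> R" unfolding R_def
    by (intro integral_mono) (auto intro!: integrable_circ_cont continuous_intros r_ge)
  moreover have "(LINT s|circ. \<beta>) > 0" using \<beta> by simp
  ultimately have R: "R > 0" by linarith
  \<comment> \<open>The multiple of \<open>E 0\<close> with the same mean as \<open>y\<close>.\<close>
  define t where "t = (LINT s|circ. y s) / of_real R"
  define P P' where "P s = y s - t * E 0 s" and "P' s = y' s - t * E1 0 s" for s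
  have P: "has_periodic_h1_deriv P P'" unfolding P_def P'_def by (rule h1_diff[OF y h1_cE])
  have "first_mode_free P" unfolding P_def
    by (intro first_mode_free_diff m first_mode_free_cE h1_sq_int[OF y] h1_sq_int[OF h1_cE])
  moreover have "(LINT s|circ. P s) = 0"
  proof -
    have "(LINT s|circ. P s) = (LINT s|circ. y s) - (LINT s|circ. t * E 0 s)"
      unfolding P_def by (intro Bochner_Integration.integral_diff sq_int_integrable h1_sq_int[OF y] h1_sq_int[OF h1_cE])
    also have "(LINT s|circ. t * E 0 s) = t * of_real R"
      by (simp add: E_def R_def)
    finally show ?thesis using R by (simp add: t_def)
  qed
  ultimately have "sqn P' \<ge> 11/10 * sqn P"
    by (intro wirtinger_gap[OF P]) (auto simp: first_mode_free_def)
  then have JP: "J P P' \<ge> 1/10 * sqn P" by (simp add: J_def)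
  have "J P P' = J y y' - 2 * J_polar y y' (\<lambda>s. t * E 0 s) (\<lambda>s. t * E1 0 s) + J (\<lambda>s. t * E 0 s) (\<lambda>s. t * E1 0 s)"
    unfolding P_def P'_def by (rule J_diff[OF y h1_cE])
  moreover have "J_polar y y' (\<lambda>s. t * E 0 s) (\<lambda>s. t * E1 0 s) = 0"
    using J_polar_E[OF y, of t 0] c0 by simp
  moreover have "J (\<lambda>s. t * E 0 s) (\<lambda>s. t * E1 0 s) = - \<beta> * T * (norm t)\<^sup>2"
    using J_polar_E[OF h1_cE[of t 0], of t 0] unfolding coef_E if_P[OF refl] Re_cnj_self by (simp add: J_polar_def J_def)
  ultimately have Jy: "J y y' = J P P' + \<beta> * T * (norm t)\<^sup>2" by simp
  have "y = (\<lambda>s. P s + t * E 0 s)" by (simp add: P_def)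
  then have "sqn y \<le> 2 * sqn P + 2 * sqn (\<lambda>s. t * E 0 s)"
    using ip_sq_add_le[OF h1_sq_int[OF P] h1_sq_int[OF h1_cE], of t 0] by simp
  also have "\<dots> \<le> 2 * sqn P + 4 * pi * (norm t)\<^sup>2"
    using ip_E0_le[of t] by linarith
  finally have "\<delta>1 * sqn y \<le> \<delta>1 * (2 * sqn P + 4 * pi * (norm t)\<^sup>2)"
    using \<delta>1_pos by (intro mult_left_mono) auto
  also have "\<dots> = (2 * \<delta>1) * sqn P + (4 * pi * \<delta>1) * (norm t)\<^sup>2" by (simp add: algebra_simps)
  also have "\<dots> \<le> 1/10 * sqn P + (\<beta> * T) * (norm t)\<^sup>2"
  proof (intro add_mono mult_right_mono ip_self_nonneg)
    show "2 * \<delta>1 \<le> 1/10" by (simp add: \<delta>1_def)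
    have "\<delta>1 \<le> \<beta> * T / (4 * pi)" by (simp add: \<delta>1_def)
    then show "4 * pi * \<delta>1 \<le> \<beta> * T" by (simp add: field_simps)
  qed simp
  finally show ?thesis using JP Jy by linarith
qed

text \<open>Bessel's inequality for \<open>J\<close>: the remainder after subtracting the modes in \<open>K\<close> has \<open>J \<ge> 0\<close> by
  \<open>J_coercive_mean_free\<close>. Only the functions \<open>E k\<close>, of period \<open>\<pi>\<close>, occur, so that the
  remainder stays orthogonal to the first harmonics.\<close>

lemma bessel:
  assumes y: "has_periodic_h1_deriv y y'" and m: "first_mode_free y" and c0: "coef y 0 = 0"
    and K: "finite K" "0 \<notin> K"
  shows "\<beta> * T * (\<Sum>k\<in>K. (4 * (of_int k)\<^sup>2 - 1) * (norm (coef y k))\<^sup>2) \<le> J y y'"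
proof -
  define S S' where "S s = (\<Sum>k\<in>K. coef y k * E k s)" and "S' s = (\<Sum>k\<in>K. coef y k * E1 k s)" for s
  have S: "has_periodic_h1_deriv S S'" unfolding S_def S'_def by (intro h1_sum K h1_cE)
  have coS: "coef S l = (if l \<in> K then coef y l else 0)" for l
    unfolding S_def using K by (subst coef_sum) (auto intro: h1_sq_int[OF h1_cE] simp: coef_E)
  have B: "J_polar f f' S S' = \<beta> * T * (\<Sum>k\<in>K. (4 * (of_int k)\<^sup>2 - 1) * Re (cnj (coef y k) * coef f k))"
    if f: "has_periodic_h1_deriv f f'" for f f'
  proof -
    have "J_polar f f' S S' = (\<Sum>k\<in>K. J_polar f f' (\<lambda>s. coef y k * E k s) (\<lambda>s. coef y k * E1 k s))"
      unfolding S_def S'_def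
      by (rule J_polar_sum_right) (intro h1_sq_int[OF f] h1_sq_int_deriv[OF f] h1_sq_int[OF h1_cE] h1_sq_int_deriv[OF h1_cE])+
    then show ?thesis by (simp only: J_polar_E[OF f]) (simp only: sum_distrib_left mult_ac)
  qed
  let ?X = "\<beta> * T * (\<Sum>k\<in>K. (4 * (of_int k)\<^sup>2 - 1) * (norm (coef y k))\<^sup>2)"
  note n = Re_cnj_self
  have 1: "J_polar y y' S S' = ?X" using B[OF y] by (simp only: n)
  have 2: "J S S' = ?X"
  proof -
    have "J S S' = J_polar S S' S S'" by (simp add: J_def J_polar_def)
    also have "\<dots> = \<beta> * T * (\<Sum>k\<in>K. (4 * (of_int k)\<^sup>2 - 1) * Re (cnj (coef y k) * coef y k))"
      unfolding B[OF S] by (intro arg_cong[where f="\<lambda>x. \<beta> * T * x"] sum.cong) (auto simp: coS)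
    finally show ?thesis by (simp only: n)
  qed
  have "0 \<le> \<delta>1 * sqn (\<lambda>s. y s - S s)"
    using \<delta>1_pos ip_self_nonneg by (intro mult_nonneg_nonneg) auto
  also have "\<dots> \<le> J (\<lambda>s. y s - S s) (\<lambda>s. y' s - S' s)"
  proof (rule J_coercive_mean_free[OF h1_diff[OF y S]])
    have "first_mode_free S"
      unfolding S_def by (intro first_mode_free_sum first_mode_free_cE h1_sq_int[OF h1_cE])
    then show "first_mode_free (\<lambda>s. y s - S s)"
      by (intro first_mode_free_diff m h1_sq_int[OF y] h1_sq_int[OF S])
    show "coef (\<lambda>s. y s - S s) 0 = 0"
      using coS c0 K by (simp add: coef_diff h1_sq_int[OF y] h1_sq_int[OF S])
  qed
  also have "\<dots> = J y y' - 2 * J_polar y y' S S' + J S S'" by (rule J_diff[OF y S])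
  finally show ?thesis unfolding 1 2 by simp
qed

end

section \<open>The linearised closing condition bounds the zeroth coefficient\<close>

context oval
begin

text \<open>Partial sums of the Poisson kernel \<open>1/\<kappa> = \<Sum>\<^sub>k q\<^bsup>|k|\<^esup> \<zeta>\<^sup>k\<close>.\<close>

definition kernel_sum :: "nat \<Rightarrow> real \<Rightarrow> complex" where
  "kernel_sum N s = 1 + (\<Sum>k=1..N. of_real (q ^ k) * (\<zeta> s powi (int k) + \<zeta> s powi (- int k)))"

text \<open>Multiplying by \<open>|1 - q \<zeta>|\<^sup>2\<close> telescopes the two geometric sums.\<close>

lemma kernel_sum_telescope:
  "(1 - (of_real q)\<^sup>2) * (of_real (\<kappa> s) * kernel_sum N s) = (1 - (of_real q)\<^sup>2)
     - (of_real (q ^ Suc N) * (\<zeta> s ^ Suc N + inverse (\<zeta> s) ^ Suc N) - of_real (q ^ Suc (Suc N)) * (\<zeta> s ^ N + inverse (\<zeta> s) ^ N))"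
proof -
  define u v Q where "u = \<zeta> s" and "v = inverse (\<zeta> s)" and "Q = complex_of_real q"
  have uv: "u * v = 1" by (simp add: u_def v_def)
  have "(1 - Q\<^sup>2) \<noteq> 0"
  proof
    assume "1 - Q\<^sup>2 = 0"
    then have "complex_of_real (q\<^sup>2) = of_real 1" by (simp add: Q_def)
    then have "q\<^sup>2 = 1" by (simp only: of_real_eq_iff)
    then show False using q by (simp add: power2_eq_1_iff)
  qed
  then have k: "(1 - Q\<^sup>2) * of_real (\<kappa> s) = 1 + Q\<^sup>2 - Q * (u + v)"
    unfolding \<kappa>_Poisson Q_def u_def v_def by simp
  have ks: "kernel_sum N s = 1 + (\<Sum>k=1..N. Q ^ k * (u ^ k + v ^ k))" for N
    by (simp add: kernel_sum_def u_def v_def Q_def power_int_minus power_inverse)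
  have "(1 + Q\<^sup>2 - Q * (u + v)) * (1 + (\<Sum>k=1..N. Q ^ k * (u ^ k + v ^ k)))
    = (1 - Q\<^sup>2) - (Q ^ Suc N * (u ^ Suc N + v ^ Suc N) - Q ^ Suc (Suc N) * (u ^ N + v ^ N))"
  proof (induction N)
    case 0
    show ?case by (simp add: power2_eq_square algebra_simps)
  next
    case (Suc N)
    let ?U = "u ^ N" and ?V = "v ^ N" and ?P = "Q ^ N"
    have s: "(\<Sum>k=1..Suc N. Q ^ k * (u ^ k + v ^ k)) = (\<Sum>k=1..N. Q ^ k * (u ^ k + v ^ k)) + Q ^ Suc N * (u ^ Suc N + v ^ Suc N)"
      by simp
    have *: "(1 + Q\<^sup>2 - Q * (u + v)) * (Q * P * (u * U + v * V))
       = (Q * P * (u * U + v * V) - Q * Q * P * (U + V)) - (Q * Q * P * (u * u * U + v * v * V) - Q * Q * Q * P * (u * U + v * V))" for U V P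
      using uv by algebra
    have "(1 + Q\<^sup>2 - Q * (u + v)) * (1 + (\<Sum>k=1..Suc N. Q ^ k * (u ^ k + v ^ k)))
      = (1 + Q\<^sup>2 - Q * (u + v)) * (1 + (\<Sum>k=1..N. Q ^ k * (u ^ k + v ^ k))) + (1 + Q\<^sup>2 - Q * (u + v)) * (Q * ?P * (u * ?U + v * ?V))"
      unfolding s by (simp only: distrib_left power_Suc add.assoc)
    also have "\<dots> = (1 - Q\<^sup>2) - (Q ^ Suc (Suc N) * (u ^ Suc (Suc N) + v ^ Suc (Suc N)) - Q ^ Suc (Suc (Suc N)) * (u ^ Suc N + v ^ Suc N))"
      unfolding Suc * by (simp add: algebra_simps)
    finally show ?case .
  qed
  then show ?thesis
    unfolding ks using k by (simp add: u_def v_def Q_def mult.assoc[symmetric])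
qed

lemma kernel_sum_error: "norm (1 - of_real (\<kappa> s) * kernel_sum N s) \<le> 4 / (1 - q\<^sup>2) * q ^ N"
proof -
  have q1: "1 - q\<^sup>2 > 0" using q by (simp add: power_less_one_iff abs_square_less_1)
  let ?e = "of_real (q ^ Suc N) * (\<zeta> s ^ Suc N + inverse (\<zeta> s) ^ Suc N) - of_real (q ^ Suc (Suc N)) * (\<zeta> s ^ N + inverse (\<zeta> s) ^ N)"
  have "(1 - (of_real q)\<^sup>2) * (1 - of_real (\<kappa> s) * kernel_sum N s) = ?e"
    using kernel_sum_telescope[of s N] by (simp add: right_diff_distrib)
  then have "norm (1 - complex_of_real (q\<^sup>2)) * norm (1 - of_real (\<kappa> s) * kernel_sum N s) = norm ?e"
    by (metis norm_mult of_real_power)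
  moreover have "norm (1 - complex_of_real (q\<^sup>2)) = 1 - q\<^sup>2"
  proof -
    have "1 - complex_of_real (q\<^sup>2) = of_real (1 - q\<^sup>2)" by simp
    then show ?thesis using q1 by (simp only: norm_of_real, simp?)
  qed
  moreover have "norm ?e \<le> 4 * q ^ N"
  proof -
    have two: "norm (\<zeta> s ^ n + inverse (\<zeta> s) ^ n) \<le> 2" for n
      by (rule order_trans[OF norm_triangle_ineq]) (simp add: norm_power norm_inverse)
    have p: "q ^ Suc N \<le> q ^ N" "q ^ Suc (Suc N) \<le> q ^ N" using q by (intro power_decreasing; simp)+
    have "norm ?e \<le> norm (of_real (q ^ Suc N) * (\<zeta> s ^ Suc N + inverse (\<zeta> s) ^ Suc N)) + norm (of_real (q ^ Suc (Suc N)) * (\<zeta> s ^ N + inverse (\<zeta> s) ^ N))"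
      by (rule norm_triangle_ineq4)
    also have "\<dots> \<le> q ^ N * 2 + q ^ N * 2"
    proof -
      have n: "norm (complex_of_real (q ^ n)) = q ^ n" for n
        using q by (simp only: norm_of_real abs_of_nonneg zero_le_power)
      show ?thesis unfolding norm_mult n by (intro add_mono mult_mono two p norm_ge_zero zero_le_power q)
    qed
    finally show ?thesis by simp
  qed
  ultimately have "(1 - q\<^sup>2) * norm (1 - of_real (\<kappa> s) * kernel_sum N s) \<le> 4 * q ^ N" by simp
  then have "norm (1 - of_real (\<kappa> s) * kernel_sum N s) \<le> 4 * q ^ N / (1 - q\<^sup>2)"
    using q1 by (simp only: pos_le_divide_eq mult.commute)
  then show ?thesis by simp
qed

lemma coef_shift: "(LINT s|circ. of_real (\<kappa> s) * \<zeta> s powi k * (\<zeta> s powi m * (y s / of_real (r s)))) = of_real T * coef y (- (k + m))"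
proof -
  have "of_real (\<kappa> s) * \<zeta> s powi k * (\<zeta> s powi m * (y s / of_real (r s))) = of_real (\<kappa> s / r s) * \<zeta> s powi (- (- (k + m))) * y s" for s
    using power_int_add[of "\<zeta> s" m k] by (simp add: mult_ac)
  then show ?thesis unfolding coef_def by (simp only:) (use T_pos in simp)
qed

text \<open>An integral against \<open>ds\<close> is one against \<open>\<kappa> ds\<close> with the factor \<open>1/\<kappa>\<close>; replacing this factor by
  \<open>kernel_sum\<close> costs an error \<open>C q\<^sup>N\<close> and leaves a combination of coefficients. The constant may depend on
  \<open>y\<close>, since \<open>N\<close> tends to infinity with \<open>y\<close> fixed.\<close>

lemma mean_expansion:
  assumes y: "sq_int y"
  shows "\<exists>C\<ge>0. \<forall>N. norm ((LINT s|circ. \<zeta> s powi m * (y s / of_real (r s))) / of_real T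
     - (coef y (- m) + (\<Sum>k=1..N. of_real (q ^ k) * (coef y (- m - int k) + coef y (int k - m))))) \<le> C * q ^ N"
proof -
  define Y where "Y s = \<zeta> s powi m * (y s / of_real (r s))" for s
  have Y: "sq_int Y"
  proof -
    have "sq_int (\<lambda>s. (\<zeta> s powi m / of_real (r s)) * y s)"
      by (rule sq_int_bounded_bilinear[OF bounded_bilinear_mult _ y]) (auto intro!: continuous_intros)
    then show ?thesis by (simp add: Y_def[abs_def])
  qed
  note iY = sq_int_integrable[OF Y]
  define A where "A = (LINT s|circ. norm (Y s))"
  define C where "C = 4 / (1 - q\<^sup>2) * A / T"
  have q1: "1 - q\<^sup>2 > 0" using q by (simp add: power_less_one_iff abs_square_less_1)
  have A: "A \<ge> 0" by (simp add: A_def)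
  have "norm ((LINT s|circ. Y s) / of_real T - (coef y (- m) + (\<Sum>k=1..N. of_real (q ^ k) * (coef y (- m - int k) + coef y (int k - m))))) \<le> C * q ^ N" for N
  proof -
    have ik: "integrable circ (\<lambda>s. of_real (\<kappa> s) * \<zeta> s powi k * Y s)" for k
      by (intro integrable_cont_mult Y continuous_intros)
    have iK: "integrable circ (\<lambda>s. (of_real (\<kappa> s) * kernel_sum N s) * Y s)"
      unfolding kernel_sum_def by (intro integrable_cont_mult Y continuous_intros)
    have "(\<lambda>s. (of_real (\<kappa> s) * kernel_sum N s) * Y s) = (\<lambda>s. of_real (\<kappa> s) * \<zeta> s powi 0 * Y s
       + (\<Sum>k=1..N. of_real (q ^ k) * (of_real (\<kappa> s) * \<zeta> s powi (int k) * Y s + of_real (\<kappa> s) * \<zeta> s powi (- int k) * Y s)))"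
      by (simp add: kernel_sum_def fun_eq_iff distrib_left distrib_right sum_distrib_left sum_distrib_right mult_ac)
    then have "(LINT s|circ. (of_real (\<kappa> s) * kernel_sum N s) * Y s) = (LINT s|circ. of_real (\<kappa> s) * \<zeta> s powi 0 * Y s)
      + (\<Sum>k=1..N. of_real (q ^ k) * ((LINT s|circ. of_real (\<kappa> s) * \<zeta> s powi (int k) * Y s) + (LINT s|circ. of_real (\<kappa> s) * \<zeta> s powi (- int k) * Y s)))"
      using ik by (simp only: Bochner_Integration.integral_add Bochner_Integration.integral_sum Bochner_Integration.integral_mult_right_zero
         Bochner_Integration.integrable_add Bochner_Integration.integrable_sum integrable_mult_right)
    also have "\<dots> = of_real T * (coef y (- m) + (\<Sum>k=1..N. of_real (q ^ k) * (coef y (- m - int k) + coef y (int k - m))))"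
    proof -
      have i: "- (0 + m) = - m" "- (int k + m) = - m - int k" "- (- int k + m) = int k - m" for k by simp_all
      show ?thesis
        unfolding Y_def coef_shift i by (simp add: distrib_left sum_distrib_left mult_ac)
    qed
    finally have e: "(coef y (- m) + (\<Sum>k=1..N. of_real (q ^ k) * (coef y (- m - int k) + coef y (int k - m)))) = (LINT s|circ. (of_real (\<kappa> s) * kernel_sum N s) * Y s) / of_real T"
      using T_pos by (simp add: field_simps)
    have "(LINT s|circ. Y s) - (LINT s|circ. (of_real (\<kappa> s) * kernel_sum N s) * Y s) = (LINT s|circ. (1 - of_real (\<kappa> s) * kernel_sum N s) * Y s)"
      using Bochner_Integration.integral_diff[OF iY iK] by (simp add: left_diff_distrib)
    also have "norm \<dots> \<le> (LINT s|circ. norm ((1 - of_real (\<kappa> s) * kernel_sum N s) * Y s))"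
      by (rule integral_norm_bound)
    also have "\<dots> \<le> (LINT s|circ. 4 / (1 - q\<^sup>2) * q ^ N * norm (Y s))"
    proof (rule integral_mono)
      have "integrable circ (\<lambda>s. (1 - of_real (\<kappa> s) * kernel_sum N s) * Y s)"
        unfolding kernel_sum_def by (intro integrable_cont_mult Y continuous_intros)
      then show "integrable circ (\<lambda>s. norm ((1 - of_real (\<kappa> s) * kernel_sum N s) * Y s))" by (rule integrable_norm)
      show "norm ((1 - of_real (\<kappa> s) * kernel_sum N s) * Y s) \<le> 4 / (1 - q\<^sup>2) * q ^ N * norm (Y s)" for s
        unfolding norm_mult by (rule mult_right_mono[OF kernel_sum_error]) simp
    qed (use iY in auto)
    also have "\<dots> = 4 / (1 - q\<^sup>2) * q ^ N * A" by (simp only: A_def Bochner_Integration.integral_mult_right_zero)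
    finally have "norm ((LINT s|circ. Y s) - (LINT s|circ. (of_real (\<kappa> s) * kernel_sum N s) * Y s)) \<le> 4 / (1 - q\<^sup>2) * q ^ N * A" .
    then have "norm ((LINT s|circ. Y s) - (LINT s|circ. (of_real (\<kappa> s) * kernel_sum N s) * Y s)) / T \<le> 4 / (1 - q\<^sup>2) * q ^ N * A / T"
      using T_pos by (intro divide_right_mono) auto
    then show ?thesis
      unfolding e diff_divide_distrib[symmetric] norm_divide using T_pos by (simp add: C_def mult_ac)
  qed
  moreover have "C \<ge> 0" using A q1 T_pos by (simp add: C_def)
  ultimately show ?thesis unfolding Y_def by blast
qed

lemma coef_bound:
  assumes y: "sq_int y"
  shows "norm (coef y k) \<le> (LINT s|circ. norm (of_real (\<kappa> s / r s) * y s)) / T"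
proof -
  have "norm (LINT s|circ. of_real (\<kappa> s / r s) * \<zeta> s powi (- k) * y s) \<le> (LINT s|circ. norm (of_real (\<kappa> s / r s) * \<zeta> s powi (- k) * y s))"
    by (rule integral_norm_bound)
  also have "\<dots> = (LINT s|circ. norm (of_real (\<kappa> s / r s) * y s))" by (simp only: norm_mult \<zeta>_powi_norm mult_1_right)
  finally show ?thesis
    unfolding coef_def norm_divide using T_pos by (simp add: divide_right_mono)
qed

text \<open>The weights are those of the Poisson kernel; the planar part of the linearised condition shifts the
  index by one, whence \<open>q\<^bsup>k-1\<^esup>\<close> for positive indices.\<close>

definition tail_sum :: "(real \<Rightarrow> complex) \<Rightarrow> nat \<Rightarrow> real" where
  "tail_sum y N = (\<Sum>k=1..N. q^(k-1) * norm (coef y (int k)) + q^k * norm (coef y (- int k)))"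

text \<open>For the component of \<open>V\<close> orthogonal to the plane of the oval the linearised condition is the
  vanishing of the integral of \<open>y/r\<close>.\<close>

lemma coef0_normal:
  assumes y: "sq_int y"
  shows "\<exists>C. \<forall>N. norm (coef y 0) \<le> norm (LINT s|circ. y s / of_real (r s)) / T + tail_sum y N + C * q ^ N"
proof -
  obtain C where C: "\<And>N. norm ((LINT s|circ. y s / of_real (r s)) / of_real T
     - (coef y 0 + (\<Sum>k=1..N. of_real (q ^ k) * (coef y (- int k) + coef y (int k))))) \<le> C * q ^ N"
    using mean_expansion[OF y, of 0] by auto
  have "norm (coef y 0) \<le> norm (LINT s|circ. y s / of_real (r s)) / T + tail_sum y N + C * q ^ N" for N
  proof -
    let ?L = "(LINT s|circ. y s / of_real (r s)) / of_real T"
    let ?S = "\<Sum>k=1..N. of_real (q ^ k) * (coef y (- int k) + coef y (int k))"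
    have "norm ?S \<le> (\<Sum>k=1..N. norm (of_real (q ^ k) * (coef y (- int k) + coef y (int k))))" by (rule norm_sum)
    also have "\<dots> \<le> tail_sum y N" unfolding tail_sum_def
    proof (rule sum_mono)
      fix k assume k: "k \<in> {1..N}"
      have "norm (of_real (q ^ k) * (coef y (- int k) + coef y (int k))) = q ^ k * norm (coef y (- int k) + coef y (int k))"
        using q by (simp add: norm_mult norm_power)
      also have "\<dots> \<le> q ^ k * (norm (coef y (- int k)) + norm (coef y (int k)))"
        using q by (intro mult_left_mono norm_triangle_ineq) auto
      also have "\<dots> \<le> q^(k-1) * norm (coef y (int k)) + q^k * norm (coef y (- int k))"
      proof -
        have "q ^ k \<le> q ^ (k - 1)" using q by (intro power_decreasing) auto
        then have "q ^ k * norm (coef y (int k)) \<le> q ^ (k - 1) * norm (coef y (int k))" by (rule mult_right_mono) simp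
        then show ?thesis by (simp add: distrib_left)
      qed
      finally show "norm (of_real (q ^ k) * (coef y (- int k) + coef y (int k))) \<le> q^(k-1) * norm (coef y (int k)) + q^k * norm (coef y (- int k))" .
    qed
    finally have S: "norm ?S \<le> tail_sum y N" .
    have tri: "norm x \<le> norm L + norm S + norm (L - (x + S))" for x L S :: complex
      using norm_triangle_ineq4[of "L - S" "L - (x + S)"] norm_triangle_ineq4[of L S] by simp
    have "norm ?L = norm (LINT s|circ. y s / of_real (r s)) / T"
      using T_pos by (simp add: norm_divide)
    with tri[of "coef y 0" ?L ?S] S C[of N] show ?thesis by linarith
  qed
  then show ?thesis by blast
qed

text \<open>For the component in the plane, in complex notation, the linearised condition is the vanishing of
  the integral of \<open>Z - cnj Z \<zeta>\<close> with \<open>Z = y/r\<close>. Expanding both terms with coefficients \<open>a k\<close> and setting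
  \<open>A = \<Sum> q\<^bsup>k-1\<^esup> a k\<close> and \<open>B = \<Sum> q\<^sup>k a (-k)\<close>, the integral is \<open>T (u - q cnj u)\<close> with \<open>u = a 0 + B - cnj A\<close>, so
  that \<open>u\<close> is controlled and \<open>|a 0| \<le> |A| + |B| + |u|\<close>.\<close>

lemma coef0_planar:
  assumes y: "sq_int y"
  shows "\<exists>C. \<forall>N. norm (coef y 0) \<le> norm (LINT s|circ. y s / of_real (r s) - cnj (y s / of_real (r s)) * \<zeta> s) / (T * (1 - q)) + tail_sum y N + C * q ^ N"
proof -
  define L where "L = (LINT s|circ. y s / of_real (r s) - cnj (y s / of_real (r s)) * \<zeta> s)"
  define a where "a k = coef y k" for k
  obtain C where C: "\<And>N. norm ((LINT s|circ. y s / of_real (r s)) / of_real T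
     - (a 0 + (\<Sum>k=1..N. of_real (q ^ k) * (a (- int k) + a (int k))))) \<le> C * q ^ N"
    using mean_expansion[OF y, of 0] unfolding a_def by auto
  obtain D where D: "\<And>N. norm ((LINT s|circ. \<zeta> s powi (-1) * (y s / of_real (r s))) / of_real T
     - (a 1 + (\<Sum>k=1..N. of_real (q ^ k) * (a (1 - int k) + a (int k + 1))))) \<le> D * q ^ N"
    using mean_expansion[OF y, of "-1"] unfolding a_def by auto
  obtain M where M: "\<And>k. norm (a k) \<le> M" using coef_bound[OF y] unfolding a_def by blast
  define A B where "A N = (\<Sum>k=1..N. of_real (q^(k-1)) * a (int k))" and "B N = (\<Sum>k=1..N. of_real (q^k) * a (- int k))" for N
  have AB: "norm (A N) + norm (B N) \<le> tail_sum y N" for N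
  proof -
    have "norm (A N) \<le> (\<Sum>k=1..N. q^(k-1) * norm (a (int k)))"
      unfolding A_def by (rule order_trans[OF norm_sum]) (use q in \<open>simp add: norm_mult norm_power\<close>)
    moreover have "norm (B N) \<le> (\<Sum>k=1..N. q^k * norm (a (- int k)))"
      unfolding B_def by (rule order_trans[OF norm_sum]) (use q in \<open>simp add: norm_mult norm_power\<close>)
    ultimately show ?thesis unfolding tail_sum_def a_def by (simp add: sum.distrib)
  qed
  have X0: "a 0 + (\<Sum>k=1..N. of_real (q ^ k) * (a (- int k) + a (int k))) = a 0 + of_real q * A N + B N" for N
  proof -
    have "of_real q * A N = (\<Sum>k=1..N. of_real (q ^ k) * a (int k))"
      unfolding A_def sum_distrib_left
      by (rule sum.cong[OF refl]) (auto simp: power_eq_if)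
    then show ?thesis by (simp add: B_def distrib_left sum.distrib)
  qed
  have X1: "a 1 + (\<Sum>k=1..N. of_real (q ^ k) * (a (1 - int k) + a (int k + 1)))
     = of_real q * a 0 + A N + of_real q * B N + of_real (q ^ N) * (a (int N + 1) - of_real q * a (- int N))" for N
  proof (induction N)
    case 0 show ?case by (simp add: A_def B_def)
  next
    case (Suc N)
    have "A (Suc N) = A N + of_real (q ^ N) * a (int N + 1)" by (simp add: A_def add.commute)
    moreover have "B (Suc N) = B N + of_real (q ^ Suc N) * a (- int (Suc N))"
      by (simp add: B_def del: of_nat_Suc)
    moreover have "(\<Sum>k=1..Suc N. of_real (q ^ k) * (a (1 - int k) + a (int k + 1)))
      = (\<Sum>k=1..N. of_real (q ^ k) * (a (1 - int k) + a (int k + 1))) + of_real (q ^ Suc N) * (a (- int N) + a (int (Suc N) + 1))"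
      by simp
    moreover have i: "1 - int (Suc N) = - int N" by simp
    ultimately show ?case using Suc by (simp add: algebra_simps i del: of_nat_Suc)
  qed
  define u where "u N = a 0 + B N - cnj (A N)" for N
  have L: "L = (LINT s|circ. y s / of_real (r s)) - cnj (LINT s|circ. \<zeta> s powi (-1) * (y s / of_real (r s)))"
  proof -
    have iy: "integrable circ (\<lambda>s. p s * y s)" if "continuous_on {0..2*pi} p" for p
      by (rule integrable_cont_mult[OF that y])
    have i1: "integrable circ (\<lambda>s. y s / of_real (r s))"
      using iy[of "\<lambda>s. 1 / of_real (r s)"] by (simp add: continuous_intros)
    have i2: "integrable circ (\<lambda>s. \<zeta> s powi (-1) * (y s / of_real (r s)))"
      using iy[of "\<lambda>s. \<zeta> s powi (-1) / of_real (r s)"] continuous_on_divide[OF \<zeta>_cont[of _ "-1"] continuous_on_of_real[OF r_cont]]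
      by simp
    have c: "cnj (\<zeta> s powi (-1) * (y s / of_real (r s))) = cnj (y s / of_real (r s)) * \<zeta> s" for s
      unfolding complex_cnj_mult \<zeta>_cnj by simp
    have "(LINT s|circ. cnj (\<zeta> s powi (-1) * (y s / of_real (r s)))) = cnj (LINT s|circ. \<zeta> s powi (-1) * (y s / of_real (r s)))"
      by (rule integral_bounded_linear[OF bounded_linear_cnj i2])
    moreover have "integrable circ (\<lambda>s. cnj (\<zeta> s powi (-1) * (y s / of_real (r s))))"
      by (rule integrable_bounded_linear[OF bounded_linear_cnj i2])
    ultimately show ?thesis
      unfolding L_def c by (simp only: Bochner_Integration.integral_diff[OF i1])
  qed
  define K where "K = (C + D + 2 * M) / (1 - q)"
  have "norm (a 0) \<le> norm L / (T * (1 - q)) + tail_sum y N + K * q ^ N" for N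
  proof -
    let ?I0 = "(LINT s|circ. y s / of_real (r s)) / of_real T"
    let ?I1 = "(LINT s|circ. \<zeta> s powi (-1) * (y s / of_real (r s))) / of_real T"
    define e0 e2 e1 where "e0 = ?I0 - (a 0 + of_real q * A N + B N)"
      and "e2 = of_real (q ^ N) * (a (int N + 1) - of_real q * a (- int N))"
      and "e1 = ?I1 - (of_real q * a 0 + A N + of_real q * B N + e2)"
    have n0: "norm e0 \<le> C * q ^ N" using C[of N] unfolding X0 e0_def .
    have n1: "norm e1 \<le> D * q ^ N" using D[of N] unfolding X1 e1_def e2_def .
    have n2: "norm e2 \<le> 2 * M * q ^ N"
    proof -
      have "norm (a (int N + 1) - of_real q * a (- int N)) \<le> norm (a (int N + 1)) + norm (of_real q * a (- int N))"
        by (rule norm_triangle_ineq4)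
      also have "\<dots> \<le> M + 1 * M"
        unfolding norm_mult using q by (intro add_mono mult_mono M) auto
      finally have "q ^ N * norm (a (int N + 1) - of_real q * a (- int N)) \<le> q ^ N * (2 * M)"
        using q by (intro mult_left_mono) auto
      then show ?thesis using q by (simp add: e2_def norm_mult norm_power mult_ac)
    qed
    have Le: "L / of_real T = u N - of_real q * cnj (u N) + e0 - cnj e1 - cnj e2"
    proof -
      have "L / of_real T = ?I0 - cnj ?I1" unfolding L by (simp add: diff_divide_distrib)
      also have "?I0 = e0 + (a 0 + of_real q * A N + B N)" by (simp add: e0_def)
      also have "?I1 = e1 + (of_real q * a 0 + A N + of_real q * B N + e2)" by (simp add: e1_def)
      finally show ?thesis by (simp add: u_def algebra_simps)
    qed
    have "norm (u N) \<le> norm (u N - of_real q * cnj (u N)) + norm (of_real q * cnj (u N))"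
      by (metis norm_triangle_sub add.commute)
    moreover have "norm (of_real q * cnj (u N)) = q * norm (u N)" using q by (simp add: norm_mult)
    ultimately have "(1 - q) * norm (u N) \<le> norm (u N - of_real q * cnj (u N))" by (simp add: left_diff_distrib)
    also have "u N - of_real q * cnj (u N) = L / of_real T - e0 + cnj e1 + cnj e2" unfolding Le by simp
    also have "norm \<dots> \<le> norm (L / of_real T) + norm e0 + norm e1 + norm e2"
      using norm_triangle_ineq[of "L / of_real T - e0 + cnj e1" "cnj e2"] norm_triangle_ineq[of "L / of_real T - e0" "cnj e1"]
        norm_triangle_ineq4[of "L / of_real T" e0] by simp
    also have "\<dots> \<le> norm L / T + (C + D + 2 * M) * q ^ N"
      using n0 n1 n2 T_pos by (simp add: norm_divide algebra_simps)
    finally have "norm (u N) \<le> (norm L / T + (C + D + 2 * M) * q ^ N) / (1 - q)"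
      using q by (simp add: field_simps)
    also have "\<dots> = norm L / (T * (1 - q)) + K * q ^ N"
      unfolding K_def add_divide_distrib[of "norm L / T"] by simp
    finally have nu: "norm (u N) \<le> norm L / (T * (1 - q)) + K * q ^ N" .
    have "a 0 = u N - B N + cnj (A N)" by (simp add: u_def)
    then have "norm (a 0) \<le> norm (u N) + norm (B N) + norm (A N)"
      using norm_triangle_ineq[of "u N - B N" "cnj (A N)"] norm_triangle_ineq4[of "u N" "B N"] by simp
    with nu AB[of N] show ?thesis by simp
  qed
  then show ?thesis unfolding a_def L_def by blast
qed

text \<open>The square of the constant in \<open>|coef y 0|\<^sup>2 \<le> \<rho> \<dots>\<close> below; that it is below 1 makes the
  minimum nondegenerate.\<close>

definition \<rho> :: real where "\<rho> = (1 + 2 * q\<^sup>2) / 3"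

lemma \<rho>: "0 < \<rho>" "\<rho> < 1"
proof -
  have "q\<^sup>2 < 1" using q by (simp add: power_less_one_iff abs_square_less_1)
  then show "0 < \<rho>" "\<rho> < 1" unfolding \<rho>_def by (simp_all add: add_pos_nonneg)
qed

lemma tail_sum_le:
  assumes R: "has_periodic_h1_deriv R R'" and m: "first_mode_free R" and c0: "coef R 0 = 0"
  shows "tail_sum R N \<le> sqrt (\<rho> * J R R' / (\<beta> * T))"
proof (rule real_le_rsqrt)
  let ?d = "\<lambda>k. 4 * (real_of_int k)\<^sup>2 - 1"
  have bT: "\<beta> * T > 0" using \<beta> T_pos by simp
  have "(tail_sum R N)\<^sup>2 \<le> \<rho> * (\<Sum>k=1..N. (4 * (real k)\<^sup>2 - 1) * ((norm (coef R (int k)))\<^sup>2 + (norm (coef R (- int k)))\<^sup>2))"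
    unfolding tail_sum_def \<rho>_def by (rule weighted_Cauchy_Schwarz[OF q])
  also have "(\<Sum>k=1..N. (4 * (real k)\<^sup>2 - 1) * ((norm (coef R (int k)))\<^sup>2 + (norm (coef R (- int k)))\<^sup>2))
      = (\<Sum>k\<in>int ` {1..N} \<union> (\<lambda>k. - int k) ` {1..N}. ?d k * (norm (coef R k))\<^sup>2)"
    by (subst sum.union_disjoint)
      (auto simp: sum.reindex inj_on_def sum.distrib distrib_left)
  also have "\<dots> \<le> J R R' / (\<beta> * T)"
  proof -
    have "\<beta> * T * (\<Sum>k\<in>int ` {1..N} \<union> (\<lambda>k. - int k) ` {1..N}. ?d k * (norm (coef R k))\<^sup>2) \<le> J R R'"
      by (rule bessel[OF R m c0]) auto
    then show ?thesis using bT by (simp add: pos_le_divide_eq mult.commute)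
  qed
  finally show "(tail_sum R N)\<^sup>2 \<le> \<rho> * J R R' / (\<beta> * T)" using \<rho> by simp
qed

text \<open>Write \<open>y = R + a E 0\<close>. Then \<open>J y = J R - \<beta> T |a|\<^sup>2\<close>, where \<open>\<beta> T |a|\<^sup>2\<close> is at most \<open>\<rho> J R\<close> up to terms
  in \<open>l\<close>, and \<open>J R\<close> controls both parts of \<open>y\<close>. The number \<open>l\<close> measures the linearised condition.\<close>

lemma coercive_scalar:
  "\<exists>\<delta>>0. \<exists>K\<ge>0. \<forall>y y' l C. has_periodic_h1_deriv y y' \<longrightarrow> first_mode_free y \<longrightarrow> l \<ge> 0 \<longrightarrow>
     (\<forall>N. norm (coef y 0) \<le> l + tail_sum y N + C * q ^ N) \<longrightarrow> J y y' \<ge> \<delta> * sqn y - K * l\<^sup>2"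
proof -
  define bT where "bT = \<beta> * T"
  have bT: "bT > 0" using \<beta> T_pos by (simp add: bT_def)
  \<comment> \<open>The splitting parameter for which \<open>(1 + \<tau>) \<rho>\<close> is the midpoint of \<open>\<rho>\<close> and 1.\<close>
  define \<tau> where "\<tau> = (1 - \<rho>) / (2 * \<rho>)"
  have \<tau>: "\<tau> > 0" using \<rho> by (simp add: \<tau>_def)
  define K1 where "K1 = bT * (1 + 1 / \<tau>)"
  define g where "g = (1 - \<rho>) / 2"
  have g: "g > 0" using \<rho> by (simp add: g_def)
  define C1 where "C1 = 2 / \<delta>1 + 8 * pi * \<rho> / bT"
  have C1: "C1 > 0" using \<delta>1_pos \<rho> bT by (auto simp: C1_def intro!: add_pos_nonneg)
  define \<delta> where "\<delta> = g / C1"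
  define K where "K = K1 + \<delta> * (8 * pi)"
  have \<delta>: "\<delta> > 0" using g C1 by (simp add: \<delta>_def)
  have K1: "K1 \<ge> 0" using bT \<tau> by (simp add: K1_def)
  have "J y y' \<ge> \<delta> * sqn y - K * l\<^sup>2"
    if y: "has_periodic_h1_deriv y y'" and m: "first_mode_free y" and l: "l \<ge> 0"
      and c: "\<And>N. norm (coef y 0) \<le> l + tail_sum y N + C * q ^ N" for y y' l C
  proof -
    define a where "a = coef y 0"
    define R R' where "R s = y s - a * E 0 s" and "R' s = y' s - a * E1 0 s" for s
    have R: "has_periodic_h1_deriv R R'" unfolding R_def R'_def by (rule h1_diff[OF y h1_cE])
    have mR: "first_mode_free R" unfolding R_def
      by (intro first_mode_free_diff m first_mode_free_cE h1_sq_int[OF y] h1_sq_int[OF h1_cE])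
    have cR: "coef R k = (if k = 0 then 0 else coef y k)" for k
      unfolding R_def coef_diff[OF h1_sq_int[OF y] h1_sq_int[OF h1_cE]] coef_E by (simp add: a_def)
    have tR: "tail_sum R N = tail_sum y N" for N
      unfolding tail_sum_def by (intro sum.cong) (auto simp: cR)
    have J0: "J R R' \<ge> \<delta>1 * sqn R" using J_coercive_mean_free[OF R mR] cR by simp
    have JR: "J R R' \<ge> 0"
      using J0 mult_nonneg_nonneg[OF less_imp_le[OF \<delta>1_pos] ip_self_nonneg[of R]] by linarith
    define x where "x = sqrt (\<rho> * J R R' / bT)"
    have x: "x \<ge> 0" "x\<^sup>2 = \<rho> * J R R' / bT" using JR \<rho> bT by (auto simp: x_def)
    have "norm a \<le> l + x + C * q ^ N" for N
      using c[of N] tail_sum_le[OF R mR, of N] cR unfolding tR a_def x_def bT_def by simp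
    moreover have "(\<lambda>N. l + x + C * q ^ N) \<longlonglongrightarrow> l + x + C * 0"
      using q by (intro tendsto_intros LIMSEQ_power_zero) auto
    ultimately have "norm a \<le> l + x"
      by (intro LIMSEQ_le_const[of "\<lambda>N. l + x + C * q ^ N"]) auto
    then have a2: "(norm a)\<^sup>2 \<le> (l + x)\<^sup>2" by (rule power_mono) simp
    have "(l + x)\<^sup>2 \<le> (1 + \<tau>) * x\<^sup>2 + (1 + 1 / \<tau>) * l\<^sup>2"
    proof -
      have "0 \<le> (\<tau> * x - l)\<^sup>2 / \<tau>" using \<tau> by simp
      also have "\<dots> = \<tau> * x\<^sup>2 - 2 * x * l + l\<^sup>2 / \<tau>"
        using \<tau> by (simp add: power2_eq_square field_simps)
      finally show ?thesis by (simp add: power2_eq_square algebra_simps)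
    qed
    then have "bT * (norm a)\<^sup>2 \<le> bT * ((1 + \<tau>) * x\<^sup>2 + (1 + 1 / \<tau>) * l\<^sup>2)"
      using a2 bT by (intro mult_left_mono) auto
    also have "\<dots> = (1 + \<tau>) * \<rho> * J R R' + K1 * l\<^sup>2"
    proof -
      have "bT * ((1 + \<tau>) * (\<rho> * j / bT) + e * l\<^sup>2) = (1 + \<tau>) * \<rho> * j + bT * e * l\<^sup>2" for j e
        using bT by (simp add: distrib_left)
      then show ?thesis unfolding x K1_def .
    qed
    also have "(1 + \<tau>) * \<rho> = 1 - g" using \<rho> by (simp add: \<tau>_def g_def field_simps)
    finally have na: "bT * (norm a)\<^sup>2 \<le> (1 - g) * J R R' + K1 * l\<^sup>2" .
    have Jy: "J y y' = J R R' - bT * (norm a)\<^sup>2"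
    proof -
      have "J R R' = J y y' - 2 * J_polar y y' (\<lambda>s. a * E 0 s) (\<lambda>s. a * E1 0 s) + J (\<lambda>s. a * E 0 s) (\<lambda>s. a * E1 0 s)"
        unfolding R_def R'_def by (rule J_diff[OF y h1_cE])
      moreover have "J_polar y y' (\<lambda>s. a * E 0 s) (\<lambda>s. a * E1 0 s) = - bT * (norm a)\<^sup>2"
        unfolding J_polar_E[OF y] a_def[symmetric] Re_cnj_self by (simp add: bT_def)
      moreover have "J (\<lambda>s. a * E 0 s) (\<lambda>s. a * E1 0 s) = - bT * (norm a)\<^sup>2"
        using J_polar_E[OF h1_cE[of a 0], of a 0] unfolding coef_E if_P[OF refl] Re_cnj_self by (simp add: J_polar_def J_def bT_def)
      ultimately show ?thesis by simp
    qed
    have low: "J y y' \<ge> g * J R R' - K1 * l\<^sup>2" using na unfolding Jy by (simp add: algebra_simps)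
    have "y = (\<lambda>s. R s + a * E 0 s)" by (simp add: R_def)
    then have "sqn y \<le> 2 * sqn R + 2 * sqn (\<lambda>s. a * E 0 s)"
      using ip_sq_add_le[OF h1_sq_int[OF R] h1_sq_int[OF h1_cE], of a 0] by simp
    also have "\<dots> \<le> 2 * sqn R + 4 * pi * (l + x)\<^sup>2"
    proof -
      have "2 * pi * (norm a)\<^sup>2 \<le> 2 * pi * (l + x)\<^sup>2" using a2 by (intro mult_left_mono) auto
      with ip_E0_le[of a] show ?thesis by linarith
    qed
    also have "\<dots> \<le> 2 * (J R R' / \<delta>1) + 4 * pi * (2 * l\<^sup>2 + 2 * x\<^sup>2)"
    proof (intro add_mono mult_left_mono)
      show "sqn R \<le> J R R' / \<delta>1" using J0 \<delta>1_pos by (simp add: field_simps)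
      have "(l + x)\<^sup>2 = 2 * l\<^sup>2 + 2 * x\<^sup>2 - (l - x)\<^sup>2" by (simp add: power2_eq_square algebra_simps)
      then show "(l + x)\<^sup>2 \<le> 2 * l\<^sup>2 + 2 * x\<^sup>2" using zero_le_power2[of "l - x"] by linarith
    qed auto
    also have "\<dots> = C1 * J R R' + 8 * pi * l\<^sup>2"
      unfolding x C1_def by (simp add: algebra_simps)
    finally have "\<delta> * sqn y \<le> \<delta> * (C1 * J R R' + 8 * pi * l\<^sup>2)"
      using \<delta> by (intro mult_left_mono) auto
    also have "\<dots> = g * J R R' + \<delta> * (8 * pi) * l\<^sup>2"
      using C1 by (simp add: \<delta>_def field_simps)
    finally show ?thesis using low unfolding K_def by (simp add: algebra_simps)
  qed
  moreover have "K \<ge> 0" using K1 \<delta> by (simp add: K_def)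
  ultimately show ?thesis using \<delta> by blast
qed

end

section \<open>The derivative of the direction of a vector\<close>

text \<open>The derivative of \<open>sgn\<close> at \<open>x\<close>: projection orthogonal to \<open>x\<close>, divided by \<open>|x|\<close>.\<close>

definition dsgn :: "'a::real_inner \<Rightarrow> 'a \<Rightarrow> 'a" where
  "dsgn x v = (v - (sgn x \<bullet> v) *\<^sub>R sgn x) /\<^sub>R norm x"

text \<open>An exact finite-difference form of the derivative, in which the unit vector \<open>sgn x\<close> occurs once as
  \<open>m\<close> and once as \<open>sgn y\<close>; it follows from \<open>|x|\<^sup>2 - |y|\<^sup>2 = (x - y) \<bullet> (x + y)\<close>.\<close>

lemma sgn_diff_eq:
  fixes x y :: "'a::real_inner"
  assumes "x \<noteq> 0" "y \<noteq> 0"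
  defines "m \<equiv> (x + y) /\<^sub>R (norm x + norm y)"
  shows "sgn x - sgn y = ((x - y) - ((x - y) \<bullet> m) *\<^sub>R sgn y) /\<^sub>R norm x"
proof -
  have s: "norm x + norm y > 0" using assms by (simp add: add_pos_pos)
  have "(x - y) \<bullet> (x + y) = (norm x + norm y) * (norm x - norm y)"
  proof -
    have "(x - y) \<bullet> (x + y) = (norm x)\<^sup>2 - (norm y)\<^sup>2"
      by (simp add: power2_norm_eq_inner inner_add_right inner_diff_left inner_commute[of y x])
    then show ?thesis by (simp add: power2_eq_square algebra_simps)
  qed
  then have e: "(x - y) \<bullet> m = norm x - norm y"
    unfolding m_def inner_scaleR_right using s by simp
  have "(x - y) - ((x - y) \<bullet> m) *\<^sub>R sgn y = norm x *\<^sub>R sgn x - norm x *\<^sub>R sgn y"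
  proof -
    have "norm x *\<^sub>R sgn x = x" "norm y *\<^sub>R sgn y = y" using assms(1,2) by (simp_all add: sgn_div_norm)
    then show ?thesis unfolding e scaleR_diff_left by simp
  qed
  then show ?thesis using assms(1,2) by (simp add: scaleR_diff_right[symmetric])
qed

lemma norm_average_direction_le:
  fixes x y :: "'a::real_inner"
  assumes "x \<noteq> 0" "y \<noteq> 0"
  shows "norm ((x + y) /\<^sub>R (norm x + norm y)) \<le> 1"
proof -
  have s: "norm x + norm y > 0" using assms by (simp add: add_pos_pos)
  show ?thesis using s norm_triangle_ineq[of x y] by (simp add: divide_simps divide_inverse_commute[symmetric])
qed

lemma sgn_Lipschitz:
  fixes x y :: "'a::real_inner"
  assumes "x \<noteq> 0" "y \<noteq> 0"
  shows "norm (sgn x - sgn y) \<le> 2 * norm (x - y) / norm x"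
proof -
  let ?m = "(x + y) /\<^sub>R (norm x + norm y)"
  have "norm ((x - y) - ((x - y) \<bullet> ?m) *\<^sub>R sgn y) \<le> norm (x - y) + \<bar>(x - y) \<bullet> ?m\<bar> * norm (sgn y)"
    using norm_triangle_ineq4[of "x - y" "((x - y) \<bullet> ?m) *\<^sub>R sgn y"] by simp
  also have "\<bar>(x - y) \<bullet> ?m\<bar> * norm (sgn y) \<le> norm (x - y) * 1"
  proof -
    have "\<bar>(x - y) \<bullet> ?m\<bar> \<le> norm (x - y) * norm ?m" by (rule Cauchy_Schwarz_ineq2)
    also have "\<dots> \<le> norm (x - y) * 1" by (intro mult_left_mono norm_average_direction_le assms) auto
    finally show ?thesis using assms by (simp add: norm_sgn)
  qed
  finally show ?thesis
    unfolding sgn_diff_eq[OF assms] using assms by (simp add: divide_simps)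
qed

text \<open>Strict differentiability with explicit constants: in \<open>sgn_diff_eq\<close> each of \<open>m\<close>, \<open>sgn y\<close> and \<open>1/|x|\<close>
  differs from its value at \<open>z\<close> by \<open>O(d)\<close>.\<close>

lemma sgn_strict_derivative:
  fixes x y z :: "'a::real_inner"
  assumes b: "0 < b" "b \<le> norm z" and d: "norm (x - z) \<le> d" "norm (y - z) \<le> d" "d \<le> b / 2"
  shows "norm (sgn x - sgn y - dsgn z (x - y)) \<le> 12 * d / b\<^sup>2 * norm (x - y)"
proof -
  define v m n where "v = x - y" and "m = (x + y) /\<^sub>R (norm x + norm y)" and "n = sgn z"
  have d0: "d \<ge> 0" using d(1) norm_ge_zero[of "x - z"] by linarith
  have nx: "norm x \<ge> b / 2" "norm y \<ge> b / 2"
    using norm_triangle_ineq2[of z x] norm_triangle_ineq2[of z y] d b by (auto simp: norm_minus_commute)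
  then have nz: "x \<noteq> 0" "y \<noteq> 0" "z \<noteq> 0" using b by auto
  have n1: "norm n = 1" "norm (sgn y) = 1" using nz by (auto simp: n_def norm_sgn)
  have m1: "norm m \<le> 1" unfolding m_def by (rule norm_average_direction_le[OF nz(1,2)])
  have dev: "norm (p - norm p *\<^sub>R n) \<le> 2 * d" if "norm (p - z) \<le> d" for p
  proof -
    have zn: "norm z *\<^sub>R n = z" using nz by (simp add: n_def sgn_div_norm)
    have "p - norm p *\<^sub>R n = (p - z) + (norm z - norm p) *\<^sub>R n"
      unfolding scaleR_diff_left zn by simp
    then have "norm (p - norm p *\<^sub>R n) \<le> norm (p - z) + \<bar>norm z - norm p\<bar>"
      unfolding \<open>p - norm p *\<^sub>R n = _\<close> using norm_triangle_ineq[of "p - z" "(norm z - norm p) *\<^sub>R n"] n1 by simp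
    also have "\<bar>norm z - norm p\<bar> \<le> norm (p - z)"
      using norm_triangle_ineq3[of z p] by (simp add: norm_minus_commute)
    finally show ?thesis using that by simp
  qed
  have yn: "norm (sgn y - n) \<le> 4 * d / b"
  proof -
    have "norm y *\<^sub>R (sgn y - n) = y - norm y *\<^sub>R n" using nz by (simp add: sgn_div_norm scaleR_diff_right)
    then have "norm y * norm (sgn y - n) \<le> 2 * d" using dev[OF d(2)] by (metis norm_scaleR abs_norm_cancel)
    moreover have "b / 2 * norm (sgn y - n) \<le> norm y * norm (sgn y - n)" by (rule mult_right_mono[OF nx(2)]) simp
    ultimately have "b / 2 * norm (sgn y - n) \<le> 2 * d" by linarith
    then show ?thesis using b by (simp add: field_simps)
  qed
  have mn: "norm (m - n) \<le> 4 * d / b"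
  proof -
    let ?S = "norm x + norm y"
    have S: "?S \<ge> b" "?S > 0" using nx b by auto
    have "?S *\<^sub>R (m - n) = (x - norm x *\<^sub>R n) + (y - norm y *\<^sub>R n)"
    proof -
      have "?S *\<^sub>R m = x + y" unfolding m_def using S by simp
      then show ?thesis unfolding scaleR_diff_right by (simp add: scaleR_add_left)
    qed
    then have "norm (?S *\<^sub>R (m - n)) \<le> 4 * d"
      using norm_triangle_ineq[of "x - norm x *\<^sub>R n" "y - norm y *\<^sub>R n"] dev[OF d(1)] dev[OF d(2)] by simp
    then have "?S * norm (m - n) \<le> 4 * d" unfolding norm_scaleR using S by (simp only: abs_of_pos)
    moreover have "b * norm (m - n) \<le> ?S * norm (m - n)" by (rule mult_right_mono[OF S(1)]) simp
    ultimately have "b * norm (m - n) \<le> 4 * d" by linarith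
    then show ?thesis using b by (simp add: field_simps)
  qed
  define P where "P = v - (v \<bullet> m) *\<^sub>R sgn y"
  define Q where "Q = v - (n \<bullet> v) *\<^sub>R n"
  have PQ: "norm (P - Q) \<le> 8 * d / b * norm v"
  proof -
    have "P - Q = (v \<bullet> (n - m)) *\<^sub>R sgn y + (v \<bullet> n) *\<^sub>R (n - sgn y)"
      by (simp add: P_def Q_def algebra_simps inner_commute inner_diff_right)
    then have "norm (P - Q) \<le> \<bar>v \<bullet> (n - m)\<bar> + \<bar>v \<bullet> n\<bar> * norm (n - sgn y)"
      using norm_triangle_ineq[of "(v \<bullet> (n - m)) *\<^sub>R sgn y" "(v \<bullet> n) *\<^sub>R (n - sgn y)"] n1 by simp
    also have "\<bar>v \<bullet> (n - m)\<bar> \<le> norm v * (4 * d / b)"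
      using Cauchy_Schwarz_ineq2[of v "n - m"] mult_left_mono[OF mn norm_ge_zero[of v]] by (simp add: norm_minus_commute)
    also have "\<bar>v \<bullet> n\<bar> * norm (n - sgn y) \<le> norm v * (4 * d / b)"
      using Cauchy_Schwarz_ineq2[of v n] n1 yn by (intro mult_mono) (auto simp: norm_minus_commute)
    finally show ?thesis by (simp add: algebra_simps)
  qed
  have Pn: "norm P \<le> 2 * norm v"
  proof -
    have "norm P \<le> norm v + \<bar>v \<bullet> m\<bar>"
      unfolding P_def using norm_triangle_ineq4[of v "(v \<bullet> m) *\<^sub>R sgn y"] n1 by simp
    also have "\<bar>v \<bullet> m\<bar> \<le> norm v * norm m" by (rule Cauchy_Schwarz_ineq2)
    also have "\<dots> \<le> norm v * 1" using m1 by (intro mult_left_mono) auto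
    finally show ?thesis by simp
  qed
  have inv: "\<bar>inverse (norm x) - inverse (norm z)\<bar> \<le> 2 * d / b\<^sup>2"
  proof -
    have "\<bar>inverse (norm x) - inverse (norm z)\<bar> = \<bar>norm z - norm x\<bar> / (norm x * norm z)"
      using nz by (simp add: field_simps abs_mult abs_divide)
    also have "\<dots> \<le> d / (b / 2 * b)"
    proof (rule frac_le)
      show "\<bar>norm z - norm x\<bar> \<le> d" using norm_triangle_ineq3[of z x] d by (simp add: norm_minus_commute)
      show "b / 2 * b \<le> norm x * norm z" using nx b by (intro mult_mono) auto
    qed (use b d0 in auto)
    finally show ?thesis by (simp add: power2_eq_square field_simps)
  qed
  have "sgn x - sgn y - dsgn z (x - y) = (inverse (norm x) - inverse (norm z)) *\<^sub>R P + (P - Q) /\<^sub>R norm z"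
    unfolding sgn_diff_eq[OF nz(1,2)] dsgn_def P_def[symmetric] Q_def[symmetric] v_def[symmetric] n_def[symmetric] m_def[symmetric]
    by (simp add: algebra_simps)
  then have "norm (sgn x - sgn y - dsgn z (x - y)) \<le> \<bar>inverse (norm x) - inverse (norm z)\<bar> * norm P + norm (P - Q) * inverse (norm z)"
    using norm_triangle_ineq[of "(inverse (norm x) - inverse (norm z)) *\<^sub>R P" "(P - Q) /\<^sub>R norm z"] by (simp add: mult.commute)
  also have "\<dots> \<le> 2 * d / b\<^sup>2 * (2 * norm v) + (8 * d / b * norm v) * inverse b"
    using inv Pn PQ b d0 by (intro add_mono mult_mono) (auto intro: le_imp_inverse_le)
  also have "\<dots> = 12 * d / b\<^sup>2 * norm v" by (simp add: power2_eq_square field_simps)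
  finally show ?thesis unfolding v_def .
qed

section \<open>Coercivity for maps into space\<close>

text \<open>An oval in space: \<open>e1\<close> and \<open>e2\<close> span its plane along the axes of the ellipse. Points of space are
  split into a complex number for this plane and the component along \<open>e3\<close>, which is embedded in the complex
  numbers so that the scalar theory applies to both parts.\<close>

locale framed_oval = oval +
  fixes e1 e2 e3 :: "real^3"
  assumes orth: "e1 \<bullet> e1 = 1" "e2 \<bullet> e2 = 1" "e3 \<bullet> e3 = 1" "e1 \<bullet> e2 = 0" "e1 \<bullet> e3 = 0" "e2 \<bullet> e3 = 0"
    and span: "\<And>v. v = (v \<bullet> e1) *\<^sub>R e1 + (v \<bullet> e2) *\<^sub>R e2 + (v \<bullet> e3) *\<^sub>R e3"
begin

definition X0 :: "real \<Rightarrow> real^3" where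
  "X0 s = cos (s - s0) *\<^sub>R e1 + (\<beta> * sin (s - s0)) *\<^sub>R e2"

definition planar :: "real^3 \<Rightarrow> complex" where "planar v = Complex (v \<bullet> e1) (v \<bullet> e2)"
definition normal :: "real^3 \<Rightarrow> complex" where "normal v = of_real (v \<bullet> e3)"

lemma inner_frame: "u \<bullet> v = (u \<bullet> e1) * (v \<bullet> e1) + (u \<bullet> e2) * (v \<bullet> e2) + (u \<bullet> e3) * (v \<bullet> e3)"
proof -
  have "u \<bullet> v = u \<bullet> ((v \<bullet> e1) *\<^sub>R e1 + (v \<bullet> e2) *\<^sub>R e2 + (v \<bullet> e3) *\<^sub>R e3)" using span[of v] by simp
  then show ?thesis by (simp add: inner_add_right mult.commute)
qed

lemma inner_planar_normal: "u \<bullet> v = planar u \<bullet> planar v + normal u \<bullet> normal v"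
  unfolding inner_frame[of u v] by (simp add: planar_def normal_def inner_complex_def)

lemma bounded_linear_planar: "bounded_linear planar"
proof -
  have "planar = (\<lambda>v. of_real (v \<bullet> e1) + \<i> * of_real (v \<bullet> e2))"
    by (auto simp: planar_def complex_eq_iff)
  moreover have "bounded_linear (\<lambda>v. complex_of_real (v \<bullet> e1) + \<i> * of_real (v \<bullet> e2))"
    by (intro bounded_linear_add bounded_linear_compose[OF bounded_linear_of_real bounded_linear_inner_left]
        bounded_linear_compose[OF bounded_linear_mult_right bounded_linear_compose[OF bounded_linear_of_real bounded_linear_inner_left]])
  ultimately show ?thesis by simp
qed

lemma bounded_linear_normal: "bounded_linear normal"
  unfolding normal_def
  by (rule bounded_linear_compose[OF bounded_linear_of_real bounded_linear_inner_left])

lemma X0_frame: "X0 s \<bullet> e1 = cos (s - s0)" "X0 s \<bullet> e2 = \<beta> * sin (s - s0)" "X0 s \<bullet> e3 = 0"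
  using orth by (simp_all add: X0_def inner_add_left inner_commute[of e2 e1])

lemma planar_X0: "planar (X0 s) = w s"
  by (simp add: planar_def w_def X0_frame)

lemma norm_X0: "norm (X0 s) = r s"
proof -
  have "X0 s \<bullet> X0 s = (r s)\<^sup>2"
    unfolding inner_frame[of "X0 s" "X0 s"] X0_frame r_sq by (simp add: power2_eq_square)
  then show ?thesis by (simp add: norm_eq_sqrt_inner less_imp_le)
qed

lemma X0_nz: "X0 s \<noteq> 0" using norm_X0[of s] r_pos[of s] by auto

lemma normal_dsgn: "normal (dsgn (X0 s) v) = normal v / of_real (r s)"
  by (simp add: normal_def dsgn_def norm_X0 sgn_div_norm inner_diff_left X0_frame divide_inverse mult.commute)

text \<open>In complex notation the projection orthogonal to \<open>w\<close> maps \<open>y\<close> to \<open>(y - cnj y w\<^sup>2/|w|\<^sup>2)/2\<close>, and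
  \<open>w\<^sup>2/|w|\<^sup>2 = \<zeta>\<close>.\<close>

lemma planar_dsgn:
  "planar (dsgn (X0 s) v) = (planar v / of_real (r s) - cnj (planar v / of_real (r s)) * \<zeta> s) / 2"
proof -
  interpret planar: bounded_linear planar by (rule bounded_linear_planar)
  define y where "y = planar v"
  have "X0 s \<bullet> v = Re (cnj (w s) * y)"
    unfolding inner_planar_normal[of "X0 s" v] planar_X0 inner_complex_cnj[of "w s"] y_def
    by (simp add: normal_def X0_frame inner_complex_def)
  moreover have "complex_of_real (Re (cnj (w s) * y)) = (cnj (w s) * y + cnj (cnj (w s) * y)) / 2"
    by (simp only: complex_add_cnj) simp
  ultimately have i: "complex_of_real (X0 s \<bullet> v) = (cnj (w s) * y + w s * cnj y) / 2" by simp
  have r: "complex_of_real (r s) \<noteq> 0" by simp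
  have "planar (dsgn (X0 s) v) = (y - of_real ((X0 s \<bullet> v) / (r s)\<^sup>2) * w s) / of_real (r s)"
    unfolding dsgn_def sgn_div_norm norm_X0 planar.scaleR planar.diff planar_X0 y_def[symmetric] inner_scaleR_left
    by (simp add: scaleR_conv_of_real power2_eq_square divide_inverse mult_ac)
  also have "of_real ((X0 s \<bullet> v) / (r s)\<^sup>2) * w s = (cnj (w s) * y + w s * cnj y) / 2 / (w s * cnj (w s)) * w s"
    unfolding of_real_divide i w_cnj by simp
  also have "\<dots> = (y + cnj y * \<zeta> s) / 2"
    by (simp add: \<zeta>_def field_simps)
  also have "(y - (y + cnj y * \<zeta> s) / 2) / of_real (r s) = (y / of_real (r s) - cnj (y / of_real (r s)) * \<zeta> s) / 2"
    using r by (simp add: field_simps)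
  finally show ?thesis by (simp add: y_def)
qed

lemma continuous_dsgn:
  assumes "continuous_on A V" shows "continuous_on A (\<lambda>s. dsgn (X0 s) (V s))"
  unfolding dsgn_def X0_def[abs_def]
  by (intro continuous_intros assms) (use X0_nz in \<open>auto simp: X0_def\<close>)

text \<open>The second variation at the oval: \<open>J\<close>, the norm and the linearised closing condition all split
  into a planar and a normal part, to which \<open>coercive_scalar\<close> applies.\<close>

lemma coercive_vector:
  "\<exists>\<delta>>0. \<exists>K\<ge>0. \<forall>V V'. has_periodic_h1_deriv V V' \<longrightarrow> first_mode_free V \<longrightarrow>
     J V V' \<ge> \<delta> * sqn V - K * (norm (LINT s|circ. dsgn (X0 s) (V s)))\<^sup>2"
proof -
  obtain \<delta> K where \<delta>: "\<delta> > 0" and K: "K \<ge> 0" and scalar: "\<And>y y' l C. has_periodic_h1_deriv y y' \<Longrightarrow> first_mode_free y \<Longrightarrow> l \<ge> 0 \<Longrightarrow>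
     (\<And>N. norm (coef y 0) \<le> l + tail_sum y N + C * q ^ N) \<Longrightarrow> J y y' \<ge> \<delta> * sqn y - K * l\<^sup>2"
    using coercive_scalar by metis
  define c where "c = 2 / (T * (1 - q))"
  define c' where "c' = 1 / T"
  have "J V V' \<ge> \<delta> * sqn V - (K * (c\<^sup>2 + c'\<^sup>2)) * (norm (LINT s|circ. dsgn (X0 s) (V s)))\<^sup>2"
    if V: "has_periodic_h1_deriv V V'" and m: "first_mode_free V" for V V'
  proof -
    define L where "L = (LINT s|circ. dsgn (X0 s) (V s))"
    define y y' where "y s = planar (V s)" and "y' s = planar (V' s)" for s
    define f f' where "f s = normal (V s)" and "f' s = normal (V' s)" for s
    have y: "has_periodic_h1_deriv y y'" unfolding y_def y'_def by (rule h1_linear[OF bounded_linear_planar V])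
    have f: "has_periodic_h1_deriv f f'" unfolding f_def f'_def by (rule h1_linear[OF bounded_linear_normal V])
    have my: "first_mode_free y" unfolding y_def by (rule first_mode_free_linear[OF bounded_linear_planar m h1_sq_int[OF V]])
    have mf: "first_mode_free f" unfolding f_def by (rule first_mode_free_linear[OF bounded_linear_normal m h1_sq_int[OF V]])
    have iL: "integrable circ (\<lambda>s. dsgn (X0 s) (V s))"
      by (intro integrable_circ_cont continuous_dsgn h1_cont[OF V])
    have split: "ip F G = ip (\<lambda>s. planar (F s)) (\<lambda>s. planar (G s)) + ip (\<lambda>s. normal (F s)) (\<lambda>s. normal (G s))"
      if "sq_int F" "sq_int G" for F G
      using sq_int_inner[OF sq_int_linear[OF bounded_linear_planar that(1)] sq_int_linear[OF bounded_linear_planar that(2)]]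
        sq_int_inner[OF sq_int_linear[OF bounded_linear_normal that(1)] sq_int_linear[OF bounded_linear_normal that(2)]]
      unfolding ip_def inner_planar_normal[of "F _" "G _"] by simp
    have Lp: "norm (planar L) \<le> norm L" "norm (normal L) \<le> norm L"
    proof -
      have "(norm L)\<^sup>2 = (norm (planar L))\<^sup>2 + (norm (normal L))\<^sup>2"
        unfolding power2_norm_eq_inner inner_planar_normal[of L L] ..
      then have "(norm (planar L))\<^sup>2 \<le> (norm L)\<^sup>2" "(norm (normal L))\<^sup>2 \<le> (norm L)\<^sup>2"
        by simp_all
      then show "norm (planar L) \<le> norm L" "norm (normal L) \<le> norm L"
        using power2_le_imp_le norm_ge_zero by blast+
    qed
    have pL: "planar L = (LINT s|circ. y s / of_real (r s) - cnj (y s / of_real (r s)) * \<zeta> s) / 2"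
      unfolding L_def integral_bounded_linear[OF bounded_linear_planar iL, symmetric] planar_dsgn y_def
      by (rule integral_divide_zero)
    have nL: "normal L = (LINT s|circ. f s / of_real (r s))"
      unfolding L_def integral_bounded_linear[OF bounded_linear_normal iL, symmetric] normal_dsgn f_def ..
    have Tq: "T * (1 - q) > 0" using T_pos q by simp
    have "J y y' \<ge> \<delta> * sqn y - K * (c * norm L)\<^sup>2"
    proof -
      obtain C where C: "\<And>N. norm (coef y 0) \<le> norm (LINT s|circ. y s / of_real (r s) - cnj (y s / of_real (r s)) * \<zeta> s) / (T * (1 - q)) + tail_sum y N + C * q ^ N"
        using coef0_planar[OF h1_sq_int[OF y]] by blast
      have "norm (LINT s|circ. y s / of_real (r s) - cnj (y s / of_real (r s)) * \<zeta> s) = 2 * norm (planar L)"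
        unfolding pL by (simp add: norm_divide)
      then have "norm (LINT s|circ. y s / of_real (r s) - cnj (y s / of_real (r s)) * \<zeta> s) / (T * (1 - q)) \<le> 2 * norm L / (T * (1 - q))"
        using Lp Tq by (intro divide_right_mono) auto
      then have *: "norm (LINT s|circ. y s / of_real (r s) - cnj (y s / of_real (r s)) * \<zeta> s) / (T * (1 - q)) \<le> c * norm L"
        by (simp add: c_def)
      show ?thesis
      proof (rule scalar[OF y my])
        show "0 \<le> c * norm L" using Tq by (simp add: c_def)
        show "norm (coef y 0) \<le> c * norm L + tail_sum y N + C * q ^ N" for N
          using C[of N] * by linarith
      qed
    qed
    moreover have "J f f' \<ge> \<delta> * sqn f - K * (c' * norm L)\<^sup>2"
    proof -
      obtain C where C: "\<And>N. norm (coef f 0) \<le> norm (LINT s|circ. f s / of_real (r s)) / T + tail_sum f N + C * q ^ N"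
        using coef0_normal[OF h1_sq_int[OF f]] by blast
      have *: "norm (LINT s|circ. f s / of_real (r s)) / T \<le> c' * norm L"
        unfolding nL[symmetric] c'_def using Lp T_pos by (simp add: divide_right_mono)
      show ?thesis
      proof (rule scalar[OF f mf])
        show "0 \<le> c' * norm L" using T_pos by (simp add: c'_def)
        show "norm (coef f 0) \<le> c' * norm L + tail_sum f N + C * q ^ N" for N
          using C[of N] * by linarith
      qed
    qed
    moreover have "sqn V = sqn y + sqn f" "sqn V' = sqn y' + sqn f'"
      unfolding y_def f_def y'_def f'_def by (intro split h1_sq_int[OF V] h1_sq_int_deriv[OF V])+
    ultimately have "J V V' \<ge> \<delta> * sqn V - (K * (c * norm L)\<^sup>2 + K * (c' * norm L)\<^sup>2)"
      by (simp add: J_def algebra_simps)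
    then show ?thesis unfolding L_def[symmetric] by (simp add: power_mult_distrib algebra_simps)
  qed
  moreover have "K * (c\<^sup>2 + c'\<^sup>2) \<ge> 0" using K by simp
  ultimately show ?thesis using \<delta> by blast
qed

end

section \<open>First harmonics as a constrained local minimum\<close>

text \<open>Averages \<open>|f s|\<^sup>2 \<le> 2 |f t|\<^sup>2 + 2 |f s - f t|\<^sup>2\<close> over \<open>t\<close>.\<close>

lemma h1_sup_bound:
  fixes f :: "real \<Rightarrow> 'a::euclidean_space"
  assumes f: "has_periodic_h1_deriv f f'" and s: "s \<in> {0..2*pi}"
  shows "(norm (f s))\<^sup>2 \<le> sqn f / pi + 4 * pi * sqn f'"
proof -
  have "(norm (f s))\<^sup>2 - 4 * pi * sqn f' \<le> 2 * (norm (f t))\<^sup>2" if t: "t \<in> {0..2*pi}" for t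
  proof -
    have "(norm (f s - f t))\<^sup>2 \<le> \<bar>s - t\<bar> * sqn f'"
      using h1_increment_bound[OF f t s] by (simp add: ip_self)
    also have "\<dots> \<le> (2 * pi) * sqn f'"
      using s t by (intro mult_right_mono ip_self_nonneg) auto
    finally have d: "(norm (f s - f t))\<^sup>2 \<le> 2 * pi * sqn f'" .
    have "norm (f s) \<le> norm (f t) + norm (f s - f t)" by (metis norm_triangle_sub)
    then have "(norm (f s))\<^sup>2 \<le> (norm (f t) + norm (f s - f t))\<^sup>2" by (rule power_mono) simp
    also have "\<dots> = 2 * (norm (f t))\<^sup>2 + 2 * (norm (f s - f t))\<^sup>2 - (norm (f t) - norm (f s - f t))\<^sup>2"
      by (simp add: power2_eq_square algebra_simps)
    also have "\<dots> \<le> 2 * (norm (f t))\<^sup>2 + 2 * (norm (f s - f t))\<^sup>2" by simp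
    finally show ?thesis using d by simp
  qed
  then have "(LINT t|circ. (norm (f s))\<^sup>2 - 4 * pi * sqn f') \<le> (LINT t|circ. 2 * (norm (f t))\<^sup>2)"
    by (intro integral_mono) (auto intro: sq_int_norm2[OF h1_sq_int[OF f]])
  then have "2 * pi * ((norm (f s))\<^sup>2 - 4 * pi * sqn f') \<le> 2 * sqn f" by (simp add: ip_self)
  then have "pi * ((norm (f s))\<^sup>2 - 4 * pi * sqn f') \<le> sqn f" by simp
  then have "(norm (f s))\<^sup>2 - 4 * pi * sqn f' \<le> sqn f / pi"
    by (simp only: pos_le_divide_eq[OF pi_gt_zero] mult.commute)
  then show ?thesis by simp
qed

lemma ip_deriv_eq:
  fixes f :: "real \<Rightarrow> 'a::euclidean_space"
  assumes f: "has_periodic_h1_deriv f g" and f': "has_periodic_h1_deriv f g'"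
  shows "sqn g = sqn g'"
  unfolding ip_self
proof (rule integral_cong_AE)
  show "AE s in circ. (norm (g s))\<^sup>2 = (norm (g' s))\<^sup>2"
    using h1_deriv_unique[OF f f'] by eventually_elim simp
qed (use sq_int_norm2[OF h1_sq_int_deriv[OF f]] sq_int_norm2[OF h1_sq_int_deriv[OF f']] in auto)

lemma integral_norm_le_sqrt_ip:
  assumes f: "sq_int f"
  shows "(LINT s|circ. norm (f s))\<^sup>2 \<le> 2 * pi * sqn f"
proof -
  have "sq_int (\<lambda>s. 1::real)" by (intro sq_int_cont continuous_intros)
  from Cauchy_Schwarz_circ[OF this f] show ?thesis by (simp add: ip_self)
qed

definition harmonic :: "'a::real_vector \<Rightarrow> 'a \<Rightarrow> real \<Rightarrow> 'a" where
  "harmonic a b s = cos s *\<^sub>R a + sin s *\<^sub>R b"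

lemma harmonic_cont [continuous_intros]: "continuous_on A (harmonic a b)" for a :: "'a::real_normed_vector"
  unfolding harmonic_def by (intro continuous_intros)

lemma h1_harmonic: "has_periodic_h1_deriv (harmonic a b) (harmonic b (- a))" for a :: "'a::euclidean_space"
  unfolding harmonic_def by (rule h1_smooth, simp) (auto intro!: derivative_eq_intros continuous_intros simp: algebra_simps)

lemma harmonic_uminus: "harmonic (- a) (- b) = (\<lambda>s. - harmonic a b s)"
  by (simp add: harmonic_def fun_eq_iff)

lemma J_polar_harmonic:
  fixes f :: "real \<Rightarrow> 'a::euclidean_space"
  assumes f: "has_periodic_h1_deriv f f'"
  shows "J_polar f f' (harmonic a b) (harmonic b (- a)) = 0"
proof -
  have "ip f' (harmonic b (- a)) = - ip f (harmonic (- a) (- b))"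
    by (rule ip_parts[OF f h1_harmonic])
  also have "ip f (harmonic (- a) (- b)) = - ip f (harmonic a b)"
    by (simp add: ip_def harmonic_uminus)
  finally show ?thesis by (simp add: J_polar_def)
qed

lemma J_harmonic: "J (harmonic a b) (harmonic b (- a)) = 0" for a :: "'a::euclidean_space"
  using J_polar_harmonic[OF h1_harmonic, of a b a b] by (simp add: J_def J_polar_def)

lemma J_diff_harmonic:
  fixes f :: "real \<Rightarrow> 'a::euclidean_space"
  assumes f: "has_periodic_h1_deriv f f'"
  shows "J (\<lambda>s. f s - harmonic a b s) (\<lambda>s. f' s - harmonic b (- a) s) = J f f'"
  by (simp add: J_diff[OF f h1_harmonic] J_polar_harmonic[OF f] J_harmonic)

lemma integral_trig_scaleR_harmonic:
  fixes a :: "'a::euclidean_space"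
  shows "(LINT s|circ. cos s *\<^sub>R harmonic a b s) = pi *\<^sub>R a" "(LINT s|circ. sin s *\<^sub>R harmonic a b s) = pi *\<^sub>R b"
proof -
  have i: "integrable circ (\<lambda>s. cos s * cos s)" "integrable circ (\<lambda>s. cos s * sin s)" "integrable circ (\<lambda>s. sin s * cos s)" "integrable circ (\<lambda>s. sin s * sin s)"
    by (intro integrable_circ_cont continuous_intros)+
  have "(\<lambda>s. cos s *\<^sub>R harmonic a b s) = (\<lambda>s. (cos s * cos s) *\<^sub>R a + (cos s * sin s) *\<^sub>R b)"
    "(\<lambda>s. sin s *\<^sub>R harmonic a b s) = (\<lambda>s. (sin s * cos s) *\<^sub>R a + (sin s * sin s) *\<^sub>R b)"
    by (simp_all add: harmonic_def scaleR_add_right)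
  then show "(LINT s|circ. cos s *\<^sub>R harmonic a b s) = pi *\<^sub>R a" "(LINT s|circ. sin s *\<^sub>R harmonic a b s) = pi *\<^sub>R b"
    using i by (simp_all add: trig_products)
qed

context framed_oval
begin

lemma X0_harmonic: "X0 = harmonic (cos s0 *\<^sub>R e1 - (\<beta> * sin s0) *\<^sub>R e2) (sin s0 *\<^sub>R e1 + (\<beta> * cos s0) *\<^sub>R e2)"
  by (simp add: fun_eq_iff X0_def harmonic_def cos_diff sin_diff algebra_simps)

text \<open>Here \<open>a\<close> and \<open>b\<close> are the first Fourier coefficients of \<open>X\<close>, and \<open>V\<close> is the remainder. Both \<open>X\<close> and its first
  harmonics satisfy the closing condition, so the linearised condition for \<open>V\<close> equals the
  error of linearisation, which is \<open>O(d)\<close> times the norm of \<open>V\<close>. For small \<open>d\<close> the coercive term absorbs its square.\<close>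

lemma local_minimum:
  "\<exists>d>0. \<exists>\<delta>>0. \<forall>X X'. has_periodic_h1_deriv X X' \<longrightarrow> (\<forall>s\<in>{0..2*pi}. norm (X s - X0 s) \<le> d) \<longrightarrow>
     (LINT s|circ. sgn (X s)) = 0 \<longrightarrow>
     (\<exists>a b. (\<forall>s. norm (harmonic a b s - X0 s) \<le> \<beta> / 2) \<and>
        J X X' \<ge> \<delta> * sqn (\<lambda>s. X s - harmonic a b s))"
proof -
  obtain \<delta> K where \<delta>: "\<delta> > 0" and K: "K \<ge> 0" and coercive: "\<And>V V'. has_periodic_h1_deriv V V' \<Longrightarrow> first_mode_free V \<Longrightarrow>
     J V V' \<ge> \<delta> * sqn V - K * (norm (LINT s|circ. dsgn (X0 s) (V s)))\<^sup>2"
    using coercive_vector by metis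
  \<comment> \<open>\<open>48 = 12 \<cdot> 4\<close>, as \<open>sgn_strict_derivative\<close> is applied at distance \<open>4 d\<close> from \<open>X0\<close>.\<close>
  define M where "M = K * (48 / \<beta>\<^sup>2)\<^sup>2 * (2 * pi)"
  have M: "M \<ge> 0" using K by (simp add: M_def)
  \<comment> \<open>The first bound keeps \<open>X\<close> and its first harmonics away from zero, the second lets the coercive term absorb the error.\<close>
  define d where "d = min (\<beta> / 8) (sqrt (\<delta> / (2 * (M + 1))))"
  have d: "d > 0" using \<beta> \<delta> M by (simp add: d_def)
  have d8: "4 * d \<le> \<beta> / 2" by (simp add: d_def)
  have "d\<^sup>2 \<le> (sqrt (\<delta> / (2 * (M + 1))))\<^sup>2" using d by (intro power_mono) (auto simp: d_def)
  then have "d\<^sup>2 \<le> \<delta> / (2 * (M + 1))" using \<delta> M by simp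
  then have "d\<^sup>2 * (2 * (M + 1)) \<le> \<delta>" using M by (simp add: pos_le_divide_eq)
  then have "2 * (M * d\<^sup>2) + 2 * d\<^sup>2 \<le> \<delta>" by (simp add: algebra_simps)
  then have Md: "M * d\<^sup>2 \<le> \<delta> / 2" using zero_le_power2[of d] by linarith
  have main: "\<exists>a b. (\<forall>s. norm (harmonic a b s - X0 s) \<le> \<beta> / 2) \<and>
        J X X' \<ge> (\<delta> / 2) * sqn (\<lambda>s. X s - harmonic a b s)"
    if X: "has_periodic_h1_deriv X X'" and near: "\<And>s. s \<in> {0..2*pi} \<Longrightarrow> norm (X s - X0 s) \<le> d"
      and closed: "(LINT s|circ. sgn (X s)) = 0" for X X'
  proof -
    define a0 b0 where "a0 = cos s0 *\<^sub>R e1 - (\<beta> * sin s0) *\<^sub>R e2" and "b0 = sin s0 *\<^sub>R e1 + (\<beta> * cos s0) *\<^sub>R e2"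
    have X0: "X0 = harmonic a0 b0" unfolding a0_def b0_def by (rule X0_harmonic)
    define a b where "a = (LINT s|circ. cos s *\<^sub>R X s) /\<^sub>R pi" and "b = (LINT s|circ. sin s *\<^sub>R X s) /\<^sub>R pi"
    have coeff: "norm ((LINT s|circ. p s *\<^sub>R X s) /\<^sub>R pi - (LINT s|circ. p s *\<^sub>R X0 s) /\<^sub>R pi) \<le> 2 * d"
      if p: "continuous_on {0..2*pi} p" "\<And>s. \<bar>p s\<bar> \<le> 1" for p
    proof -
      have sX: "sq_int X" "sq_int X0" unfolding X0 by (rule h1_sq_int[OF X] h1_sq_int[OF h1_harmonic])+
      have "norm ((LINT s|circ. p s *\<^sub>R X s) - (LINT s|circ. p s *\<^sub>R X0 s)) = norm (LINT s|circ. p s *\<^sub>R (X s - X0 s))"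
        by (simp only: integral_scaleR_diff_cont[OF p(1) sX])
      also have "\<dots> \<le> (LINT s|circ. norm (p s *\<^sub>R (X s - X0 s)))" by (rule integral_norm_bound)
      also have "\<dots> \<le> (LINT s|circ. d)"
      proof (rule integral_mono)
        show "integrable circ (\<lambda>s. norm (p s *\<^sub>R (X s - X0 s)))"
          by (intro integrable_norm sq_int_bilinear[OF bounded_bilinear_scaleR] sq_int_cont p sq_int_diff sX)
        fix s assume "s \<in> space circ"
        then have "norm (X s - X0 s) \<le> d" using near by simp
        then have "\<bar>p s\<bar> * norm (X s - X0 s) \<le> 1 * d" using p(2) by (intro mult_mono) auto
        then show "norm (p s *\<^sub>R (X s - X0 s)) \<le> d" by simp
      qed simp
      finally have "norm ((LINT s|circ. p s *\<^sub>R X s) - (LINT s|circ. p s *\<^sub>R X0 s)) \<le> 2 * pi * d" by simp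
      then show ?thesis unfolding scaleR_diff_right[symmetric] norm_scaleR by (simp add: field_simps)
    qed
    have a: "norm (a - a0) \<le> 2 * d"
      using coeff[of cos] by (simp add: X0 integral_trig_scaleR_harmonic a_def continuous_intros)
    have b: "norm (b - b0) \<le> 2 * d"
      using coeff[of sin] by (simp add: X0 integral_trig_scaleR_harmonic b_def continuous_intros)
    have F: "norm (harmonic a b s - X0 s) \<le> 4 * d" for s
    proof -
      have "harmonic a b s - X0 s = cos s *\<^sub>R (a - a0) + sin s *\<^sub>R (b - b0)" by (simp add: X0 harmonic_def algebra_simps)
      then have "norm (harmonic a b s - X0 s) \<le> \<bar>cos s\<bar> * norm (a - a0) + \<bar>sin s\<bar> * norm (b - b0)"
        using norm_triangle_ineq[of "cos s *\<^sub>R (a - a0)" "sin s *\<^sub>R (b - b0)"] by simp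
      also have "\<dots> \<le> 1 * (2 * d) + 1 * (2 * d)" using a b d by (intro add_mono mult_mono) auto
      finally show ?thesis by simp
    qed
    have Fnz: "harmonic a b s \<noteq> 0" for s
    proof
      assume "harmonic a b s = 0"
      then have "r s \<le> \<beta> / 2" using F[of s] d8 by (simp add: norm_X0)
      then show False using r_ge[of s] \<beta> by simp
    qed
    have Xnz: "X s \<noteq> 0" if "s \<in> {0..2*pi}" for s
    proof
      assume "X s = 0"
      then have "r s \<le> \<beta> / 2" using near[OF that] d8 d by (simp add: norm_X0)
      then show False using r_ge[of s] \<beta> by simp
    qed
    define V V' where "V s = X s - harmonic a b s" and "V' s = X' s - harmonic b (- a) s" for s
    have V: "has_periodic_h1_deriv V V'" unfolding V_def V'_def by (rule h1_diff[OF X h1_harmonic])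
    have JV: "J V V' = J X X'" unfolding V_def V'_def by (rule J_diff_harmonic[OF X])
    have mV: "first_mode_free V"
      unfolding first_mode_free_def V_def
      using integral_scaleR_diff_cont[OF _ h1_sq_int[OF X] h1_sq_int[OF h1_harmonic], of cos a b]
        integral_scaleR_diff_cont[OF _ h1_sq_int[OF X] h1_sq_int[OF h1_harmonic], of sin a b]
      by (simp add: continuous_intros integral_trig_scaleR_harmonic a_def b_def)
    define L where "L = (LINT s|circ. dsgn (X0 s) (V s))"
    have closed1: "(LINT s|circ. sgn (harmonic a b s)) = 0"
    proof (rule antiperiodic_integral_zero)
      show "continuous_on UNIV (\<lambda>s. sgn (harmonic a b s))" using Fnz by (intro continuous_intros) auto
      show "sgn (harmonic a b (s + pi)) = - sgn (harmonic a b s)" for s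
      proof -
        have "harmonic a b (s + pi) = - harmonic a b s" by (simp add: harmonic_def)
        then show ?thesis by (simp add: sgn_minus)
      qed
    qed
    have cs: "continuous_on {0..2*pi} (\<lambda>s. sgn (X s))" "continuous_on {0..2*pi} (\<lambda>s. sgn (harmonic a b s))"
      using Xnz Fnz by (auto intro!: continuous_intros h1_cont[OF X])
    note isg = integrable_circ_cont[OF cs(1)] integrable_circ_cont[OF cs(2)]
      integrable_circ_cont[OF continuous_dsgn[OF h1_cont[OF V]]]
    have "L = - (LINT s|circ. sgn (X s) - sgn (harmonic a b s) - dsgn (X0 s) (V s))"
      unfolding L_def using isg closed closed1 by simp
    then have "norm L = norm (LINT s|circ. sgn (X s) - sgn (harmonic a b s) - dsgn (X0 s) (V s))" by simp
    also have "\<dots> \<le> (LINT s|circ. norm (sgn (X s) - sgn (harmonic a b s) - dsgn (X0 s) (V s)))"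
      by (rule integral_norm_bound)
    also have "\<dots> \<le> (LINT s|circ. (48 / \<beta>\<^sup>2 * d) * norm (V s))"
    proof (rule integral_mono)
      show "integrable circ (\<lambda>s. norm (sgn (X s) - sgn (harmonic a b s) - dsgn (X0 s) (V s)))"
        using isg by (intro integrable_norm Bochner_Integration.integrable_diff)
      show "integrable circ (\<lambda>s. (48 / \<beta>\<^sup>2 * d) * norm (V s))"
        by (intro integrable_mult_right integrable_norm sq_int_integrable h1_sq_int[OF V])
      fix s assume "s \<in> space circ"
      then have "norm (X s - X0 s) \<le> 4 * d" using near[of s] d by simp
      from sgn_strict_derivative[OF \<beta>(1) _ this F[of s] d8] show "norm (sgn (X s) - sgn (harmonic a b s) - dsgn (X0 s) (V s)) \<le> (48 / \<beta>\<^sup>2 * d) * norm (V s)"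
        using r_ge[of s] by (simp add: norm_X0 V_def)
    qed
    also have "\<dots> = (48 / \<beta>\<^sup>2 * d) * (LINT s|circ. norm (V s))"
      by (rule Bochner_Integration.integral_mult_right_zero)
    finally have "(norm L)\<^sup>2 \<le> ((48 / \<beta>\<^sup>2 * d) * (LINT s|circ. norm (V s)))\<^sup>2"
      by (rule power_mono) simp
    also have "\<dots> = (48 / \<beta>\<^sup>2)\<^sup>2 * d\<^sup>2 * (LINT s|circ. norm (V s))\<^sup>2" by (simp only: power_mult_distrib)
    also have "\<dots> \<le> (48 / \<beta>\<^sup>2)\<^sup>2 * d\<^sup>2 * (2 * pi * sqn V)"
      by (intro mult_left_mono integral_norm_le_sqrt_ip h1_sq_int[OF V]) simp
    finally have "K * (norm L)\<^sup>2 \<le> K * ((48 / \<beta>\<^sup>2)\<^sup>2 * d\<^sup>2 * (2 * pi * sqn V))"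
      using K by (rule mult_left_mono)
    also have "\<dots> = (M * d\<^sup>2) * sqn V" by (simp add: M_def)
    also have "\<dots> \<le> (\<delta> / 2) * sqn V" by (intro mult_right_mono Md ip_self_nonneg)
    finally have "J V V' \<ge> \<delta> * sqn V - (\<delta> / 2) * sqn V"
      using coercive[OF V mV] unfolding L_def by linarith
    then have "J X X' \<ge> (\<delta> / 2) * sqn V" unfolding JV by (simp add: field_simps)
    moreover have "norm (harmonic a b s - X0 s) \<le> \<beta> / 2" for s using F[of s] d8 by linarith
    ultimately show ?thesis unfolding V_def by blast
  qed
  have half: "\<delta> / 2 > 0" using \<delta> by simp
  show ?thesis
    by (rule exI[of _ d], rule conjI[OF d], rule exI[of _ "\<delta> / 2"], rule conjI[OF half], intro allI impI)
      (rule main, auto)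
qed

end

section \<open>Rayleigh quotients close to one\<close>

lemma unit_field_deriv_orthogonal:
  fixes U :: "real \<Rightarrow> 'a::euclidean_space"
  assumes U: "has_periodic_h1_deriv U U'" and n: "\<And>s. norm (U s) = 1"
  shows "AE s in circ. U s \<bullet> U' s = 0"
proof -
  have "(\<lambda>s. U s \<bullet> U s) = (\<lambda>s. 1)" using n by (simp add: norm_eq_1)
  then have "has_periodic_h1_deriv (\<lambda>s. 1::real) (\<lambda>s. U' s \<bullet> U s + U s \<bullet> U' s)"
    using h1_prod[OF bounded_bilinear_inner U U] by simp
  moreover have "has_periodic_h1_deriv (\<lambda>s. 1::real) (\<lambda>s. 0)"
    by (rule h1_smooth) auto
  ultimately have "AE s in circ. U' s \<bullet> U s + U s \<bullet> U' s = 0" by (rule h1_deriv_unique)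
  then show ?thesis by eventually_elim (simp add: inner_commute)
qed

text \<open>\<open>|(\<Phi> U)'|\<^sup>2 = \<Phi>'\<^sup>2 + \<Phi>\<^sup>2 |U'|\<^sup>2\<close>, as \<open>U\<close> and \<open>U'\<close> are orthogonal.\<close>

lemma scaled_unit_field:
  fixes U :: "real \<Rightarrow> 'a::euclidean_space"
  assumes U: "has_periodic_h1_deriv U U'" and n: "\<And>s. norm (U s) = 1"
    and \<Phi>: "has_periodic_h1_deriv \<Phi> \<phi>" and X: "has_periodic_h1_deriv (\<lambda>s. \<Phi> s *\<^sub>R U s) X'"
  shows "integrable circ (\<lambda>s. (\<phi> s)\<^sup>2 + (norm (U' s))\<^sup>2 * (\<Phi> s)\<^sup>2)"
    "sqn X' = (LINT s|circ. (\<phi> s)\<^sup>2 + (norm (U' s))\<^sup>2 * (\<Phi> s)\<^sup>2)"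
    "sqn (\<lambda>s. \<Phi> s *\<^sub>R U s) = ip \<Phi> \<Phi>"
proof -
  have P: "has_periodic_h1_deriv (\<lambda>s. \<Phi> s *\<^sub>R U s) (\<lambda>s. \<phi> s *\<^sub>R U s + \<Phi> s *\<^sub>R U' s)"
    by (rule h1_prod[OF bounded_bilinear_scaleR \<Phi> U])
  have ae: "AE s in circ. (norm (\<phi> s *\<^sub>R U s + \<Phi> s *\<^sub>R U' s))\<^sup>2 = (\<phi> s)\<^sup>2 + (norm (U' s))\<^sup>2 * (\<Phi> s)\<^sup>2"
    using unit_field_deriv_orthogonal[OF U n]
  proof eventually_elim
    case (elim s)
    have "U s \<bullet> U s = 1" using n[of s] by (simp add: norm_eq_1)
    then show ?case using elim unfolding power2_norm_eq_inner
      by (simp add: inner_add_left inner_add_right inner_commute[of "U' s" "U s"] power2_eq_square)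
  qed
  have "sq_int (\<lambda>s. \<Phi> s *\<^sub>R U' s)"
    by (intro sq_int_bounded_bilinear[OF bounded_bilinear_scaleR] h1_cont[OF \<Phi>] h1_sq_int_deriv[OF U])
  then have "integrable circ (\<lambda>s. (norm (\<Phi> s *\<^sub>R U' s))\<^sup>2)" by (rule sq_int_norm2)
  then have i: "integrable circ (\<lambda>s. (norm (U' s))\<^sup>2 * (\<Phi> s)\<^sup>2)" by (simp add: power_mult_distrib mult.commute)
  show i2: "integrable circ (\<lambda>s. (\<phi> s)\<^sup>2 + (norm (U' s))\<^sup>2 * (\<Phi> s)\<^sup>2)"
    using i sq_int_norm2[OF h1_sq_int_deriv[OF \<Phi>]] by simp
  have "sqn X' = sqn (\<lambda>s. \<phi> s *\<^sub>R U s + \<Phi> s *\<^sub>R U' s)"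
    by (rule ip_deriv_eq[OF X P])
  also have "\<dots> = (LINT s|circ. (\<phi> s)\<^sup>2 + (norm (U' s))\<^sup>2 * (\<Phi> s)\<^sup>2)"
    unfolding ip_self
  proof (rule integral_cong_AE[OF _ _ ae])
    show "(\<lambda>s. (norm (\<phi> s *\<^sub>R U s + \<Phi> s *\<^sub>R U' s))\<^sup>2) \<in> borel_measurable circ"
      using sq_int_norm2[OF h1_sq_int_deriv[OF P]] by auto
    show "(\<lambda>s. (\<phi> s)\<^sup>2 + (norm (U' s))\<^sup>2 * (\<Phi> s)\<^sup>2) \<in> borel_measurable circ"
      using i2 by auto
  qed
  finally show "sqn X' = (LINT s|circ. (\<phi> s)\<^sup>2 + (norm (U' s))\<^sup>2 * (\<Phi> s)\<^sup>2)" .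
  show "sqn (\<lambda>s. \<Phi> s *\<^sub>R U s) = ip \<Phi> \<Phi>"
    unfolding ip_self by (simp add: n)
qed

context framed_oval
begin

definition U0 :: "real \<Rightarrow> real^3" where "U0 s = sgn (X0 s)"

lemma h1_inverse_r: "has_periodic_h1_deriv (\<lambda>s. 1 / r s) (\<lambda>s. - r1 s / (r s)\<^sup>2)"
proof (rule h1_smooth)
  show "1 / r (s + 2 * pi) = 1 / r s" for s using shift_2pi[of r s] by (simp add: shift_pi)
  show "((\<lambda>s. 1 / r s) has_vector_derivative - r1 s / (r s)\<^sup>2) (at s)" for s
    unfolding has_real_derivative_iff_has_vector_derivative[symmetric]
    by (auto intro!: derivative_eq_intros r_deriv simp: power2_eq_square)
qed (intro continuous_intros, auto)

lemma h1_r: "has_periodic_h1_deriv r r1"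
  by (rule h1_smooth) (auto simp: shift_2pi[of r] shift_pi has_real_derivative_iff_has_vector_derivative[symmetric] intro!: r_deriv continuous_intros)

text \<open>Ground state substitution: since \<open>X\<^sub>0'' = - X\<^sub>0\<close>, the integrand of \<open>J\<close> at \<open>g X\<^sub>0\<close> differs from
  \<open>g'\<^sup>2 r\<^sup>2\<close> by the derivative of \<open>g\<^sup>2 (X\<^sub>0 \<bullet> X\<^sub>0')\<close>.\<close>

lemma J_multiple_of_X0:
  assumes g: "has_periodic_h1_deriv g g'" and Y: "has_periodic_h1_deriv (\<lambda>s. g s *\<^sub>R X0 s) Y'"
  shows "J (\<lambda>s. g s *\<^sub>R X0 s) Y' \<ge> \<beta>\<^sup>2 * sqn g'"
proof -
  define a b where "a = cos s0 *\<^sub>R e1 - (\<beta> * sin s0) *\<^sub>R e2" and "b = sin s0 *\<^sub>R e1 + (\<beta> * cos s0) *\<^sub>R e2"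
  have X0: "X0 = harmonic a b" unfolding a_def b_def by (rule X0_harmonic)
  define X1 where "X1 = harmonic b (- a)"
  have hX: "has_periodic_h1_deriv X0 X1" unfolding X0 X1_def by (rule h1_harmonic)
  have "has_periodic_h1_deriv X1 (harmonic (- a) (- b))" unfolding X1_def by (rule h1_harmonic)
  then have hX1: "has_periodic_h1_deriv X1 (\<lambda>s. - X0 s)" by (simp add: X0 harmonic_uminus)
  have c: "has_periodic_h1_deriv (\<lambda>s. X0 s \<bullet> X1 s) (\<lambda>s. X1 s \<bullet> X1 s + X0 s \<bullet> (- X0 s))"
    by (rule h1_prod[OF bounded_bilinear_inner hX hX1])
  have gg: "has_periodic_h1_deriv (\<lambda>s. g s * g s) (\<lambda>s. g' s * g s + g s * g' s)"
    by (rule h1_prod[OF bounded_bilinear_mult g g])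
  let ?P = "\<lambda>s. (g' s * g s + g s * g' s) * (X0 s \<bullet> X1 s) + g s * g s * (X1 s \<bullet> X1 s + X0 s \<bullet> (- X0 s))"
  have P: "has_periodic_h1_deriv (\<lambda>s. g s * g s * (X0 s \<bullet> X1 s)) ?P"
    by (rule h1_prod[OF bounded_bilinear_mult gg c])
  have P0: "(LINT s|circ. ?P s) = 0" by (rule h1_integral_deriv[OF P])
  have iP: "integrable circ ?P" by (rule sq_int_integrable[OF h1_sq_int_deriv[OF P]])
  have Y1: "has_periodic_h1_deriv (\<lambda>s. g s *\<^sub>R X0 s) (\<lambda>s. g' s *\<^sub>R X0 s + g s *\<^sub>R X1 s)"
    by (rule h1_prod[OF bounded_bilinear_scaleR g hX])
  note ss = h1_sq_int[OF Y1] h1_sq_int_deriv[OF Y1]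
  have "J (\<lambda>s. g s *\<^sub>R X0 s) Y' = J (\<lambda>s. g s *\<^sub>R X0 s) (\<lambda>s. g' s *\<^sub>R X0 s + g s *\<^sub>R X1 s)"
    unfolding J_def ip_deriv_eq[OF Y Y1] ..
  also have "\<dots> = (LINT s|circ. (g' s *\<^sub>R X0 s + g s *\<^sub>R X1 s) \<bullet> (g' s *\<^sub>R X0 s + g s *\<^sub>R X1 s) - (g s *\<^sub>R X0 s) \<bullet> (g s *\<^sub>R X0 s))"
    unfolding J_def ip_def by (rule Bochner_Integration.integral_diff[symmetric]) (intro sq_int_inner ss)+
  also have "\<dots> = (LINT s|circ. (g' s * r s)\<^sup>2 + ?P s)"
  proof (rule Bochner_Integration.integral_cong[OF refl])
    fix s
    have "X0 s \<bullet> X0 s = (r s)\<^sup>2" using norm_X0[of s] by (simp add: power2_norm_eq_inner[symmetric])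
    then show "(g' s *\<^sub>R X0 s + g s *\<^sub>R X1 s) \<bullet> (g' s *\<^sub>R X0 s + g s *\<^sub>R X1 s) - (g s *\<^sub>R X0 s) \<bullet> (g s *\<^sub>R X0 s) = (g' s * r s)\<^sup>2 + ?P s"
      by (simp add: inner_add_left inner_add_right inner_commute[of "X1 s" "X0 s"] power2_eq_square algebra_simps)
  qed
  also have "\<dots> = (LINT s|circ. (g' s * r s)\<^sup>2)"
  proof -
    have "sq_int (\<lambda>s. r s * g' s)"
      by (intro sq_int_bounded_bilinear[OF bounded_bilinear_mult] continuous_intros h1_sq_int_deriv[OF g])
    then have "integrable circ (\<lambda>s. (g' s * r s)\<^sup>2)" using sq_int_norm2 by (fastforce simp: mult.commute)
    then show ?thesis using iP P0 by simp
  qed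
  finally have e: "J (\<lambda>s. g s *\<^sub>R X0 s) Y' = (LINT s|circ. (g' s * r s)\<^sup>2)" .
  have "(LINT s|circ. \<beta>\<^sup>2 * (norm (g' s))\<^sup>2) \<le> (LINT s|circ. (g' s * r s)\<^sup>2)"
  proof (rule integral_mono)
    show "integrable circ (\<lambda>s. \<beta>\<^sup>2 * (norm (g' s))\<^sup>2)"
      by (intro integrable_mult_right sq_int_norm2 h1_sq_int_deriv[OF g])
    have "sq_int (\<lambda>s. r s * g' s)"
      by (intro sq_int_bounded_bilinear[OF bounded_bilinear_mult] continuous_intros h1_sq_int_deriv[OF g])
    then show "integrable circ (\<lambda>s. (g' s * r s)\<^sup>2)" using sq_int_norm2 by (fastforce simp: mult.commute)
    fix s
    have "\<beta>\<^sup>2 \<le> (r s)\<^sup>2" using r_ge[of s] \<beta> by (intro power_mono) auto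
    then show "\<beta>\<^sup>2 * (norm (g' s))\<^sup>2 \<le> (g' s * r s)\<^sup>2"
      unfolding power_mult_distrib mult.commute[of "(g' s)\<^sup>2"] by (simp add: mult_right_mono)
  qed
  then show ?thesis unfolding e by (simp add: ip_self)
qed

text \<open>The change of the potential \<open>|U'|\<^sup>2\<close> under a perturbation, integrated against a bounded weight.\<close>

lemma norm_sq_diff_integral_le:
  fixes f g :: "real \<Rightarrow> 'a::euclidean_space"
  assumes f: "sq_int f" and g: "sq_int g" and p: "continuous_on {0..2*pi} p" "\<And>s. s \<in> {0..2*pi} \<Longrightarrow> 0 \<le> p s \<and> p s \<le> B"
    and e: "sqn (\<lambda>s. g s - f s) \<le> \<epsilon>\<^sup>2" "\<epsilon> \<ge> 0" and B: "B \<ge> 0"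
    and i: "integrable circ (\<lambda>s. p s * (norm (f s))\<^sup>2)" "integrable circ (\<lambda>s. p s * (norm (g s))\<^sup>2)"
  shows "(LINT s|circ. p s * (norm (f s))\<^sup>2) - (LINT s|circ. p s * (norm (g s))\<^sup>2) \<le> B * (2 * sqrt (sqn f) * \<epsilon> + \<epsilon>\<^sup>2)"
proof -
  let ?D = "\<lambda>s. g s - f s"
  have D: "sq_int ?D" by (rule sq_int_diff[OF g f])
  have "(LINT s|circ. p s * (norm (f s))\<^sup>2) - (LINT s|circ. p s * (norm (g s))\<^sup>2) = (LINT s|circ. p s * (norm (f s))\<^sup>2 - p s * (norm (g s))\<^sup>2)"
    using i by simp
  also have "\<dots> \<le> (LINT s|circ. B * (2 * (norm (f s) * norm (?D s)) + (norm (?D s))\<^sup>2))"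
  proof (rule integral_mono)
    show "integrable circ (\<lambda>s. B * (2 * (norm (f s) * norm (?D s)) + (norm (?D s))\<^sup>2))"
      using sq_int_norm_mult[OF f D] sq_int_norm2[OF D] by simp
    fix s assume "s \<in> space circ"
    then have ps: "0 \<le> p s" "p s \<le> B" using p(2)[of s] by auto
    have t: "norm (f s) \<le> norm (g s) + norm (?D s)"
      using norm_triangle_sub[of "f s" "g s"] by (simp add: norm_minus_commute)
    have nn: "0 \<le> 2 * (norm (f s) * norm (?D s)) + (norm (?D s))\<^sup>2" by simp
    have "(norm (f s))\<^sup>2 - (norm (g s))\<^sup>2 = 2 * norm (f s) * (norm (f s) - norm (g s)) - (norm (f s) - norm (g s))\<^sup>2"
      by (simp add: power2_eq_square algebra_simps)
    also have "\<dots> \<le> 2 * norm (f s) * norm (?D s)"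
    proof -
      have "2 * norm (f s) * (norm (f s) - norm (g s)) \<le> 2 * norm (f s) * norm (?D s)"
        using t by (intro mult_left_mono) auto
      then show ?thesis using zero_le_power2[of "norm (f s) - norm (g s)"] by linarith
    qed
    finally have "(norm (f s))\<^sup>2 - (norm (g s))\<^sup>2 \<le> 2 * (norm (f s) * norm (?D s)) + (norm (?D s))\<^sup>2"
      using zero_le_power2[of "norm (?D s)"] by linarith
    then have "p s * ((norm (f s))\<^sup>2 - (norm (g s))\<^sup>2) \<le> p s * (2 * (norm (f s) * norm (?D s)) + (norm (?D s))\<^sup>2)"
      using ps by (intro mult_left_mono) auto
    also have "\<dots> \<le> B * (2 * (norm (f s) * norm (?D s)) + (norm (?D s))\<^sup>2)"
      using ps nn by (intro mult_right_mono)
    finally show "p s * (norm (f s))\<^sup>2 - p s * (norm (g s))\<^sup>2 \<le> B * (2 * (norm (f s) * norm (?D s)) + (norm (?D s))\<^sup>2)"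
      by (simp add: right_diff_distrib)
  qed (use i in simp)
  also have "\<dots> = B * (2 * (LINT s|circ. norm (f s) * norm (?D s)) + ip ?D ?D)"
    using sq_int_norm_mult[OF f D] sq_int_norm2[OF D] by (simp add: ip_self)
  also have "\<dots> \<le> B * (2 * sqrt (sqn f) * \<epsilon> + \<epsilon>\<^sup>2)"
  proof (rule mult_left_mono[OF _ B])
    have "(LINT s|circ. norm (f s) * norm (?D s))\<^sup>2 \<le> sqn f * ip ?D ?D"
      unfolding ip_self by (rule Cauchy_Schwarz_circ[OF f D])
    also have "\<dots> \<le> sqn f * \<epsilon>\<^sup>2" using e by (intro mult_left_mono ip_self_nonneg)
    also have "\<dots> = (sqrt (sqn f) * \<epsilon>)\<^sup>2" by (simp add: power_mult_distrib ip_self_nonneg)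
    finally have "(LINT s|circ. norm (f s) * norm (?D s)) \<le> sqrt (sqn f) * \<epsilon>"
      by (rule power2_le_imp_le) (use e in \<open>simp add: ip_self_nonneg\<close>)
    then show "2 * (LINT s|circ. norm (f s) * norm (?D s)) + ip ?D ?D \<le> 2 * sqrt (sqn f) * \<epsilon> + \<epsilon>\<^sup>2"
      using e by simp
  qed
  finally show ?thesis .
qed

lemma ip_r_pos: "sqn r > 0"
proof -
  have "(LINT s|circ. \<beta>\<^sup>2) \<le> (LINT s|circ. (norm (r s))\<^sup>2)"
  proof (rule integral_mono)
    show "integrable circ (\<lambda>s. (norm (r s))\<^sup>2)" by (intro sq_int_norm2 sq_int_cont continuous_intros)
    show "\<beta>\<^sup>2 \<le> (norm (r s))\<^sup>2" for s using r_ge[of s] \<beta> by (intro power_mono) auto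
  qed simp
  moreover have "(LINT s|circ. \<beta>\<^sup>2) > 0" using \<beta> by simp
  ultimately show ?thesis unfolding ip_self by linarith
qed

lemma ip_r_le: "sqn r \<le> 2 * pi"
proof -
  have "(LINT s|circ. (norm (r s))\<^sup>2) \<le> (LINT s|circ. 1)"
  proof (rule integral_mono)
    show "integrable circ (\<lambda>s. (norm (r s))\<^sup>2)" by (intro sq_int_norm2 sq_int_cont continuous_intros)
    show "(norm (r s))\<^sup>2 \<le> 1" for s
      using r_le[of s] less_imp_le[OF r_pos(1)[of s]] by (simp add: power_le_one)
  qed simp
  then show ?thesis unfolding ip_self by simp
qed

text \<open>If \<open>|c|\<close> were farther from 1, then \<open>|g|\<close> would be above 1 everywhere or below 1 everywhere, and
  \<open>g r\<close> could not have the norm of \<open>r\<close>.\<close>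

lemma ratio_near_one:
  assumes g: "continuous_on {0..2*pi} g" and n: "sqn (\<lambda>s. g s * r s) = sqn r"
    and w: "\<And>s. s \<in> {0..2*pi} \<Longrightarrow> \<bar>g s - c\<bar> \<le> \<omega>"
  shows "\<bar>\<bar>c\<bar> - 1\<bar> \<le> \<omega>"
proof (rule ccontr)
  assume "\<not> ?thesis"
  then consider "\<bar>c\<bar> > 1 + \<omega>" | "\<bar>c\<bar> < 1 - \<omega>" by linarith
  then show False
  proof cases
    case 1
    define t where "t = \<bar>c\<bar> - \<omega>"
    have t: "t > 1" using 1 by (simp add: t_def)
    have "(LINT s|circ. t\<^sup>2 * (norm (r s))\<^sup>2) \<le> (LINT s|circ. (norm (g s * r s))\<^sup>2)"
    proof (rule integral_mono)
      show "integrable circ (\<lambda>s. t\<^sup>2 * (norm (r s))\<^sup>2)" "integrable circ (\<lambda>s. (norm (g s * r s))\<^sup>2)"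
        by (intro integrable_circ_cont continuous_intros g)+
      fix s assume "s \<in> space circ"
      then have "t \<le> \<bar>g s\<bar>" using w[of s] by (simp add: t_def)
      then have "t\<^sup>2 \<le> \<bar>g s\<bar>\<^sup>2" using t by (intro power_mono) auto
      then show "t\<^sup>2 * (norm (r s))\<^sup>2 \<le> (norm (g s * r s))\<^sup>2"
        by (simp add: power_mult_distrib mult_right_mono)
    qed
    then have "t\<^sup>2 * sqn r \<le> sqn (\<lambda>s. g s * r s)" by (simp add: ip_self)
    then have "t\<^sup>2 * sqn r \<le> sqn r" unfolding n .
    then have "t\<^sup>2 \<le> 1" using ip_r_pos by simp
    then show False using one_less_power[OF t, of 2] by simp
  next
    case 2
    define t where "t = \<bar>c\<bar> + \<omega>"
    have "\<omega> \<ge> 0" using w[of 0] by auto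
    then have t: "0 \<le> t" "t < 1" using 2 by (auto simp: t_def)
    have "(LINT s|circ. (norm (g s * r s))\<^sup>2) \<le> (LINT s|circ. t\<^sup>2 * (norm (r s))\<^sup>2)"
    proof (rule integral_mono)
      show "integrable circ (\<lambda>s. t\<^sup>2 * (norm (r s))\<^sup>2)" "integrable circ (\<lambda>s. (norm (g s * r s))\<^sup>2)"
        by (intro integrable_circ_cont continuous_intros g)+
      fix s assume "s \<in> space circ"
      then have "\<bar>g s\<bar> \<le> t" using w[of s] by (simp add: t_def)
      then have "\<bar>g s\<bar>\<^sup>2 \<le> t\<^sup>2" by (intro power_mono) auto
      then show "(norm (g s * r s))\<^sup>2 \<le> t\<^sup>2 * (norm (r s))\<^sup>2"
        by (simp add: power_mult_distrib mult_right_mono)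
    qed
    then have "sqn (\<lambda>s. g s * r s) \<le> t\<^sup>2 * sqn r" by (simp add: ip_self)
    then have "sqn r \<le> t\<^sup>2 * sqn r" unfolding n .
    then have "1 \<le> t\<^sup>2" using ip_r_pos by simp
    moreover have "t\<^sup>2 < 1" using t by (simp add: abs_square_less_1)
    ultimately show False by simp
  qed
qed

lemma U0_scaled: "r s *\<^sub>R U0 s = X0 s"
  by (simp add: U0_def sgn_div_norm norm_X0)

lemma norm_U0: "norm (U0 s) = 1"
  using X0_nz by (simp add: U0_def norm_sgn)

definition near_U0 :: "real \<Rightarrow> (real \<Rightarrow> real^3) \<Rightarrow> (real \<Rightarrow> real^3) \<Rightarrow> bool" where
  "near_U0 \<epsilon> U U' \<longleftrightarrow> has_periodic_h1_deriv U U' \<and> (\<forall>s. norm (U s) = 1) \<and>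
     sqn (\<lambda>s. U s - U0 s) \<le> \<epsilon>\<^sup>2 \<and>
     sqn (\<lambda>s. U' s - h1_deriv U0 s) \<le> \<epsilon>\<^sup>2"

text \<open>The ground state of \<open>U0\<close> is \<open>r\<close>, with Rayleigh quotient 1. Normalised like \<open>r\<close>, a test function \<open>\<Phi>\<close>
  satisfies \<open>J(\<Phi> U) \<le> \<eta>\<close> iff its Rayleigh quotient exceeds 1 by at most a multiple of \<open>\<eta>\<close>.\<close>

definition trial :: "real \<Rightarrow> real \<Rightarrow> (real \<Rightarrow> real^3) \<Rightarrow> (real \<Rightarrow> real) \<Rightarrow> (real \<Rightarrow> real^3) \<Rightarrow> bool" where
  "trial \<epsilon> \<eta> U \<Phi> X' \<longleftrightarrow> (\<exists>U'. near_U0 \<epsilon> U U') \<and> \<Phi> \<in> periodic_h1 \<and> ip \<Phi> \<Phi> = sqn r \<and>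
     has_periodic_h1_deriv (\<lambda>s. \<Phi> s *\<^sub>R U s) X' \<and> J (\<lambda>s. \<Phi> s *\<^sub>R U s) X' \<le> \<eta>"

text \<open>The potential changes little, so \<open>\<Phi>\<close> is also almost minimal for \<open>U0\<close>. There
  \<open>J_multiple_of_X0\<close> makes \<open>\<Phi>/r\<close> nearly constant, and the normalisation makes this constant close
  to \<open>\<plusminus>1\<close>; the sign \<open>\<sigma>\<close> selects the multiple of \<open>\<Phi>\<close> close to \<open>r\<close>.\<close>

lemma near_minimizer:
  assumes d: "d > 0" and U0: "U0 \<in> periodic_h1"
  shows "\<exists>\<epsilon>>0. \<exists>\<eta>>0. \<forall>U \<Phi> X'. trial \<epsilon> \<eta> U \<Phi> X' \<longrightarrow>
     (\<exists>\<sigma>. (\<sigma> = 1 \<or> \<sigma> = -1) \<and> (\<forall>s\<in>{0..2*pi}. \<sigma> * \<Phi> s > 0 \<and> norm ((\<sigma> * \<Phi> s) *\<^sub>R U s - X0 s) \<le> d))"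
proof -
  define U0' where "U0' = h1_deriv U0"
  have U0': "has_periodic_h1_deriv U0 U0'" unfolding U0'_def by (rule periodic_h1_deriv[OF U0])
  \<comment> \<open>The bound for the oscillation of \<open>g = \<Phi>/r\<close>: below \<open>1/2\<close> it fixes the sign of \<open>\<Phi>\<close>, and \<open>2 \<omega> + d/2 \<le> d\<close>.\<close>
  define \<omega> where "\<omega> = min (1/8) (d / 4)"
  have \<omega>: "\<omega> > 0" "\<omega> \<le> 1/8" "2 * \<omega> \<le> d / 2" using d by (auto simp: \<omega>_def)
  define \<eta> where "\<eta> = min 1 (\<beta>\<^sup>2 * \<omega>\<^sup>2 / (4 * pi))"
  have \<eta>: "\<eta> > 0" "\<eta> \<le> 1" "4 * pi * \<eta> \<le> \<beta>\<^sup>2 * \<omega>\<^sup>2"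
  proof -
    show "\<eta> > 0" "\<eta> \<le> 1" using \<beta> \<omega> by (auto simp: \<eta>_def)
    have "\<eta> \<le> \<beta>\<^sup>2 * \<omega>\<^sup>2 / (4 * pi)" by (simp add: \<eta>_def)
    then show "4 * pi * \<eta> \<le> \<beta>\<^sup>2 * \<omega>\<^sup>2" by (simp add: field_simps)
  qed
  define B where "B = 2 + 4 * pi * (1 + 2 * pi)"
  have B: "B \<ge> 0" by (simp add: B_def)
  \<comment> \<open>\<open>C \<epsilon>\<close> bounds the change of the potential energy, as \<open>\<Phi>\<^sup>2 \<le> B\<close>.\<close>
  define C where "C = B * (2 * sqrt (sqn U0') + 1)"
  have C: "C \<ge> 0" using B by (simp add: C_def ip_self_nonneg)
  define \<epsilon> where "\<epsilon> = Min {1, \<eta> / (C + 1), d / (2 * sqrt (1 + 4 * pi))}"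
  have p: "sqrt (1 + 4 * pi) > 0" by (simp add: add_pos_pos)
  have \<epsilon>: "\<epsilon> > 0" "\<epsilon> \<le> 1" "\<epsilon> \<le> \<eta> / (C + 1)" "\<epsilon> \<le> d / (2 * sqrt (1 + 4 * pi))"
    using \<eta> C d p by (auto simp: \<epsilon>_def)
  have C\<epsilon>: "C * \<epsilon> \<le> \<eta>"
  proof -
    have "\<epsilon> * (C + 1) \<le> \<eta>" using \<epsilon>(3) C by (simp add: pos_le_divide_eq)
    then show ?thesis using \<epsilon> by (simp add: algebra_simps)
  qed
  have main: "\<exists>\<sigma>. (\<sigma> = 1 \<or> \<sigma> = -1) \<and> (\<forall>s\<in>{0..2*pi}. \<sigma> * \<Phi> s > 0 \<and> norm ((\<sigma> * \<Phi> s) *\<^sub>R U s - X0 s) \<le> d)"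
    if t: "trial \<epsilon> \<eta> U \<Phi> X'" for U \<Phi> X'
  proof -
    define \<phi> where "\<phi> = h1_deriv \<Phi>"
    obtain U' where U: "has_periodic_h1_deriv U U'" and nU: "\<And>s. norm (U s) = 1"
      and D: "sqn (\<lambda>s. U s - U0 s) \<le> \<epsilon>\<^sup>2" and D': "sqn (\<lambda>s. U' s - U0' s) \<le> \<epsilon>\<^sup>2"
      using t unfolding trial_def near_U0_def U0'_def by blast
    have \<Phi>: "has_periodic_h1_deriv \<Phi> \<phi>" and nn: "ip \<Phi> \<Phi> = sqn r"
      and X: "has_periodic_h1_deriv (\<lambda>s. \<Phi> s *\<^sub>R U s) X'" and J: "J (\<lambda>s. \<Phi> s *\<^sub>R U s) X' \<le> \<eta>"
      using t unfolding trial_def \<phi>_def by (auto intro: periodic_h1_deriv)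
    have s\<phi>: "integrable circ (\<lambda>s. (\<phi> s)\<^sup>2)" using sq_int_norm2[OF h1_sq_int_deriv[OF \<Phi>]] by simp
    have iU: "integrable circ (\<lambda>s. (\<Phi> s)\<^sup>2 * (norm (V s))\<^sup>2)" if "sq_int V" for V :: "real \<Rightarrow> real^3"
    proof -
      have "sq_int (\<lambda>s. \<Phi> s *\<^sub>R V s)"
        by (intro sq_int_bounded_bilinear[OF bounded_bilinear_scaleR] h1_cont[OF \<Phi>] that)
      then show ?thesis using sq_int_norm2 by (fastforce simp: power_mult_distrib)
    qed
    note s1 = scaled_unit_field[OF U nU \<Phi> X]
    have num: "sqn X' = ip \<phi> \<phi> + (LINT s|circ. (\<Phi> s)\<^sup>2 * (norm (U' s))\<^sup>2)"
      unfolding s1(2) using s\<phi> iU[OF h1_sq_int_deriv[OF U]] by (simp add: ip_self mult.commute)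
    have JX: "sqn X' \<le> \<eta> + sqn r" using J s1(3) nn by (simp add: J_def)
    have "(LINT s|circ. (\<Phi> s)\<^sup>2 * (norm (U' s))\<^sup>2) \<ge> 0" by simp
    then have ip\<phi>: "ip \<phi> \<phi> \<le> 1 + 2 * pi" using JX num \<eta> ip_r_le by linarith
    have \<Phi>B: "(\<Phi> s)\<^sup>2 \<le> B" if "s \<in> {0..2*pi}" for s
    proof -
      have "(\<Phi> s)\<^sup>2 \<le> ip \<Phi> \<Phi> / pi + 4 * pi * ip \<phi> \<phi>" using h1_sup_bound[OF \<Phi> that] by simp
      also have "\<dots> \<le> 2 + 4 * pi * (1 + 2 * pi)"
        using ip_r_le ip\<phi> unfolding nn by (intro add_mono mult_left_mono) (auto simp: divide_le_eq)
      finally show ?thesis by (simp add: B_def)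
    qed
    define g where "g s = \<Phi> s * (1 / r s)" for s
    define g' where "g' s = \<phi> s * (1 / r s) + \<Phi> s * (- r1 s / (r s)\<^sup>2)" for s
    have g: "has_periodic_h1_deriv g g'"
      unfolding g_def g'_def by (rule h1_prod[OF bounded_bilinear_mult \<Phi> h1_inverse_r])
    have gr: "g s * r s = \<Phi> s" for s by (simp add: g_def)
    have gX: "g s *\<^sub>R X0 s = \<Phi> s *\<^sub>R U0 s" for s
      unfolding U0_scaled[symmetric] scaleR_scaleR gr ..
    define Y' where "Y' s = \<phi> s *\<^sub>R U0 s + \<Phi> s *\<^sub>R U0' s" for s
    have Y: "has_periodic_h1_deriv (\<lambda>s. \<Phi> s *\<^sub>R U0 s) Y'"
      unfolding Y'_def by (rule h1_prod[OF bounded_bilinear_scaleR \<Phi> U0'])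
    note s2 = scaled_unit_field[OF U0' norm_U0 \<Phi> Y]
    have "sqn Y' = ip \<phi> \<phi> + (LINT s|circ. (\<Phi> s)\<^sup>2 * (norm (U0' s))\<^sup>2)"
      unfolding s2(2) using s\<phi> iU[OF h1_sq_int_deriv[OF U0']] by (simp add: ip_self mult.commute)
    moreover have "(LINT s|circ. (\<Phi> s)\<^sup>2 * (norm (U0' s))\<^sup>2) - (LINT s|circ. (\<Phi> s)\<^sup>2 * (norm (U' s))\<^sup>2) \<le> B * (2 * sqrt (sqn U0') * \<epsilon> + \<epsilon>\<^sup>2)"
      using \<Phi>B \<epsilon> D' B by (intro norm_sq_diff_integral_le iU h1_sq_int_deriv[OF U] h1_sq_int_deriv[OF U0'] continuous_intros h1_cont[OF \<Phi>]) auto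
    moreover have "B * (2 * sqrt (sqn U0') * \<epsilon> + \<epsilon>\<^sup>2) \<le> C * \<epsilon>"
    proof -
      have "\<epsilon>\<^sup>2 \<le> \<epsilon>" using \<epsilon> by (simp add: power2_eq_square mult_left_le)
      then have "B * (2 * sqrt (sqn U0') * \<epsilon> + \<epsilon>\<^sup>2) \<le> B * (2 * sqrt (sqn U0') * \<epsilon> + \<epsilon>)"
        using B by (intro mult_left_mono) auto
      then show ?thesis by (simp add: C_def algebra_simps)
    qed
    ultimately have "sqn Y' \<le> 2 * \<eta> + sqn r" using num JX C\<epsilon> by linarith
    then have JY: "J (\<lambda>s. g s *\<^sub>R X0 s) Y' \<le> 2 * \<eta>"
      unfolding gX J_def s2(3) nn by simp
    have "has_periodic_h1_deriv (\<lambda>s. g s *\<^sub>R X0 s) Y'" unfolding gX by (rule Y)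
    from J_multiple_of_X0[OF g this] have gb: "\<beta>\<^sup>2 * sqn g' \<le> 2 * \<eta>" using JY by linarith
    have w: "\<bar>g s - g 0\<bar> \<le> \<omega>" if s: "s \<in> {0..2*pi}" for s
    proof -
      have "(norm (g s - g 0))\<^sup>2 \<le> \<bar>s - 0\<bar> * sqn g'"
        using h1_increment_bound[OF g, of 0 s] s by (simp add: ip_self)
      also have "\<dots> \<le> (2 * pi) * sqn g'" using s by (intro mult_right_mono ip_self_nonneg) auto
      finally have "\<beta>\<^sup>2 * (norm (g s - g 0))\<^sup>2 \<le> \<beta>\<^sup>2 * ((2 * pi) * sqn g')" by (rule mult_left_mono) simp
      also have "\<dots> = 2 * pi * (\<beta>\<^sup>2 * sqn g')" by simp
      also have "\<dots> \<le> 2 * pi * (2 * \<eta>)" by (intro mult_left_mono gb) simp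
      also have "\<dots> \<le> \<beta>\<^sup>2 * \<omega>\<^sup>2" using \<eta>(3) by simp
      finally have "(norm (g s - g 0))\<^sup>2 \<le> \<omega>\<^sup>2" using \<beta> by simp
      then show ?thesis using \<omega> by (simp add: abs_le_square_iff[symmetric])
    qed
    have c: "\<bar>\<bar>g 0\<bar> - 1\<bar> \<le> \<omega>"
      by (rule ratio_near_one[OF h1_cont[OF g] _ w]) (use nn in \<open>simp_all add: gr\<close>)
    define \<sigma> where "\<sigma> = (if g 0 \<ge> 0 then 1 else -1::real)"
    have \<sigma>: "\<sigma> = 1 \<or> \<sigma> = -1" by (simp add: \<sigma>_def)
    have \<sigma>g: "\<bar>\<sigma> * g s - 1\<bar> \<le> 2 * \<omega>" if "s \<in> {0..2*pi}" for s
      using c w[OF that] by (auto simp: \<sigma>_def)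
    have "\<sigma> * \<Phi> s > 0 \<and> norm ((\<sigma> * \<Phi> s) *\<^sub>R U s - X0 s) \<le> d" if s: "s \<in> {0..2*pi}" for s
    proof
      have "\<sigma> * g s > 0" using \<sigma>g[OF s] \<omega> by linarith
      then show "\<sigma> * \<Phi> s > 0" unfolding gr[symmetric] mult.assoc[symmetric] by simp
      have DU: "norm (U s - U0 s) \<le> d / 2"
      proof -
        have "(norm (U s - U0 s))\<^sup>2 \<le> sqn (\<lambda>s. U s - U0 s) / pi + 4 * pi * sqn (\<lambda>s. U' s - U0' s)"
          by (rule h1_sup_bound[OF h1_diff[OF U U0'] s])
        also have "\<dots> \<le> \<epsilon>\<^sup>2 / 1 + 4 * pi * \<epsilon>\<^sup>2"
          using D D' pi_ge_two by (intro add_mono mult_left_mono frac_le) (auto simp: ip_self_nonneg)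
        also have "\<dots> = (sqrt (1 + 4 * pi) * \<epsilon>)\<^sup>2" using p by (simp add: power_mult_distrib algebra_simps)
        also have "\<dots> \<le> (d / 2)\<^sup>2"
        proof (rule power_mono)
          show "sqrt (1 + 4 * pi) * \<epsilon> \<le> d / 2" using \<epsilon>(4) p by (simp add: field_simps)
        qed (use p \<epsilon> in auto)
        finally show ?thesis by (rule power2_le_imp_le) (use d in simp)
      qed
      have "(\<sigma> * \<Phi> s) *\<^sub>R U s - X0 s = ((\<sigma> * g s - 1) * r s) *\<^sub>R U s + r s *\<^sub>R (U s - U0 s)"
        unfolding gr[symmetric, of s] U0_scaled[symmetric] by (simp add: algebra_simps)
      then have "norm ((\<sigma> * \<Phi> s) *\<^sub>R U s - X0 s) \<le> \<bar>\<sigma> * g s - 1\<bar> * r s + r s * norm (U s - U0 s)"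
        using norm_triangle_ineq[of "((\<sigma> * g s - 1) * r s) *\<^sub>R U s" "r s *\<^sub>R (U s - U0 s)"] nU less_imp_le[OF r_pos(1)[of s]]
        by (simp add: abs_mult)
      also have "\<dots> \<le> (2 * \<omega>) * 1 + 1 * (d / 2)"
        using \<sigma>g[OF s] r_le[of s] DU less_imp_le[OF r_pos(1)[of s]] \<omega> by (intro add_mono mult_mono) auto
      finally show "norm ((\<sigma> * \<Phi> s) *\<^sub>R U s - X0 s) \<le> d" using \<omega> by linarith
    qed
    with \<sigma> show ?thesis by blast
  qed
  show ?thesis
    by (rule exI[of _ \<epsilon>], rule conjI[OF \<epsilon>(1)], rule exI[of _ \<eta>], rule conjI[OF \<eta>(1)], intro allI impI)
      (rule main, auto)
qed

end

section \<open>The bottom of the spectrum near an oval\<close>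

lemma loop_tangent_integral:
  assumes "arclength_loop \<gamma>" and c: "continuous_on {0..2*pi} (tangent \<gamma>)"
  shows "(LINT s|circ. tangent \<gamma> s) = 0"
proof -
  have d: "(\<gamma> has_vector_derivative tangent \<gamma> s) (at s)" for s
    using assms(1) unfolding arclength_loop_def tangent_def by (simp add: vector_derivative_works)
  have "(tangent \<gamma> has_integral (\<gamma> (2*pi) - \<gamma> 0)) {0..2*pi}"
    by (rule fundamental_theorem_of_calculus) (auto intro: d has_vector_derivative_at_within)
  moreover have "\<gamma> (2*pi) = \<gamma> 0"
    using assms(1) unfolding arclength_loop_def by (metis add.left_neutral)
  ultimately have "integral {0..2*pi} (tangent \<gamma>) = 0" by (simp add: integral_unique)
  moreover have "set_integrable lborel {0..2*pi} (tangent \<gamma>)"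
    unfolding set_integrable_circ_iff by (rule integrable_circ_cont[OF c])
  ultimately show ?thesis
    unfolding lebesgue_circ_eq[symmetric] by (simp add: set_borel_integral_eq_integral(2))
qed

lemma ip_zero_imp_zero:
  fixes f :: "real \<Rightarrow> 'a::euclidean_space"
  assumes c: "continuous_on {0..2*pi} f" and z: "sqn f = 0" and s: "s \<in> {0..2*pi}"
  shows "f s = 0"
proof -
  have c2: "continuous_on {0..2*pi} (\<lambda>s. (norm (f s))\<^sup>2)" by (intro continuous_intros c)
  have "set_integrable lborel {0..2*pi} (\<lambda>s. (norm (f s))\<^sup>2)"
    unfolding set_integrable_circ_iff by (rule integrable_circ_cont[OF c2])
  then have "integral {0..2*pi} (\<lambda>s. (norm (f s))\<^sup>2) = 0"
    using z unfolding ip_self lebesgue_circ_eq[symmetric] by (simp add: set_borel_integral_eq_integral(2))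
  then have "\<forall>s\<in>{0..2*pi}. (norm (f s))\<^sup>2 = 0"
    using integral_eq_0_iff[OF c2] by simp
  then show ?thesis using s by simp
qed

lemma periodic_eq:
  fixes f g :: "real \<Rightarrow> 'a"
  assumes f: "\<And>s. f (s + 2 * pi) = f s" and g: "\<And>s. g (s + 2 * pi) = g s"
    and e: "\<And>s. s \<in> {0..2*pi} \<Longrightarrow> f s = g s"
  shows "f s = g s"
proof -
  interpret f: periodic_fun_simple f "2 * pi" by standard (rule f)
  interpret g: periodic_fun_simple g "2 * pi" by standard (rule g)
  define n where "n = \<lfloor>s / (2 * pi)\<rfloor>"
  have "of_int n \<le> s / (2 * pi)" "s / (2 * pi) \<le> of_int n + 1" unfolding n_def by linarith+
  then have "of_int n * (2 * pi) \<le> s" "s \<le> (of_int n + 1) * (2 * pi)" using pos_le_divide_eq[of "2 * pi"] pos_divide_le_eq[of "2 * pi"] by simp_all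
  then have "s - of_int n * (2 * pi) \<in> {0..2*pi}" by (simp add: algebra_simps)
  then have "f (s - of_int n * (2 * pi)) = g (s - of_int n * (2 * pi))" by (rule e)
  then show ?thesis by (simp only: f.minus_of_int g.minus_of_int)
qed

lemma rayleigh_num:
  assumes U: "tangent \<gamma> \<in> periodic_h1" and n: "\<And>s. norm (tangent \<gamma> s) = 1"
    and \<Phi>: "\<Phi> \<in> periodic_h1" and X: "has_periodic_h1_deriv (\<lambda>s. \<Phi> s *\<^sub>R tangent \<gamma> s) X'"
  shows "(LINT s:{0..2*pi}|lborel. (h1_deriv \<Phi> s)\<^sup>2 + (curvature \<gamma> s)\<^sup>2 * (\<Phi> s)\<^sup>2)
      / (LINT s:{0..2*pi}|lborel. (\<Phi> s)\<^sup>2) = sqn X' / ip \<Phi> \<Phi>"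
  using scaled_unit_field(2)[OF periodic_h1_deriv[OF U] n periodic_h1_deriv[OF \<Phi>] X]
  unfolding lebesgue_circ_eq curvature_def ip_self[of \<Phi>] by simp

lemma ip_pos:
  fixes \<Phi> :: "real \<Rightarrow> real"
  assumes \<Phi>: "has_periodic_h1_deriv \<Phi> \<phi>" and nz: "\<Phi> \<noteq> (\<lambda>_. 0)"
  shows "ip \<Phi> \<Phi> > 0"
proof (rule ccontr)
  assume "\<not> ip \<Phi> \<Phi> > 0"
  then have "ip \<Phi> \<Phi> = 0" using ip_self_nonneg[of \<Phi>] by simp
  then have "\<Phi> s = 0" if "s \<in> {0..2*pi}" for s using ip_zero_imp_zero[OF h1_cont[OF \<Phi>]] that by blast
  then have "\<Phi> s = 0" for s
    using periodic_eq[of \<Phi> "\<lambda>_. 0" s] h1_periodic[OF \<Phi>] by auto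
  then show False using nz by auto
qed

context framed_oval
begin

text \<open>The outcome of \<open>local_minimum\<close> as a statement about \<open>U\<close> alone, in a form that allows \<open>j\<close> to tend to
  zero.\<close>

definition harmonic_direction :: "real \<Rightarrow> real \<Rightarrow> (real \<Rightarrow> real^3) \<Rightarrow> bool" where
  "harmonic_direction \<delta> j U \<longleftrightarrow> (\<exists>a b V. (\<forall>s. norm (harmonic a b s - X0 s) \<le> \<beta> / 2) \<and>
     continuous_on {0..2*pi} V \<and> \<delta> * sqn V \<le> j \<and>
     (\<forall>s\<in>{0..2*pi}. harmonic a b s + V s \<noteq> 0 \<and> sgn (harmonic a b s + V s) = U s))"

text \<open>\<open>near_minimizer\<close> puts \<open>\<sigma> \<Phi> U\<close> in the neighbourhood where \<open>local_minimum\<close> holds; its closing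
  condition is that of \<open>U\<close>, because \<open>\<sigma> \<Phi>\<close> is positive.\<close>

lemma near_critical_decomposition:
  assumes U0: "U0 \<in> periodic_h1"
  shows "\<exists>\<epsilon>>0. \<exists>\<eta>>0. \<exists>\<delta>>0. \<forall>U \<Phi> X'. trial \<epsilon> \<eta> U \<Phi> X' \<longrightarrow> (LINT s|circ. U s) = 0 \<longrightarrow>
     harmonic_direction \<delta> (J (\<lambda>s. \<Phi> s *\<^sub>R U s) X') U"
proof -
  obtain d \<delta> where d: "d > 0" and \<delta>: "\<delta> > 0" and lm0: "\<forall>X X'. has_periodic_h1_deriv X X' \<longrightarrow> (\<forall>s\<in>{0..2*pi}. norm (X s - X0 s) \<le> d) \<longrightarrow>
     (LINT s|circ. sgn (X s)) = 0 \<longrightarrow>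
     (\<exists>a b. (\<forall>s. norm (harmonic a b s - X0 s) \<le> \<beta> / 2) \<and>
        J X X' \<ge> \<delta> * sqn (\<lambda>s. X s - harmonic a b s))"
    using local_minimum by (elim exE conjE) (rule that)
  note lm = lm0[THEN spec, THEN spec, THEN mp, THEN mp, THEN mp]
  obtain \<epsilon> \<eta> where \<epsilon>: "\<epsilon> > 0" and \<eta>: "\<eta> > 0" and nm: "\<forall>U \<Phi> X'. trial \<epsilon> \<eta> U \<Phi> X' \<longrightarrow>
     (\<exists>\<sigma>. (\<sigma> = 1 \<or> \<sigma> = -1) \<and> (\<forall>s\<in>{0..2*pi}. \<sigma> * \<Phi> s > 0 \<and> norm ((\<sigma> * \<Phi> s) *\<^sub>R U s - X0 s) \<le> d))"
    using near_minimizer[OF d U0] by (elim exE conjE) (rule that)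
  have main: "harmonic_direction \<delta> (J (\<lambda>s. \<Phi> s *\<^sub>R U s) X') U"
    if t: "trial \<epsilon> \<eta> U \<Phi> X'" and closed: "(LINT s|circ. U s) = 0" for U \<Phi> X'
  proof -
    have nU: "\<forall>s. norm (U s) = 1" and X: "has_periodic_h1_deriv (\<lambda>s. \<Phi> s *\<^sub>R U s) X'"
      using t unfolding trial_def near_U0_def by blast+
    obtain \<sigma> where \<sigma>: "\<sigma> = 1 \<or> \<sigma> = -1" and pos: "\<And>s. s \<in> {0..2*pi} \<Longrightarrow> \<sigma> * \<Phi> s > 0"
      and near: "\<And>s. s \<in> {0..2*pi} \<Longrightarrow> norm ((\<sigma> * \<Phi> s) *\<^sub>R U s - X0 s) \<le> d"
      using nm[THEN spec, THEN spec, THEN spec, THEN mp, OF t] by blast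
    define Z where "Z s = \<sigma> *\<^sub>R (\<Phi> s *\<^sub>R U s)" for s
    have Z: "has_periodic_h1_deriv Z (\<lambda>s. \<sigma> *\<^sub>R X' s)" unfolding Z_def by (rule h1_scaleR[OF X])
    have JZ: "J Z (\<lambda>s. \<sigma> *\<^sub>R X' s) = J (\<lambda>s. \<Phi> s *\<^sub>R U s) X'"
      using \<sigma> by (auto simp: J_def Z_def ip_def)
    have sg: "sgn (Z s) = U s" "Z s \<noteq> 0" if s: "s \<in> {0..2*pi}" for s
    proof -
      have Zs: "Z s = (\<sigma> * \<Phi> s) *\<^sub>R U s" by (simp add: Z_def)
      have nz: "U s \<noteq> 0" using nU by (metis norm_zero zero_neq_one)
      show "Z s \<noteq> 0" unfolding Zs scaleR_eq_0_iff using pos[OF s] nz by force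
      have "sgn (Z s) = sgn (\<sigma> * \<Phi> s) *\<^sub>R sgn (U s)" unfolding Zs by (rule sgn_scaleR)
      also have "sgn (U s) = U s" using nU by (simp add: sgn_div_norm)
      finally show "sgn (Z s) = U s" unfolding sgn_pos[OF pos[OF s]] by simp
    qed
    have "(LINT s|circ. sgn (Z s)) = (LINT s|circ. U s)"
      by (rule Bochner_Integration.integral_cong) (use sg in auto)
    then have "(LINT s|circ. sgn (Z s)) = 0" using closed by simp
    then obtain a b where ab: "\<forall>s. norm (harmonic a b s - X0 s) \<le> \<beta> / 2"
        "J Z (\<lambda>s. \<sigma> *\<^sub>R X' s) \<ge> \<delta> * sqn (\<lambda>s. Z s - harmonic a b s)"
      using lm[OF Z] near by (auto simp: Z_def)
    have "continuous_on {0..2*pi} (\<lambda>s. Z s - harmonic a b s)"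
      by (intro continuous_intros h1_cont[OF Z])
    then show ?thesis
      using ab sg unfolding JZ harmonic_direction_def by (intro exI[of _ a] exI[of _ b] exI[of _ "\<lambda>s. Z s - harmonic a b s"]) simp
  qed
  show ?thesis
    by (rule exI[of _ \<epsilon>], rule conjI[OF \<epsilon>], rule exI[of _ \<eta>], rule conjI[OF \<eta>], rule exI[of _ \<delta>], rule conjI[OF \<delta>], intro allI impI)
      (rule main, auto)
qed

text \<open>The remainders tend to zero in the mean, and the first harmonics lie in a compact set, so a
  subsequence of them converges. The direction map is Lipschitz away from zero, so \<open>U\<close> and the direction of the limit
  agree in the mean, hence everywhere by continuity.\<close>

lemma limit_direction:
  assumes U: "continuous_on {0..2*pi} U" and \<delta>: "\<delta> > 0" and \<eta>: "\<eta> > 0"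
    and seq: "\<And>n. harmonic_direction \<delta> (\<eta> / real (Suc n)) U"
  shows "\<exists>a b. (\<forall>s. harmonic a b s \<noteq> 0) \<and> (\<forall>s\<in>{0..2*pi}. U s = sgn (harmonic a b s))"
proof -
  obtain a b V where near: "\<And>n s. norm (harmonic (a n) (b n) s - X0 s) \<le> \<beta> / 2"
    and Vc: "\<And>n. continuous_on {0..2*pi} (V n)" and Vi: "\<And>n. \<delta> * sqn (V n) \<le> \<eta> / real (Suc n)"
    and sg: "\<And>n s. s \<in> {0..2*pi} \<Longrightarrow> harmonic (a n) (b n) s + V n s \<noteq> 0 \<and> sgn (harmonic (a n) (b n) s + V n s) = U s"
    using seq unfolding harmonic_direction_def by metis
  have bd: "norm (harmonic (a n) (b n) s) \<le> 2" for n s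
    using norm_triangle_sub[of "harmonic (a n) (b n) s" "X0 s"] near[of n s] r_le[of s] \<beta> by (simp add: norm_X0)
  have low: "norm (harmonic (a n) (b n) s) \<ge> \<beta> / 2" for n s
    using norm_triangle_sub[of "X0 s" "harmonic (a n) (b n) s"] near[of n s] r_ge[of s] by (simp add: norm_X0 norm_minus_commute)
  have "a n \<in> cball 0 2" "b n \<in> cball 0 2" for n
    using bd[of n 0] bd[of n "pi/2"] by (simp_all add: harmonic_def)
  then have mem: "\<forall>n. (a n, b n) \<in> cball 0 2 \<times> cball 0 2" by simp
  have "compact (cball (0::real^3) 2 \<times> cball (0::real^3) 2)" by (intro compact_Times compact_cball)
  from this[unfolded compact_def, THEN spec, THEN mp, OF mem] obtain l \<tau> where \<tau>: "strict_mono (\<tau>::nat \<Rightarrow> nat)" and l: "((\<lambda>n. (a n, b n)) \<circ> \<tau>) \<longlonglongrightarrow> l"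
    by blast
  obtain a' b' where l': "l = (a', b')" by (cases l)
  have la: "(\<lambda>n. a (\<tau> n)) \<longlonglongrightarrow> a'" and lb: "(\<lambda>n. b (\<tau> n)) \<longlonglongrightarrow> b'"
    using tendsto_fst[OF l] tendsto_snd[OF l] by (simp_all add: l' o_def)
  have lim: "(\<lambda>n. harmonic (a (\<tau> n)) (b (\<tau> n)) s) \<longlonglongrightarrow> harmonic a' b' s" for s
    unfolding harmonic_def by (intro tendsto_intros la lb)
  have low': "norm (harmonic a' b' s) \<ge> \<beta> / 2" for s
    by (rule LIMSEQ_le_const[OF tendsto_norm[OF lim]]) (use low in auto)
  then have nz': "harmonic a' b' s \<noteq> 0" for s using \<beta> by (metis half_gt_zero norm_zero not_le)
  define W where "W s = U s - sgn (harmonic a' b' s)" for s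
  have Wc: "continuous_on {0..2*pi} W"
    unfolding W_def using nz' by (intro continuous_intros U) auto
  define c where "c n = norm (a (\<tau> n) - a') + norm (b (\<tau> n) - b')" for n
  have est: "(norm (W s))\<^sup>2 \<le> 32 / \<beta>\<^sup>2 * ((norm (V (\<tau> n) s))\<^sup>2 + (c n)\<^sup>2)" if s: "s \<in> {0..2*pi}" for s n
  proof -
    let ?F = "harmonic (a (\<tau> n)) (b (\<tau> n)) s"
    have Fnz: "?F \<noteq> 0" using low[of "\<tau> n" s] \<beta> by auto
    have Lip: "norm (sgn ?F - sgn y) \<le> 4 / \<beta> * norm (?F - y)" if "y \<noteq> 0" for y
    proof -
      have "norm (sgn ?F - sgn y) \<le> 2 * norm (?F - y) / norm ?F" by (rule sgn_Lipschitz[OF Fnz that])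
      also have "\<dots> \<le> 2 * norm (?F - y) / (\<beta> / 2)" using low[of "\<tau> n" s] \<beta> by (intro divide_left_mono) (auto intro!: mult_pos_pos simp: Fnz)
      finally show ?thesis by simp
    qed
    have "W s = (sgn (?F + V (\<tau> n) s) - sgn ?F) + (sgn ?F - sgn (harmonic a' b' s))"
      using sg[OF s, of "\<tau> n"] by (simp add: W_def)
    then have "norm (W s) \<le> norm (sgn ?F - sgn (?F + V (\<tau> n) s)) + norm (sgn ?F - sgn (harmonic a' b' s))"
      using norm_triangle_ineq by (metis norm_minus_commute)
    also have "\<dots> \<le> 4 / \<beta> * norm (V (\<tau> n) s) + 4 / \<beta> * norm (?F - harmonic a' b' s)"
      using Lip[of "?F + V (\<tau> n) s"] Lip[OF nz'[of s]] sg[OF s, of "\<tau> n"] by simp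
    also have "norm (?F - harmonic a' b' s) \<le> c n"
    proof -
      have "?F - harmonic a' b' s = cos s *\<^sub>R (a (\<tau> n) - a') + sin s *\<^sub>R (b (\<tau> n) - b')" by (simp add: harmonic_def algebra_simps)
      then have "norm (?F - harmonic a' b' s) \<le> \<bar>cos s\<bar> * norm (a (\<tau> n) - a') + \<bar>sin s\<bar> * norm (b (\<tau> n) - b')"
        using norm_triangle_ineq[of "cos s *\<^sub>R (a (\<tau> n) - a')" "sin s *\<^sub>R (b (\<tau> n) - b')"] by simp
      also have "\<dots> \<le> 1 * norm (a (\<tau> n) - a') + 1 * norm (b (\<tau> n) - b')" by (intro add_mono mult_right_mono) auto
      finally show ?thesis by (simp add: c_def)
    qed
    finally have "norm (W s) \<le> 4 / \<beta> * (norm (V (\<tau> n) s) + c n)"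
      using \<beta> by (simp add: distrib_left mult_left_mono divide_right_mono)
    then have "(norm (W s))\<^sup>2 \<le> (4 / \<beta> * (norm (V (\<tau> n) s) + c n))\<^sup>2" by (rule power_mono) simp
    also have "\<dots> = 16 / \<beta>\<^sup>2 * (norm (V (\<tau> n) s) + c n)\<^sup>2" unfolding power_mult_distrib power_divide by simp
    also have "\<dots> \<le> 16 / \<beta>\<^sup>2 * (2 * ((norm (V (\<tau> n) s))\<^sup>2 + (c n)\<^sup>2))"
    proof (rule mult_left_mono)
      have "(norm (V (\<tau> n) s) + c n)\<^sup>2 = 2 * ((norm (V (\<tau> n) s))\<^sup>2 + (c n)\<^sup>2) - (norm (V (\<tau> n) s) - c n)\<^sup>2"
        by (simp add: power2_eq_square algebra_simps)
      then show "(norm (V (\<tau> n) s) + c n)\<^sup>2 \<le> 2 * ((norm (V (\<tau> n) s))\<^sup>2 + (c n)\<^sup>2)" by simp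
    qed simp
    finally show ?thesis by simp
  qed
  have "sqn W \<le> 32 / \<beta>\<^sup>2 * (\<eta> / \<delta> / real (Suc (\<tau> n)) + 2 * pi * (c n)\<^sup>2)" for n
  proof -
    have iV: "integrable circ (\<lambda>s. (norm (V (\<tau> n) s))\<^sup>2)" by (intro integrable_circ_cont continuous_intros Vc)
    have "sqn W \<le> (LINT s|circ. 32 / \<beta>\<^sup>2 * ((norm (V (\<tau> n) s))\<^sup>2 + (c n)\<^sup>2))"
      unfolding ip_self
    proof (rule integral_mono)
      show "integrable circ (\<lambda>s. (norm (W s))\<^sup>2)" by (intro integrable_circ_cont continuous_intros Wc)
    qed (use iV est in auto)
    also have "\<dots> = 32 / \<beta>\<^sup>2 * (sqn (V (\<tau> n)) + 2 * pi * (c n)\<^sup>2)"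
      using iV by (simp add: ip_self)
    also have "\<dots> \<le> 32 / \<beta>\<^sup>2 * (\<eta> / \<delta> / real (Suc (\<tau> n)) + 2 * pi * (c n)\<^sup>2)"
    proof -
      have "sqn (V (\<tau> n)) \<le> \<eta> / real (Suc (\<tau> n)) / \<delta>"
        unfolding pos_le_divide_eq[OF \<delta>] using Vi[of "\<tau> n"] by (simp only: mult.commute)
      then have "sqn (V (\<tau> n)) \<le> \<eta> / \<delta> / real (Suc (\<tau> n))"
        by (simp only: divide_divide_eq_left mult.commute)
      then show ?thesis by (intro mult_left_mono add_right_mono) auto
    qed
    finally show ?thesis .
  qed
  moreover have "(\<lambda>n. 32 / \<beta>\<^sup>2 * (\<eta> / \<delta> / real (Suc (\<tau> n)) + 2 * pi * (c n)\<^sup>2)) \<longlonglongrightarrow> 32 / \<beta>\<^sup>2 * (0 + 2 * pi * 0\<^sup>2)"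
  proof (intro tendsto_intros)
    have "(\<lambda>n. \<eta> / \<delta> / real (Suc n)) \<longlonglongrightarrow> 0" by (rule LIMSEQ_Suc[OF lim_const_over_n])
    from LIMSEQ_subseq_LIMSEQ[OF this \<tau>] show "(\<lambda>n. \<eta> / \<delta> / real (Suc (\<tau> n))) \<longlonglongrightarrow> 0" by (simp add: o_def)
    have "(\<lambda>n. norm (a (\<tau> n) - a') + norm (b (\<tau> n) - b')) \<longlonglongrightarrow> norm (a' - a') + norm (b' - b')"
      by (intro tendsto_intros la lb)
    then show "c \<longlonglongrightarrow> 0" by (simp add: c_def[abs_def])
  qed
  ultimately have "sqn W \<le> 32 / \<beta>\<^sup>2 * (0 + 2 * pi * 0\<^sup>2)"
    by (intro LIMSEQ_le_const) auto
  then have "sqn W = 0" using ip_self_nonneg[of W] by simp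
  then have "W s = 0" if "s \<in> {0..2*pi}" for s using ip_zero_imp_zero[OF Wc _ that] by simp
  then show ?thesis using nz' by (intro exI[of _ a'] exI[of _ b']) (simp add: W_def)
qed

lemma nonvanishing_harmonic_independent:
  fixes a b :: "real^3"
  assumes nz: "\<And>s. harmonic a b s \<noteq> 0"
  shows "a \<noteq> b \<and> independent {a, b}"
  unfolding independent_pair_iff
proof (intro allI impI)
  fix x y assume e: "x *\<^sub>R a + y *\<^sub>R b = 0"
  show "x = 0 \<and> y = 0"
  proof (rule ccontr)
    assume "\<not> (x = 0 \<and> y = 0)"
    then have p: "x\<^sup>2 + y\<^sup>2 > 0" by (simp add: sum_power2_gt_zero_iff)
    define \<rho>' where "\<rho>' = sqrt (x\<^sup>2 + y\<^sup>2)"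
    have \<rho>': "\<rho>' > 0" "\<rho>'\<^sup>2 = x\<^sup>2 + y\<^sup>2" using p by (simp_all add: \<rho>'_def)
    have "(x / \<rho>')\<^sup>2 + (y / \<rho>')\<^sup>2 = 1" unfolding power_divide \<rho>'(2) add_divide_distrib[symmetric]
      by (rule divide_self[OF less_imp_neq[OF p, symmetric]])
    then obtain t where t: "x / \<rho>' = cos t" "y / \<rho>' = sin t" by (metis sincos_total_2pi)
    have "harmonic a b t = (x *\<^sub>R a + y *\<^sub>R b) /\<^sub>R \<rho>'"
      unfolding harmonic_def t[symmetric] by (simp add: scaleR_add_right divide_inverse mult.commute)
    then show False using nz[of t] e by simp
  qed
qed

text \<open>A Rayleigh quotient \<open>Q\<close> close to 1 gives, for the test function scaled to the norm of \<open>r\<close>, the value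
  \<open>J = (Q - 1) \<integral>r\<^sup>2\<close>. Then \<open>near_critical_decomposition\<close> excludes \<open>Q < 1\<close>, and if the infimum is 1 it
  applies along a minimising sequence and leads to \<open>limit_direction\<close>.\<close>

lemma e0_near:
  assumes U0: "U0 \<in> periodic_h1"
  shows "\<exists>\<epsilon>>0. \<forall>\<gamma>. arclength_loop \<gamma> \<longrightarrow> near_U0 \<epsilon> (tangent \<gamma>) (h1_deriv (tangent \<gamma>)) \<longrightarrow>
     e0 \<gamma> \<ge> 1 \<and> (\<gamma> \<notin> family_F \<longrightarrow> e0 \<gamma> > 1)"
proof -
  obtain \<epsilon> \<eta> \<delta> where \<epsilon>: "\<epsilon> > 0" and \<eta>: "\<eta> > 0" and \<delta>: "\<delta> > 0"
    and dec: "\<forall>U \<Phi> X'. trial \<epsilon> \<eta> U \<Phi> X' \<longrightarrow> (LINT s|circ. U s) = 0 \<longrightarrow>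
     harmonic_direction \<delta> (J (\<lambda>s. \<Phi> s *\<^sub>R U s) X') U"
    using near_critical_decomposition[OF U0] by (elim exE conjE) (rule that)
  have main: "e0 \<gamma> \<ge> 1 \<and> (\<gamma> \<notin> family_F \<longrightarrow> e0 \<gamma> > 1)"
    if loop: "arclength_loop \<gamma>" and near: "near_U0 \<epsilon> (tangent \<gamma>) (h1_deriv (tangent \<gamma>))" for \<gamma>
  proof -
    let ?U = "tangent \<gamma>"
    let ?S = "{\<Phi> :: real \<Rightarrow> real. \<Phi> \<in> periodic_h1 \<and> \<Phi> \<noteq> (\<lambda>_. 0)}"
    let ?Q = "\<lambda>\<Phi>. (LINT s:{0..2*pi}|lborel. (h1_deriv \<Phi> s)\<^sup>2 + (curvature \<gamma> s)\<^sup>2 * (\<Phi> s)\<^sup>2) / (LINT s:{0..2*pi}|lborel. (\<Phi> s)\<^sup>2)"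
    have U: "has_periodic_h1_deriv ?U (h1_deriv ?U)" using near unfolding near_U0_def by blast
    then have h1: "?U \<in> periodic_h1" by (rule periodic_h1I)
    have nU: "norm (?U s) = 1" for s using loop by (simp add: arclength_loop_def)
    have closed: "(LINT s|circ. ?U s) = 0" by (rule loop_tangent_integral[OF loop h1_cont[OF U]])
    have dec': "harmonic_direction \<delta> (sqn r * (?Q \<Phi> - 1)) ?U"
      if \<Phi>S: "\<Phi> \<in> ?S" and Q: "sqn r * (?Q \<Phi> - 1) \<le> \<eta>" for \<Phi>
    proof -
      have \<Phi>h: "\<Phi> \<in> periodic_h1" using \<Phi>S by simp
      note \<Phi> = periodic_h1_deriv[OF \<Phi>h]
      have p: "ip \<Phi> \<Phi> > 0" by (rule ip_pos[OF \<Phi>]) (use \<Phi>S in auto)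
      define t where "t = sqrt (sqn r / ip \<Phi> \<Phi>)"
      have t2: "t * t = sqn r / ip \<Phi> \<Phi>" using p ip_r_pos by (simp add: t_def)
      obtain X' where X: "has_periodic_h1_deriv (\<lambda>s. \<Phi> s *\<^sub>R ?U s) X'"
        using h1_prod[OF bounded_bilinear_scaleR \<Phi> U] by blast
      have q: "?Q \<Phi> = sqn X' / ip \<Phi> \<Phi>" by (rule rayleigh_num[OF h1 nU \<Phi>h X])
      have \<Psi>: "has_periodic_h1_deriv (\<lambda>s. t *\<^sub>R \<Phi> s) (\<lambda>s. t *\<^sub>R h1_deriv \<Phi> s)" by (rule h1_scaleR[OF \<Phi>])
      have n\<Psi>: "sqn (\<lambda>s. t *\<^sub>R \<Phi> s) = sqn r"
        unfolding ip_scaleR_left ip_scaleR_right mult.assoc[symmetric] t2 using p by simp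
      have "has_periodic_h1_deriv (\<lambda>s. t *\<^sub>R (\<Phi> s *\<^sub>R ?U s)) (\<lambda>s. t *\<^sub>R X' s)" by (rule h1_scaleR[OF X])
      then have Y: "has_periodic_h1_deriv (\<lambda>s. (t *\<^sub>R \<Phi> s) *\<^sub>R ?U s) (\<lambda>s. t *\<^sub>R X' s)" by simp
      have "sqn (\<lambda>s. (t *\<^sub>R \<Phi> s) *\<^sub>R ?U s) = sqn r"
        unfolding scaled_unit_field(3)[OF U nU \<Psi> Y] by (rule n\<Psi>)
      then have JQ: "J (\<lambda>s. (t *\<^sub>R \<Phi> s) *\<^sub>R ?U s) (\<lambda>s. t *\<^sub>R X' s) = sqn r * (?Q \<Phi> - 1)"
        unfolding J_def ip_scaleR_left ip_scaleR_right mult.assoc[symmetric] t2 q by (simp add: right_diff_distrib)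
      have tr: "trial \<epsilon> \<eta> ?U (\<lambda>s. t *\<^sub>R \<Phi> s) (\<lambda>s. t *\<^sub>R X' s)"
        unfolding trial_def JQ using near periodic_h1I[OF \<Psi>] n\<Psi> Y Q by blast
      show ?thesis
        using dec[THEN spec, THEN spec, THEN spec, THEN mp, THEN mp, OF tr closed] unfolding JQ .
    qed
    have r_in: "r \<in> ?S"
      using periodic_h1I[OF h1_r] r_pos(2) by (auto dest: fun_cong)
    have Q0: "?Q \<Phi> \<ge> 1" if "\<Phi> \<in> ?S" for \<Phi>
    proof (rule ccontr)
      assume "\<not> ?Q \<Phi> \<ge> 1"
      then have neg: "sqn r * (?Q \<Phi> - 1) < 0" using ip_r_pos by (simp add: mult_pos_neg)
      then have "sqn r * (?Q \<Phi> - 1) \<le> \<eta>" using \<eta> by linarith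
      from dec'[OF that this] obtain V :: "real \<Rightarrow> real^3" where "\<delta> * sqn V \<le> sqn r * (?Q \<Phi> - 1)"
        unfolding harmonic_direction_def by blast
      moreover have "\<delta> * sqn V \<ge> 0" using \<delta> ip_self_nonneg[of V] by simp
      ultimately show False using neg by linarith
    qed
    have e0: "e0 \<gamma> = (INF \<Phi> \<in> ?S. ?Q \<Phi>)" by (simp add: e0_def)
    have ge: "e0 \<gamma> \<ge> 1" unfolding e0 by (rule cINF_greatest) (use r_in Q0 in auto)
    moreover have "\<gamma> \<in> family_F" if le: "e0 \<gamma> \<le> 1"
    proof -
      have "harmonic_direction \<delta> (\<eta> / real (Suc n)) ?U" for n
      proof -
        have pos: "\<eta> / real (Suc n) / sqn r > 0" using \<eta> ip_r_pos by simp
        have "(INF \<Phi> \<in> ?S. ?Q \<Phi>) < 1 + \<eta> / real (Suc n) / sqn r" using le pos unfolding e0 by linarith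
        moreover have "bdd_below (?Q ` ?S)" using Q0 by (intro bdd_belowI2[of _ 1]) auto
        ultimately obtain \<Phi> where \<Phi>: "\<Phi> \<in> ?S" and lt: "?Q \<Phi> < 1 + \<eta> / real (Suc n) / sqn r"
          using cINF_less_iff[of ?S ?Q] r_in by blast
        have "sqn r * (?Q \<Phi> - 1) \<le> sqn r * (\<eta> / real (Suc n) / sqn r)"
          using lt ip_r_pos by (intro mult_left_mono) auto
        also have "\<dots> = \<eta> / real (Suc n)" using ip_r_pos by simp
        finally have 1: "sqn r * (?Q \<Phi> - 1) \<le> \<eta> / real (Suc n)" .
        also have "\<dots> \<le> \<eta>" using \<eta> by (simp add: divide_le_eq)
        finally have "sqn r * (?Q \<Phi> - 1) \<le> \<eta>" .
        from dec'[OF \<Phi> this] 1 show ?thesis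
          unfolding harmonic_direction_def by (meson order_trans)
      qed
      from limit_direction[OF h1_cont[OF U] \<delta> \<eta> this]
      obtain a b where nz: "\<And>s. harmonic a b s \<noteq> 0" and eq: "\<And>s. s \<in> {0..2*pi} \<Longrightarrow> ?U s = sgn (harmonic a b s)"
        by blast
      have "?U s = sgn (harmonic a b s)" for s
      proof (rule periodic_eq[of ?U "\<lambda>s. sgn (harmonic a b s)"])
        show "?U (s + 2 * pi) = ?U s" for s by (rule h1_periodic[OF U])
        show "sgn (harmonic a b (s + 2 * pi)) = sgn (harmonic a b s)" for s by (simp add: harmonic_def)
      qed (rule eq)
      then have "\<forall>s. ?U s = (cos s *\<^sub>R a + sin s *\<^sub>R b) /\<^sub>R norm (cos s *\<^sub>R a + sin s *\<^sub>R b)"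
        by (simp only: harmonic_def sgn_div_norm) simp
      then show ?thesis
        unfolding family_F_def Let_def using loop nonvanishing_harmonic_independent[OF nz] by blast
    qed
    ultimately show ?thesis by fastforce
  qed
  show ?thesis
    by (rule exI[of _ \<epsilon>], rule conjI[OF \<epsilon>], intro allI impI) (rule main, auto)
qed

text \<open>The test function \<open>r = |X\<^sub>0|\<close> has Rayleigh quotient 1, because \<open>r U0 = X0\<close> is a first harmonic.\<close>

lemma e0_base_le:
  assumes loop: "arclength_loop \<gamma>" and h1: "tangent \<gamma> \<in> periodic_h1" and t: "tangent \<gamma> = U0"
  shows "e0 \<gamma> \<le> 1"
proof -
  let ?S = "{\<Phi> :: real \<Rightarrow> real. \<Phi> \<in> periodic_h1 \<and> \<Phi> \<noteq> (\<lambda>_. 0)}"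
  let ?Q = "\<lambda>\<Phi>. (LINT s:{0..2*pi}|lborel. (h1_deriv \<Phi> s)\<^sup>2 + (curvature \<gamma> s)\<^sup>2 * (\<Phi> s)\<^sup>2) / (LINT s:{0..2*pi}|lborel. (\<Phi> s)\<^sup>2)"
  have nU: "norm (tangent \<gamma> s) = 1" for s using loop by (simp add: arclength_loop_def)
  have r_in: "r \<in> ?S" using periodic_h1I[OF h1_r] r_pos(2) by (auto dest: fun_cong)
  obtain a b where X0: "X0 = harmonic a b" using X0_harmonic by blast
  have rU: "(\<lambda>s. r s *\<^sub>R tangent \<gamma> s) = harmonic a b" unfolding t U0_scaled X0[symmetric] ..
  have X: "has_periodic_h1_deriv (\<lambda>s. r s *\<^sub>R tangent \<gamma> s) (harmonic b (- a))" unfolding rU by (rule h1_harmonic)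
  have "sqn (harmonic a b) = sqn r"
    using scaled_unit_field(3)[OF periodic_h1_deriv[OF h1] nU h1_r X] unfolding rU .
  then have "sqn (harmonic b (- a)) = sqn r" using J_harmonic[of a b] by (simp add: J_def)
  then have "?Q r = 1"
    using rayleigh_num[OF h1 nU periodic_h1I[OF h1_r] X] ip_r_pos by simp
  moreover have "bdd_below (?Q ` ?S)"
    by (intro bdd_belowI2[of _ 0]) (auto simp: lebesgue_circ_eq)
  then have "(INF \<Phi> \<in> ?S. ?Q \<Phi>) \<le> ?Q r" using r_in by (rule cINF_lower)
  ultimately show ?thesis by (simp add: e0_def)
qed

end

lemma family_F_framed_oval:
  assumes "\<gamma> \<in> family_F"
  obtains \<beta> s0 e1 e2 e3 where "framed_oval \<beta> e1 e2 e3" "tangent \<gamma> = framed_oval.U0 \<beta> s0 e1 e2"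
proof -
  obtain \<beta> s0 and A :: "real^3^3" where loop: "arclength_loop \<gamma>" and b: "0 < \<beta>" "\<beta> \<le> 1" and A: "rotation_matrix A"
    and tan: "\<And>s. \<exists>\<rho>>0. tangent \<gamma> s = \<rho> *\<^sub>R (A *v vector [cos (s - s0), \<beta> * sin (s - s0), 0])"
    using assms unfolding family_F_iff by blast
  define e1 e2 e3 where "e1 = column 1 A" and "e2 = column 2 A" and "e3 = column 3 A"
  have oA: "orthogonal_matrix A" using A by (simp add: rotation_matrix_def)
  then have on: "e1 \<bullet> e1 = 1" "e2 \<bullet> e2 = 1" "e3 \<bullet> e3 = 1" "e1 \<bullet> e2 = 0" "e1 \<bullet> e3 = 0" "e2 \<bullet> e3 = 0"
    unfolding orthogonal_matrix_orthonormal_columns e1_def e2_def e3_def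
    by (auto simp: orthogonal_def norm_eq_1)
  have span: "v = (v \<bullet> e1) *\<^sub>R e1 + (v \<bullet> e2) *\<^sub>R e2 + (v \<bullet> e3) *\<^sub>R e3" for v :: "real^3"
  proof -
    have "v = (A ** transpose A) *v v" using oA by (simp add: orthogonal_matrix_def)
    also have "\<dots> = A *v (transpose A *v v)" by (rule matrix_vector_mul_assoc[symmetric])
    also have "\<dots> = (v \<bullet> e1) *\<^sub>R e1 + (v \<bullet> e2) *\<^sub>R e2 + (v \<bullet> e3) *\<^sub>R e3"
      by (simp add: vec_eq_iff matrix_vector_mult_def transpose_def e1_def e2_def e3_def column_def inner_vec_def sum_3 algebra_simps)
    finally show ?thesis .
  qed
  have f: "framed_oval \<beta> e1 e2 e3" by unfold_locales (use b on span in auto)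
  then interpret framed_oval \<beta> s0 e1 e2 e3 .
  have "tangent \<gamma> s = U0 s" for s
  proof -
    obtain \<rho>' where r: "\<rho>' > 0" "tangent \<gamma> s = \<rho>' *\<^sub>R (A *v vector [cos (s - s0), \<beta> * sin (s - s0), 0])"
      using tan by blast
    have "A *v vector [cos (s - s0), \<beta> * sin (s - s0), 0] = X0 s"
      unfolding X0_def matrix_vector_mult_vector3 by (simp add: e1_def e2_def)
    then have ts: "tangent \<gamma> s = \<rho>' *\<^sub>R X0 s" using r by simp
    have "tangent \<gamma> s = sgn (tangent \<gamma> s)" using loop by (simp add: arclength_loop_def sgn_div_norm)
    also have "\<dots> = sgn (X0 s)" unfolding ts sgn_scaleR using r by simp
    finally show ?thesis by (simp add: U0_def)
  qed
  then have "tangent \<gamma> = U0" by auto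
  with f show ?thesis using that by blast
qed

lemma h1_norm_sq_bounds:
  fixes f :: "real \<Rightarrow> 'a::euclidean_space"
  assumes f: "f \<in> periodic_h1"
  shows "sqn f \<le> (h1_norm f)\<^sup>2" "sqn (h1_deriv f) \<le> (h1_norm f)\<^sup>2"
proof -
  have "(h1_norm f)\<^sup>2 = sqn f + sqn (h1_deriv f)"
    unfolding h1_norm_def lebesgue_circ_eq ip_self by (rule real_sqrt_pow2) (simp add: add_nonneg_nonneg)
  then show "sqn f \<le> (h1_norm f)\<^sup>2" "sqn (h1_deriv f) \<le> (h1_norm f)\<^sup>2"
    using ip_self_nonneg[of f] ip_self_nonneg[of "h1_deriv f"] by auto
qed

theorem theorem1p1:
  fixes \<gamma> :: "real \<Rightarrow> real \<Rightarrow> real^3" and u\<^sub>1 u\<^sub>2 :: "real \<Rightarrow> real^3"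
  assumes "\<gamma> 0 \<in> family_F"
    and "\<forall>\<^sub>F \<mu> in nhds 0. arclength_loop (\<gamma> \<mu>) \<and> tangent (\<gamma> \<mu>) \<in> periodic_h1"
    and "u\<^sub>1 \<in> periodic_h1" and "u\<^sub>2 \<in> periodic_h1"
    and "(\<lambda>\<mu>. h1_norm (\<lambda>s. tangent (\<gamma> \<mu>) s
                - (tangent (\<gamma> 0) s + \<mu> *\<^sub>R u\<^sub>1 s + \<mu>\<^sup>2 *\<^sub>R u\<^sub>2 s))) \<in> o[at 0](\<lambda>\<mu>. \<mu>\<^sup>2)"
  shows "\<exists>c>0. \<forall>\<mu>. \<bar>\<mu>\<bar> < c \<longrightarrow>
           e0 (\<gamma> \<mu>) \<ge> e0 (\<gamma> 0) \<and> (\<gamma> \<mu> \<notin> family_F \<longrightarrow> e0 (\<gamma> \<mu>) > e0 (\<gamma> 0))"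
proof -
  obtain \<beta> s0 e1 e2 e3 where fr: "framed_oval \<beta> e1 e2 e3" and t0: "tangent (\<gamma> 0) = framed_oval.U0 \<beta> s0 e1 e2"
    using family_F_framed_oval[OF assms(1)] by metis
  interpret framed_oval \<beta> s0 e1 e2 e3 by (rule fr)
  \<comment> \<open>All hypotheses on the loops also hold at \<open>\<mu> = 0\<close>, which lies in every neighbourhood.\<close>
  have base: "arclength_loop (\<gamma> 0)" "tangent (\<gamma> 0) \<in> periodic_h1"
    using eventually_nhds_x_imp_x[OF assms(2)] by auto
  have U0h: "U0 \<in> periodic_h1" using base t0 by simp
  have e00: "e0 (\<gamma> 0) \<le> 1" by (rule e0_base_le[OF base t0])
  obtain \<epsilon> where \<epsilon>: "\<epsilon> > 0" and near: "\<forall>\<gamma>. arclength_loop \<gamma> \<longrightarrow> near_U0 \<epsilon> (tangent \<gamma>) (h1_deriv (tangent \<gamma>)) \<longrightarrow>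
     e0 \<gamma> \<ge> 1 \<and> (\<gamma> \<notin> family_F \<longrightarrow> e0 \<gamma> > 1)"
    using e0_near[OF U0h] by (elim exE conjE) (rule that)
  \<comment> \<open>Bounds the square norm of \<open>F + \<mu> f1 + \<mu>\<^sup>2 f2\<close> when \<open>F\<close> has norm at most \<open>\<mu>\<^sup>2\<close>; it serves for the tangents and for their derivatives.\<close>
  define K where "K f1 f2 \<mu> = 2 * (\<mu>\<^sup>2)\<^sup>2 + 2 * (2 * (\<mu> * (\<mu> * sqn f1)) + 2 * (\<mu>\<^sup>2 * (\<mu>\<^sup>2 * sqn f2)))" for f1 f2 :: "real \<Rightarrow> real^3" and \<mu>
  have Kev: "\<forall>\<^sub>F \<mu> in at 0. K f1 f2 \<mu> < \<epsilon>\<^sup>2" for f1 f2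
  proof -
    have "(K f1 f2 \<longlongrightarrow> K f1 f2 0) (at 0)" unfolding K_def by (intro tendsto_intros)
    moreover have "K f1 f2 0 = 0" by (simp add: K_def)
    ultimately show ?thesis using \<epsilon> by (simp add: order_tendsto_iff)
  qed
  have small: "\<forall>\<^sub>F \<mu> in at 0. norm (h1_norm (\<lambda>s. tangent (\<gamma> \<mu>) s - (tangent (\<gamma> 0) s + \<mu> *\<^sub>R u\<^sub>1 s + \<mu>\<^sup>2 *\<^sub>R u\<^sub>2 s))) \<le> 1 * norm (\<mu>\<^sup>2)"
    by (rule landau_o.smallD[OF assms(5)]) simp
  have ev: "\<forall>\<^sub>F \<mu> in at 0. arclength_loop (\<gamma> \<mu>) \<and> tangent (\<gamma> \<mu>) \<in> periodic_h1"
    using assms(2) by (auto simp: eventually_at_filter elim: eventually_mono)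
  have "\<forall>\<^sub>F \<mu> in at 0. e0 (\<gamma> \<mu>) \<ge> 1 \<and> (\<gamma> \<mu> \<notin> family_F \<longrightarrow> e0 (\<gamma> \<mu>) > 1)"
    using ev small Kev[of u\<^sub>1 u\<^sub>2] Kev[of "h1_deriv u\<^sub>1" "h1_deriv u\<^sub>2"]
  proof eventually_elim
    case (elim \<mu>)
    note hU = periodic_h1_deriv[OF conjunct2[OF elim(1)]] and hU0 = periodic_h1_deriv[OF U0h]
      and hu = periodic_h1_deriv[OF assms(3)] periodic_h1_deriv[OF assms(4)]
    define R where "R s = tangent (\<gamma> \<mu>) s - (tangent (\<gamma> 0) s + \<mu> *\<^sub>R u\<^sub>1 s + \<mu>\<^sup>2 *\<^sub>R u\<^sub>2 s)" for s
    have hp: "has_periodic_h1_deriv (\<lambda>s. \<mu> *\<^sub>R u\<^sub>1 s + \<mu>\<^sup>2 *\<^sub>R u\<^sub>2 s) (\<lambda>s. \<mu> *\<^sub>R h1_deriv u\<^sub>1 s + \<mu>\<^sup>2 *\<^sub>R h1_deriv u\<^sub>2 s)"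
      by (intro h1_add h1_scaleR hu)
    have hR: "R \<in> periodic_h1"
    proof (rule periodic_h1I)
      show "has_periodic_h1_deriv R (\<lambda>s. (h1_deriv (tangent (\<gamma> \<mu>)) s - h1_deriv U0 s) - (\<mu> *\<^sub>R h1_deriv u\<^sub>1 s + \<mu>\<^sup>2 *\<^sub>R h1_deriv u\<^sub>2 s))"
        using h1_diff[OF h1_diff[OF hU hU0] hp] by (simp add: R_def[abs_def] t0 algebra_simps)
    qed
    have hRd: "has_periodic_h1_deriv R (h1_deriv R)" by (rule periodic_h1_deriv[OF hR])
    have nR: "(h1_norm R)\<^sup>2 \<le> (\<mu>\<^sup>2)\<^sup>2"
    proof -
      have "\<bar>h1_norm R\<bar> \<le> \<mu>\<^sup>2" using elim(2) by (simp add: R_def[abs_def])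
      then show ?thesis using power_mono[of "\<bar>h1_norm R\<bar>" "\<mu>\<^sup>2" 2] by simp
    qed
    have bound: "sqn (\<lambda>s. F s + (\<mu> *\<^sub>R f1 s + \<mu>\<^sup>2 *\<^sub>R f2 s)) \<le> K f1 f2 \<mu>"
      if s: "sq_int F" "sq_int f1" "sq_int f2" and F: "sqn F \<le> (\<mu>\<^sup>2)\<^sup>2" for F f1 f2
    proof -
      note s' = sq_int_scaleR[OF s(2), of \<mu>] sq_int_scaleR[OF s(3), of "\<mu>\<^sup>2"]
      have "sqn (\<lambda>s. F s + (\<mu> *\<^sub>R f1 s + \<mu>\<^sup>2 *\<^sub>R f2 s))
        \<le> 2 * sqn F + 2 * sqn (\<lambda>s. \<mu> *\<^sub>R f1 s + \<mu>\<^sup>2 *\<^sub>R f2 s)"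
        by (rule ip_sq_add_le[OF s(1) sq_int_add[OF s']])
      also have "\<dots> \<le> 2 * (\<mu>\<^sup>2)\<^sup>2 + 2 * (2 * sqn (\<lambda>s. \<mu> *\<^sub>R f1 s) + 2 * sqn (\<lambda>s. \<mu>\<^sup>2 *\<^sub>R f2 s))"
        using F ip_sq_add_le[OF s'] by (intro add_mono mult_left_mono) auto
      finally show ?thesis unfolding K_def ip_scaleR_left ip_scaleR_right .
    qed
    have D: "(\<lambda>s. tangent (\<gamma> \<mu>) s - U0 s) = (\<lambda>s. R s + (\<mu> *\<^sub>R u\<^sub>1 s + \<mu>\<^sup>2 *\<^sub>R u\<^sub>2 s))"
      by (simp add: R_def t0)
    have "sqn (\<lambda>s. tangent (\<gamma> \<mu>) s - U0 s) \<le> K u\<^sub>1 u\<^sub>2 \<mu>"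
      unfolding D using h1_norm_sq_bounds(1)[OF hR] nR
      by (intro bound h1_sq_int[OF hRd] h1_sq_int[OF hu(1)] h1_sq_int[OF hu(2)]) linarith
    then have 1: "sqn (\<lambda>s. tangent (\<gamma> \<mu>) s - U0 s) \<le> \<epsilon>\<^sup>2" using elim(3) by linarith
    have hD: "has_periodic_h1_deriv (\<lambda>s. tangent (\<gamma> \<mu>) s - U0 s) (\<lambda>s. h1_deriv R s + (\<mu> *\<^sub>R h1_deriv u\<^sub>1 s + \<mu>\<^sup>2 *\<^sub>R h1_deriv u\<^sub>2 s))"
      unfolding D by (rule h1_add[OF hRd hp])
    have "sqn (\<lambda>s. h1_deriv (tangent (\<gamma> \<mu>)) s - h1_deriv U0 s)
      = sqn (\<lambda>s. h1_deriv R s + (\<mu> *\<^sub>R h1_deriv u\<^sub>1 s + \<mu>\<^sup>2 *\<^sub>R h1_deriv u\<^sub>2 s))"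
      by (rule ip_deriv_eq[OF h1_diff[OF hU hU0] hD])
    also have "\<dots> \<le> K (h1_deriv u\<^sub>1) (h1_deriv u\<^sub>2) \<mu>"
      using h1_norm_sq_bounds(2)[OF hR] nR
      by (intro bound h1_sq_int_deriv[OF hRd] h1_sq_int_deriv[OF hu(1)] h1_sq_int_deriv[OF hu(2)]) linarith
    finally have 2: "sqn (\<lambda>s. h1_deriv (tangent (\<gamma> \<mu>)) s - h1_deriv U0 s) \<le> \<epsilon>\<^sup>2"
      using elim(4) by linarith
    have "near_U0 \<epsilon> (tangent (\<gamma> \<mu>)) (h1_deriv (tangent (\<gamma> \<mu>)))"
      unfolding near_U0_def using hU 1 2 elim(1) by (simp add: arclength_loop_def)
    then show ?case using near[THEN spec, THEN mp, THEN mp] elim(1) by blast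
  qed
  then obtain c where c: "c > 0" and nr: "\<And>\<mu>. \<mu> \<noteq> 0 \<Longrightarrow> \<bar>\<mu>\<bar> < c \<Longrightarrow> e0 (\<gamma> \<mu>) \<ge> 1 \<and> (\<gamma> \<mu> \<notin> family_F \<longrightarrow> e0 (\<gamma> \<mu>) > 1)"
    unfolding eventually_at by (auto simp: dist_real_def)
  have "e0 (\<gamma> \<mu>) \<ge> e0 (\<gamma> 0) \<and> (\<gamma> \<mu> \<notin> family_F \<longrightarrow> e0 (\<gamma> \<mu>) > e0 (\<gamma> 0))" if "\<bar>\<mu>\<bar> < c" for \<mu>
  proof (cases "\<mu> = 0")
    case True then show ?thesis using assms(1) by simp
  next
    case False
    from nr[OF this that] e00 show ?thesis by auto
  qed
  with c show ?thesis by blast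
qed

end
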